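(* Let $M^3$ be a hypersurface of Euclidean 4-space $\mathbb E^4$ which is Casorati ideal for the inequality $\rho\le\delta_C(2)$, i.e. $\rho=\delta_C(2)$ at every point of $M^3$. Then $M^3$ is congruent to $$\Big(\tfrac1a\,\mathrm{sd}\big(at,\tfrac1{\sqrt2}\big)\sin u,\ \tfrac1a\,\mathrm{sd}\big(at,\tfrac1{\sqrt2}\big)\cos u\sin v,\ \tfrac1a\,\mathrm{sd}\big(at,\tfrac1{\sqrt2}\big)\cos u\cos v,\ \tfrac12\int_0^t \mathrm{sd}^2\big(a\tau,\tfrac1{\sqrt2}\big)\,d\tau\Big)$$ for some positive real number $a$, where $\mathrm{sd}(\cdot,\cdot)$ denotes Jacobi's elliptic function.
   Context: The displayed expression is the hypersurface of $\mathbb E^4$ parametrized by $(t,u,v)$. $\mathrm{sd}(x,k)=\mathrm{sn}(x,k)/\mathrm{dn}(x,k)$ is the Jacobi elliptic function with modulus $k$ (here $k=1/\sqrt2$). Congruent means equal up to an isometry of $\mathbb E^4$. For a hypersurface $M^3$ of $\mathbb E^4$ with induced metric, let $h_{ij}$ be the components of its (scalar) second fundamental form in an orthonormal tangent frame $e_1,e_2,e_3$. The Casorati curvature is $\mathcal C=\frac13\sum_{i,j=1}^3h_{ij}^2$. For a plane $L\subset T_xM$ with orthonormal basis $e_1,e_2$, $\mathcal C(L)=\frac12\sum_{i,j=1}^2h_{ij}^2$. The normalized $\delta$-Casorati curvature is $$[\delta_C(2)]_x=\tfrac12\,\mathcal C_x+\tfrac23\inf\{\mathcal C(L)\mid L\text{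 a 2-dimensional subspace of }T_xM\}.$$ The normalized scalar curvature is $\rho=\frac13\sum_{i<j}K(e_i\wedge e_j)$, where $K$ is the sectional curvature of $M$. The inequality $\rho\le\delta_C(2)$ holds for every hypersurface of $\mathbb E^4$; hypersurfaces attaining equality are called Casorati ideal for it.
   Formalization: M is assumed connected and not totally geodesic (open parts of hyperplanes are Casorati ideal but fit no a > 0), and "congruent to" the displayed hypersurface is read as congruent to a relatively open portion of it. *)

theory Defs
  imports "HOL-Analysis.Analysis"
begin

section \<open>Smooth maps on open subsets of Euclidean 3-space\<close>

definition pd :: "3 \<Rightarrow> (real^3 \<Rightarrow> 'b::real_normed_vector) \<Rightarrow> real^3 \<Rightarrow> 'b" where
  "pd i f u = frechet_derivative f (at u) (axis i 1)"

primrec iter_pd :: "3 list \<Rightarrow> (real^3 \<Rightarrow> 'b::real_normed_vector) \<Rightarrow> real^3 \<Rightarrow> 'b" where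
  "iter_pd [] f = f"
| "iter_pd (i # is) f = pd i (iter_pd is f)"

text \<open>Being of class C-infinity, for open sets: all iterated partial derivatives exist and are
  again (totally) differentiable.\<close>

definition smooth_on :: "(real^3) set \<Rightarrow> (real^3 \<Rightarrow> 'b::real_normed_vector) \<Rightarrow> bool" where
  "smooth_on U f \<longleftrightarrow> open U \<and> (\<forall>is. iter_pd is f differentiable_on U)"

section \<open>Hypersurfaces of Euclidean 4-space\<close>

text \<open>A hypersurface is a 3-manifold \<open>M\<close> with an immersion \<open>\<iota>\<close> into \<open>real^4\<close>.  Since \<open>\<iota>\<close> is an
  immersion, the differentiable structure of \<open>M\<close> is determined by \<open>\<iota>\<close> and the topology of \<open>M\<close>: the
  inverses of its charts are exactly the maps \<open>x\<close> below, and changes of parameters are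
  automatically smooth.  Self-intersections are allowed; embedded hypersurfaces are the
  case \<open>M = top_of_set S\<close>, \<open>\<iota> = id\<close>.\<close>

definition local_param ::
    "'a topology \<Rightarrow> ('a \<Rightarrow> real^4) \<Rightarrow> (real^3) set \<Rightarrow> (real^3 \<Rightarrow> 'a) \<Rightarrow> bool" where
  "local_param M \<iota> U x \<longleftrightarrow>
     open U \<and> embedding_map (top_of_set U) M x \<and> openin M (x ` U) \<and>
     smooth_on U (\<iota> \<circ> x) \<and>
     (\<forall>u\<in>U. inj (frechet_derivative (\<iota> \<circ> x) (at u)))"

definition hypersurface :: "'a topology \<Rightarrow> ('a \<Rightarrow> real^4) \<Rightarrow> bool" where
  "hypersurface M \<iota> \<longleftrightarrow>
     Hausdorff_space M \<and> second_countable M \<and>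
     (\<forall>p\<in>topspace M. \<exists>U x. local_param M \<iota> U x \<and> p \<in> x ` U)"

section \<open>Riemannian metrics in local coordinates\<close>

text \<open>A metric is given by its coefficient matrix \<open>g u $ i $ j\<close>; tangent vectors at \<open>u\<close> are
  given by their components with respect to the coordinate frame, so that the tangent space
  at \<open>u\<close> is \<open>real^3\<close> with the inner product \<open>inner_at g u\<close>.\<close>

definition inner_at :: "(real^3 \<Rightarrow> real^3^3) \<Rightarrow> real^3 \<Rightarrow> real^3 \<Rightarrow> real^3 \<Rightarrow> real" where
  "inner_at g u a b = (\<Sum>i\<in>UNIV. \<Sum>j\<in>UNIV. g u $ i $ j * a $ i * b $ j)"

definition christoffel :: "(real^3 \<Rightarrow> real^3^3) \<Rightarrow> 3 \<Rightarrow> 3 \<Rightarrow> 3 \<Rightarrow> real^3 \<Rightarrow> real" where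
  "christoffel g k i j u =
     1/2 * (\<Sum>l\<in>UNIV. matrix_inv (g u) $ k $ l *
       (pd i (\<lambda>w. g w $ j $ l) u + pd j (\<lambda>w. g w $ i $ l) u - pd l (\<lambda>w. g w $ i $ j) u))"

text \<open>\<open>riemann g l i j k u\<close> is the \<open>l\<close>-th component of \<open>R(\<partial>\<^sub>i, \<partial>\<^sub>j)\<partial>\<^sub>k\<close>, where
  \<open>R(X,Y)Z = \<nabla>\<^sub>X\<nabla>\<^sub>YZ - \<nabla>\<^sub>Y\<nabla>\<^sub>XZ - \<nabla>\<^bsub>[X,Y]\<^esub>Z\<close> for the Levi-Civita connection \<open>\<nabla>\<close> of \<open>g\<close>.\<close>

definition riemann :: "(real^3 \<Rightarrow> real^3^3) \<Rightarrow> 3 \<Rightarrow> 3 \<Rightarrow> 3 \<Rightarrow> 3 \<Rightarrow> real^3 \<Rightarrow> real" where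
  "riemann g l i j k u =
     pd i (christoffel g l j k) u - pd j (christoffel g l i k) u
     + (\<Sum>m\<in>UNIV. christoffel g m j k u * christoffel g l i m u
                 - christoffel g m i k u * christoffel g l j m u)"

definition curvature_op ::
    "(real^3 \<Rightarrow> real^3^3) \<Rightarrow> real^3 \<Rightarrow> real^3 \<Rightarrow> real^3 \<Rightarrow> real^3 \<Rightarrow> real^3" where
  "curvature_op g u a b c =
     (\<chi> l. \<Sum>i\<in>UNIV. \<Sum>j\<in>UNIV. \<Sum>k\<in>UNIV. riemann g l i j k u * a $ i * b $ j * c $ k)"

text \<open>The sign convention makes round spheres positively curved.\<close>

definition sectional_curvature ::
    "(real^3 \<Rightarrow> real^3^3) \<Rightarrow> real^3 \<Rightarrow> real^3 \<Rightarrow> real^3 \<Rightarrow> real" where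
  "sectional_curvature g u a b =
     inner_at g u (curvature_op g u a b b) a /
     (inner_at g u a a * inner_at g u b b - (inner_at g u a b)\<^sup>2)"

text \<open>Only the values \<open>e 1, \<dots>, e (dim L)\<close> matter.\<close>

definition orthonormal_frame ::
    "(real^3 \<Rightarrow> real^3^3) \<Rightarrow> real^3 \<Rightarrow> (real^3) set \<Rightarrow> (nat \<Rightarrow> real^3) \<Rightarrow> bool" where
  "orthonormal_frame g u L e \<longleftrightarrow>
     (\<forall>i\<in>{1..dim L}. e i \<in> L) \<and>
     (\<forall>i\<in>{1..dim L}. \<forall>j\<in>{1..dim L}. inner_at g u (e i) (e j) = (if i = j then 1 else 0))"

text \<open>The definitions below that choose a frame do not depend on the choice.\<close>

definition normalized_scalar_curvature :: "(real^3 \<Rightarrow> real^3^3) \<Rightarrow> real^3 \<Rightarrow> real" where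
  "normalized_scalar_curvature g u =
     (let e = SOME e. orthonormal_frame g u UNIV e
      in 1/3 * (\<Sum>j\<in>{1..3}. \<Sum>i\<in>{1..<j}. sectional_curvature g u (e i) (e j)))"

section \<open>Extrinsic geometry of a parametrized hypersurface\<close>

definition induced_metric :: "(real^3 \<Rightarrow> real^4) \<Rightarrow> real^3 \<Rightarrow> real^3^3" where
  "induced_metric \<phi> u = (\<chi> i j. pd i \<phi> u \<bullet> pd j \<phi> u)"

text \<open>The unit normal is only determined up to sign at each point; the Casorati curvatures are
  quadratic in the second fundamental form and do not see the sign.\<close>

definition unit_normal :: "(real^3 \<Rightarrow> real^4) \<Rightarrow> real^3 \<Rightarrow> real^4" where
  "unit_normal \<phi> u = (SOME n. norm n = 1 \<and> (\<forall>v. n \<bullet> frechet_derivative \<phi> (at u) v = 0))"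

definition second_fundamental_form ::
    "(real^3 \<Rightarrow> real^4) \<Rightarrow> real^3 \<Rightarrow> real^3 \<Rightarrow> real^3 \<Rightarrow> real" where
  "second_fundamental_form \<phi> u a b =
     (\<Sum>i\<in>UNIV. \<Sum>j\<in>UNIV. a $ i * b $ j * (pd i (pd j \<phi>) u \<bullet> unit_normal \<phi> u))"

text \<open>The Casorati curvature of a subspace \<open>L\<close> of the tangent space at \<open>u\<close>;
  \<open>L = UNIV\<close> gives the Casorati curvature of the hypersurface.\<close>

definition casorati_curvature :: "(real^3 \<Rightarrow> real^4) \<Rightarrow> real^3 \<Rightarrow> (real^3) set \<Rightarrow> real" where
  "casorati_curvature \<phi> u L =
     (let e = SOME e. orthonormal_frame (induced_metric \<phi>) u L e
      in 1 / real (dim L) *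
         (\<Sum>i\<in>{1..dim L}. \<Sum>j\<in>{1..dim L}. (second_fundamental_form \<phi> u (e i) (e j))\<^sup>2))"

definition delta_casorati :: "(real^3 \<Rightarrow> real^4) \<Rightarrow> real^3 \<Rightarrow> real" where
  "delta_casorati \<phi> u =
     1/2 * casorati_curvature \<phi> u UNIV
     + 2/3 * Inf {casorati_curvature \<phi> u L | L. subspace L \<and> dim L = 2}"

definition casorati_ideal :: "'a topology \<Rightarrow> ('a \<Rightarrow> real^4) \<Rightarrow> bool" where
  "casorati_ideal M \<iota> \<longleftrightarrow>
     (\<forall>U x. local_param M \<iota> U x \<longrightarrow>
       (\<forall>u\<in>U. normalized_scalar_curvature (induced_metric (\<iota> \<circ> x)) u = delta_casorati (\<iota> \<circ> x) u))"

text \<open>Open parts of hyperplanes satisfy equality trivially (both sides vanish); they are the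
  degenerate limit \<open>a \<rightarrow> 0\<close> of the model below and have to be excluded.\<close>

definition totally_geodesic :: "'a topology \<Rightarrow> ('a \<Rightarrow> real^4) \<Rightarrow> bool" where
  "totally_geodesic M \<iota> \<longleftrightarrow>
     (\<forall>U x. local_param M \<iota> U x \<longrightarrow>
       (\<forall>u\<in>U. \<forall>a b. second_fundamental_form (\<iota> \<circ> x) u a b = 0))"

section \<open>Jacobi elliptic functions of real argument and modulus \<open>0 \<le> k < 1\<close>\<close>

text \<open>The integrals \<open>LBINT\<close> are oriented, so negative upper limits are allowed.\<close>

definition elliptic_F :: "real \<Rightarrow> real \<Rightarrow> real" where
  "elliptic_F \<phi> k = (LBINT \<theta>=0..\<phi>. 1 / sqrt (1 - k\<^sup>2 * (sin \<theta>)\<^sup>2))"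

definition jacobi_am :: "real \<Rightarrow> real \<Rightarrow> real" where
  "jacobi_am x k = (THE \<phi>. elliptic_F \<phi> k = x)"

definition jacobi_sn :: "real \<Rightarrow> real \<Rightarrow> real" where
  "jacobi_sn x k = sin (jacobi_am x k)"

definition jacobi_dn :: "real \<Rightarrow> real \<Rightarrow> real" where
  "jacobi_dn x k = sqrt (1 - k\<^sup>2 * (jacobi_sn x k)\<^sup>2)"

definition jacobi_sd :: "real \<Rightarrow> real \<Rightarrow> real" where
  "jacobi_sd x k = jacobi_sn x k / jacobi_dn x k"

section \<open>The model hypersurface\<close>

definition model_param :: "real \<Rightarrow> real \<Rightarrow> real \<Rightarrow> real \<Rightarrow> real^4" where
  "model_param a t u v =
     vector [1/a * jacobi_sd (a * t) (1 / sqrt 2) * sin u,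
             1/a * jacobi_sd (a * t) (1 / sqrt 2) * cos u * sin v,
             1/a * jacobi_sd (a * t) (1 / sqrt 2) * cos u * cos v,
             1/2 * (LBINT \<tau>=0..t. (jacobi_sd (a * \<tau>) (1 / sqrt 2))\<^sup>2)]"

text \<open>The rotational hypersurface degenerates where \<open>sd (a * t) = 0\<close>, so a (smooth) hypersurface is
  compared with relatively open portions of this image.\<close>

definition model_image :: "real \<Rightarrow> (real^4) set" where
  "model_image a = {model_param a t u v | t u v. True}"

end

theory Submission
  imports Defs
begin

text \<open>By the Gauss equation, six times \<open>\<delta>\<^sub>C(2) - \<rho>\<close> is a sum of squares at a minimizing plane, so
  equality forces the shape operator to be \<open>l (id + T \<otimes> T)\<close> with a unit vector \<open>T\<close>, i.e. to have the
  principal curvatures \<open>l, l, 2 l\<close>.  Where \<open>l \<noteq> 0\<close>, the symmetry of the second derivatives of \<open>N\<close>,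
  \<open>l\<close> and \<open>T\<close> (the Codazzi and Gauss equations) gives, with \<open>\<mu>\<close> the derivative of \<open>l\<close> along \<open>T\<close>,
  a closed system for \<open>(N, T, l, \<mu>)\<close>.  Its first integrals are \<open>c\<^sup>2 = \<mu>\<^sup>2 + l\<^sup>4\<close> and the axis direction
  \<open>E = (l\<^sup>2 T + \<mu> N) / c\<close>; the distance to the axis is \<open>r = l / c\<close> and \<open>r' = \<mu> / c\<close>, so
  \<open>r'\<^sup>2 = 1 - c\<^sup>2 r\<^sup>4\<close>, the equation of \<open>sd (a t) / a\<close> for \<open>a\<^sup>2 = 2 c\<close>, and the remaining
  integral is the base point of the axis.

  If \<open>l\<close> tended to \<open>0\<close> with \<open>c\<close> fixed, the second derivatives of \<open>l\<close> transversally to \<open>T\<close>, which are about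
  \<open>\<mu>\<^sup>2 / l\<close>, would blow up.  Hence the set of points with given \<open>c\<close>, \<open>E\<close> and base point is open
  and closed, and \<open>M\<close>, being connected, lies in a single model.\<close>

section \<open>Differentiable functions of finite order\<close>

text \<open>Along T the system reads l' = \<mu>, \<mu>' = -2 l^3, so \<open>\<mu>^2 + l^4\<close> is
  conserved. For the modulus 1/sqrt 2 one has sd'^2 = 1 - sd^4/4; comparing r = sd(a t)/a with r'^2
  = 1 - c^2 r^4 is what forces a^2 = 2 c. Three obstacles shape the proof. T is determined only up
  to sign, and nothing provides a coherent global choice; reversing T replaces E by -E and can move
  the base point. Hence one triple of constants is fixed, and the question is at which points some
  local choice of T realizes it. Next, the frames and normals in the definitions are picked
  pointwise, and transitions between charts are a priori only continuous, so differentiable objects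
  must be built before any equation can be differentiated. Finally, the model is singular where sd
  vanishes, and openness in it cannot be read off from a single chart; since r = l/c > 0 on the
  pieces obtained, they lie in the regular part, which is mapped injectively into
  \<open>real^3\<close>, where an open mapping theorem applies.\<close>

abbreviation FD :: "('a::real_normed_vector \<Rightarrow> 'b::real_normed_vector) \<Rightarrow> 'a \<Rightarrow> 'a \<Rightarrow> 'b" where
  "FD f u \<equiv> frechet_derivative f (at u)"

section \<open>Symmetry of second derivatives\<close>

text \<open>The mean value theorem is applied to the increment of \<open>f\<close> in direction
  \<open>b\<close>, viewed as a function of the step in direction \<open>a\<close>. Second-order
  information then enters only through the differentiability of \<open>\<lambda>w. F w a\<close> at
  the single point \<open>u\<close>.\<close>

lemma mixed_difference_estimate:
  fixes f :: "'a::real_normed_vector \<Rightarrow> real"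
  assumes S: "open S" "u \<in> S"
    and F: "\<And>w. w \<in> S \<Longrightarrow> (f has_derivative F w) (at w)"
    and Ga: "((\<lambda>w. F w a) has_derivative Ga) (at u)"
    and e: "e > 0"
  shows "\<exists>d>0. \<forall>s. 0 < s \<and> s < d \<longrightarrow>
    \<bar>f (u + s *\<^sub>R a + s *\<^sub>R b) - f (u + s *\<^sub>R a) - f (u + s *\<^sub>R b) + f u - s\<^sup>2 * Ga b\<bar> \<le> e * s\<^sup>2"
proof -
  define K where "K = norm a + norm b + 1"
  have K: "K > 0" "norm a \<le> K" "norm b \<le> K" by (auto simp: K_def add_nonneg_pos)
  \<comment> \<open>Two linearization errors of size \<open>e' * (s * K)\<close> will occur, and
    \<open>2 * e' * K = e\<close>.\<close>
  define e' where "e' = e / (2 * K)"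
  have e': "e' > 0" using e K by (simp add: e'_def)
  have blG: "bounded_linear Ga" using Ga by (rule has_derivative_bounded_linear)
  then interpret Ga: bounded_linear Ga .
  obtain d1 where d1: "d1 > 0" "\<And>y. norm (y - u) < d1 \<Longrightarrow> norm (F y a - F u a - Ga (y - u)) \<le> e' * norm (y - u)"
    using Ga e' unfolding has_derivative_at_alt by blast
  obtain d2 where d2: "d2 > 0" "ball u d2 \<subseteq> S"
    using S open_contains_ball by blast
  define d where "d = min d1 d2 / K"
  have "d > 0" using d1 d2 K by (simp add: d_def)
  moreover have "\<bar>f (u + s *\<^sub>R a + s *\<^sub>R b) - f (u + s *\<^sub>R a) - f (u + s *\<^sub>R b) + f u - s\<^sup>2 * Ga b\<bar> \<le> e * s\<^sup>2"
    if s: "0 < s" "s < d" for s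
  proof -
    have sK: "s * K < d1" "s * K < d2"
      using s K unfolding d_def by (simp_all add: field_simps)
    have bnd: "norm (r *\<^sub>R a + q *\<^sub>R b) \<le> s * K" if "0 \<le> r" "r \<le> s" "0 \<le> q" "q \<le> s" for r q
    proof -
      have "norm (r *\<^sub>R a + q *\<^sub>R b) \<le> r * norm a + q * norm b"
        using that by (metis abs_of_nonneg norm_scaleR norm_triangle_ineq)
      also have "\<dots> \<le> s * norm a + s * norm b"
        using that by (intro add_mono mult_right_mono) auto
      also have "\<dots> \<le> s * K" using s by (simp add: K_def algebra_simps)
      finally show ?thesis .
    qed
    have inS: "u + (r *\<^sub>R a + q *\<^sub>R b) \<in> S" if "0 \<le> r" "r \<le> s" "0 \<le> q" "q \<le> s" for r q
    proof -
      have "dist (u + (r *\<^sub>R a + q *\<^sub>R b)) u < d2" using bnd[OF that] sK by (simp add: dist_norm)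
      then show ?thesis using d2 by (auto simp: dist_commute)
    qed
    define g where "g r = f (u + r *\<^sub>R a + s *\<^sub>R b) - f (u + r *\<^sub>R a)" for r
    define g' where "g' r = F (u + r *\<^sub>R a + s *\<^sub>R b) a - F (u + r *\<^sub>R a) a" for r
    have gd: "(g has_derivative (\<lambda>h. h * g' r)) (at r)" if r: "0 \<le> r" "r \<le> s" for r
    proof -
      have 1: "u + r *\<^sub>R a + s *\<^sub>R b \<in> S" using inS[OF r, of s] s by (simp add: algebra_simps)
      have 2: "u + r *\<^sub>R a \<in> S" using inS[OF r, of 0] s by (simp add: algebra_simps)
      have A: "((\<lambda>r. f (u + r *\<^sub>R a + s *\<^sub>R b)) has_derivative (\<lambda>h. F (u + r *\<^sub>R a + s *\<^sub>R b) (h *\<^sub>R a))) (at r)"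
        by (rule has_derivative_compose[where g=f and f="\<lambda>r. u + r *\<^sub>R a + s *\<^sub>R b", OF _ F[OF 1]])
           (auto intro!: derivative_eq_intros)
      have B: "((\<lambda>r. f (u + r *\<^sub>R a)) has_derivative (\<lambda>h. F (u + r *\<^sub>R a) (h *\<^sub>R a))) (at r)"
        by (rule has_derivative_compose[where g=f and f="\<lambda>r. u + r *\<^sub>R a", OF _ F[OF 2]])
           (auto intro!: derivative_eq_intros)
      have eq: "(\<lambda>h. F (u + r *\<^sub>R a + s *\<^sub>R b) (h *\<^sub>R a) - F (u + r *\<^sub>R a) (h *\<^sub>R a)) = (\<lambda>h. h * g' r)"
        using bounded_linear.linear[OF has_derivative_bounded_linear[OF F[OF 1]]]
          bounded_linear.linear[OF has_derivative_bounded_linear[OF F[OF 2]]]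
        by (simp add: g'_def linear_cmul algebra_simps)
      show ?thesis unfolding g_def using has_derivative_diff[OF A B] unfolding eq .
    qed
    obtain r where r: "r \<in> {0<..<s}" "g s - g 0 = (s - 0) * g' r"
      using mvt_simple[of 0 s g "\<lambda>r h. h * g' r"] gd s
      by (metis atLeastAtMost_iff has_derivative_at_withinI)
    have n: "norm (F (u + y) a - F u a - Ga y) \<le> e' * (s * K)" if y: "norm y \<le> s * K" for y
    proof -
      have "norm (F (u + y) a - F u a - Ga y) \<le> e' * norm y" using d1(2)[of "u + y"] y sK by simp
      also have "\<dots> \<le> e' * (s * K)" using y e' by (intro mult_left_mono) auto
      finally show ?thesis .
    qed
    have n1: "norm (F (u + r *\<^sub>R a + s *\<^sub>R b) a - F u a - Ga (r *\<^sub>R a + s *\<^sub>R b)) \<le> e' * (s * K)"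
      using n[OF bnd[of r s]] r s by (simp add: add.assoc)
    have n2: "norm (F (u + r *\<^sub>R a) a - F u a - Ga (r *\<^sub>R a)) \<le> e' * (s * K)"
      using n[of "r *\<^sub>R a"] bnd[of r 0] r s by simp
    have "Ga (r *\<^sub>R a + s *\<^sub>R b) = Ga (r *\<^sub>R a) + s * Ga b"
      by (simp add: Ga.add Ga.scaleR)
    then have "\<bar>g' r - s * Ga b\<bar> \<le> 2 * (e' * (s * K))"
      using n1 n2 unfolding g'_def real_norm_def by linarith
    also have "\<dots> = e * s" using K by (simp add: e'_def field_simps)
    finally have "s * \<bar>g' r - s * Ga b\<bar> \<le> s * (e * s)" using s by (intro mult_left_mono) auto
    moreover have "s * \<bar>g' r - s * Ga b\<bar> = \<bar>s * g' r - s\<^sup>2 * Ga b\<bar>"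
    proof -
      have "s * g' r - s\<^sup>2 * Ga b = s * (g' r - s * Ga b)"
        by (simp add: power2_eq_square right_diff_distrib)
      then show ?thesis using s by (simp add: abs_mult)
    qed
    moreover have "f (u + s *\<^sub>R a + s *\<^sub>R b) - f (u + s *\<^sub>R a) - f (u + s *\<^sub>R b) + f u = s * g' r"
      using r(2) by (simp add: g_def)
    ultimately show ?thesis by (simp add: power2_eq_square algebra_simps)
  qed
  ultimately show ?thesis by blast
qed

text \<open>The mixed second difference does not change when \<open>a\<close> and \<open>b\<close>
  are exchanged, so its two quadratic approximations must agree.\<close>

lemma second_derivative_symmetric_real:
  fixes f :: "'a::real_normed_vector \<Rightarrow> real"
  assumes S: "open S" "u \<in> S"
    and F: "\<And>w. w \<in> S \<Longrightarrow> (f has_derivative F w) (at w)"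
    and Ga: "((\<lambda>w. F w a) has_derivative Ga) (at u)"
    and Gb: "((\<lambda>w. F w b) has_derivative Gb) (at u)"
  shows "Ga b = Gb a"
proof (rule ccontr)
  assume "Ga b \<noteq> Gb a"
  define e where "e = \<bar>Ga b - Gb a\<bar> / 3"
  have e: "e > 0" using \<open>Ga b \<noteq> Gb a\<close> by (simp add: e_def)
  obtain d1 where d1: "d1 > 0" "\<And>s. 0 < s \<Longrightarrow> s < d1 \<Longrightarrow>
    \<bar>f (u + s *\<^sub>R a + s *\<^sub>R b) - f (u + s *\<^sub>R a) - f (u + s *\<^sub>R b) + f u - s\<^sup>2 * Ga b\<bar> \<le> e * s\<^sup>2"
    using mixed_difference_estimate[OF S F Ga e] by blast
  obtain d2 where d2: "d2 > 0" "\<And>s. 0 < s \<Longrightarrow> s < d2 \<Longrightarrow>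
    \<bar>f (u + s *\<^sub>R b + s *\<^sub>R a) - f (u + s *\<^sub>R b) - f (u + s *\<^sub>R a) + f u - s\<^sup>2 * Gb a\<bar> \<le> e * s\<^sup>2"
    using mixed_difference_estimate[OF S F Gb e] by blast
  define s where "s = min d1 d2 / 2"
  have s: "0 < s" "s < d1" "s < d2" using d1 d2 by (auto simp: s_def)
  have eq: "u + s *\<^sub>R b + s *\<^sub>R a = u + s *\<^sub>R a + s *\<^sub>R b" by (simp add: algebra_simps)
  have "\<bar>s\<^sup>2 * Ga b - s\<^sup>2 * Gb a\<bar> \<le> 2 * (e * s\<^sup>2)"
    using d1(2)[OF s(1,2)] d2(2)[OF s(1,3)] unfolding eq by linarith
  then have "s\<^sup>2 * \<bar>Ga b - Gb a\<bar> \<le> s\<^sup>2 * (2 * e)"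
    unfolding right_diff_distrib[symmetric] abs_mult by (simp add: mult_ac)
  then have "\<bar>Ga b - Gb a\<bar> \<le> 2 * e" using s by simp
  then show False using e by (simp add: e_def)
qed

lemma second_derivative_symmetric:
  fixes f :: "'a::real_normed_vector \<Rightarrow> 'b::real_inner"
  assumes S: "open S" "u \<in> S"
    and F: "\<And>w. w \<in> S \<Longrightarrow> (f has_derivative F w) (at w)"
    and Ga: "((\<lambda>w. F w a) has_derivative Ga) (at u)"
    and Gb: "((\<lambda>w. F w b) has_derivative Gb) (at u)"
  shows "Ga b = Gb a"
proof -
  have "Ga b \<bullet> v = Gb a \<bullet> v" for v
    by (rule second_derivative_symmetric_real[OF S, where f="\<lambda>w. f w \<bullet> v" and F="\<lambda>w h. F w h \<bullet> v"
          and Ga="\<lambda>h. Ga h \<bullet> v" and Gb="\<lambda>h. Gb h \<bullet> v"])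
       (auto intro!: has_derivative_inner_left F Ga Gb)
  then show ?thesis by (metis inner_diff_left inner_eq_zero_iff right_minus_eq)
qed

section \<open>Calculus of maps of class C^k\<close>

text \<open>The order is explicit because closure under products, quotients and square roots is an
  induction in which each derivative has one order less. A smooth map is \<open>Ck\<close> for every
  \<open>k\<close>, and this is the form in which smoothness is used.\<close>

primrec Ck :: "nat \<Rightarrow> (real^3) set \<Rightarrow> (real^3 \<Rightarrow> 'b::real_normed_vector) \<Rightarrow> bool" where
  "Ck 0 U f = continuous_on U f"
| "Ck (Suc k) U f = (f differentiable_on U \<and> (\<forall>i. Ck k U (pd i f)))"

lemma iter_pd_append: "iter_pd (is @ [i]) f = iter_pd is (pd i f)"
  by (induction "is") auto

lemma smooth_on_pd: "smooth_on U f \<Longrightarrow> smooth_on U (pd i f)"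
  unfolding smooth_on_def by (metis iter_pd_append)

lemma smooth_on_differentiable: "smooth_on U f \<Longrightarrow> f differentiable_on U"
  unfolding smooth_on_def by (metis iter_pd.simps(1))

lemma smooth_on_Ck: "smooth_on U f \<Longrightarrow> Ck k U f"
  by (induction k arbitrary: f)
     (auto simp: smooth_on_differentiable smooth_on_pd intro: differentiable_imp_continuous_on)

lemma Ck_differentiable: "Ck (Suc k) U f \<Longrightarrow> f differentiable_on U"
  by simp

lemma Ck_continuous: "Ck k U f \<Longrightarrow> continuous_on U f"
  by (cases k) (auto intro: differentiable_imp_continuous_on)

lemma Ck_mono1: "Ck (Suc k) U f \<Longrightarrow> Ck k U f"
  by (induction k arbitrary: f) (auto intro: differentiable_imp_continuous_on)

lemma pd_eq_derivative: "(f has_derivative f') (at u) \<Longrightarrow> pd i f u = f' (axis i 1)"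
  unfolding pd_def by (metis frechet_derivative_at)

lemma pd_cong:
  assumes "open U" "u \<in> U" "\<And>w. w \<in> U \<Longrightarrow> f w = g w"
  shows "pd i f u = pd i g u"
proof -
  have "(f has_derivative f') (at u) \<longleftrightarrow> (g has_derivative f') (at u)" for f'
    using has_derivative_transform_within_open[of _ _ u UNIV U] assms by metis
  then show ?thesis by (simp add: pd_def frechet_derivative_def)
qed

lemma Ck_cong:
  assumes "open U" "\<And>w. w \<in> U \<Longrightarrow> f w = g w" "Ck k U f"
  shows "Ck k U g"
  using assms(2,3)
proof (induction k arbitrary: f g)
  case 0
  then show ?case using continuous_on_cong by (metis Ck.simps(1))
next
  case (Suc k)
  have "g differentiable_on U"
    unfolding differentiable_on_eq_differentiable_at[OF assms(1)]
  proof
    fix w assume w: "w \<in> U"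
    then obtain f' where "(f has_derivative f') (at w)"
      using Suc.prems unfolding Ck.simps differentiable_on_eq_differentiable_at[OF assms(1)] differentiable_def by blast
    then have "(g has_derivative f') (at w)"
      by (rule has_derivative_transform_within_open[OF _ assms(1) w]) (use Suc.prems in auto)
    then show "g differentiable at w" unfolding differentiable_def by blast
  qed
  moreover have "Ck k U (pd i g)" for i
    using Suc.IH[of "pd i f" "pd i g"] pd_cong[OF assms(1)] Suc.prems by (metis Ck.simps(2))
  ultimately show ?case by simp
qed

lemma Ck_subset:
  assumes "open V" "V \<subseteq> U" "Ck k U f"
  shows "Ck k V f"
  using assms(3) by (induction k arbitrary: f)
    (use assms in \<open>auto intro: continuous_on_subset differentiable_on_subset\<close>)

lemma diff_on_open_has_derivative:
  assumes "open U" "f differentiable_on U" "u \<in> U"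
  shows "(f has_derivative FD f u) (at u)"
  using assms differentiable_on_eq_differentiable_at frechet_derivative_works by blast

lemma Ck_const: "Ck k U (\<lambda>u. c)"
proof (induction k arbitrary: c)
  case (Suc k)
  have "pd i (\<lambda>u. c) = (\<lambda>u. 0)" for i by (auto simp: pd_def fun_eq_iff)
  then show ?case using Suc by simp
qed simp

lemma Ck_add:
  assumes "open U" "Ck k U f" "Ck k U g"
  shows "Ck k U (\<lambda>u. f u + g u)"
  using assms(2,3)
proof (induction k arbitrary: f g)
  case 0 then show ?case by (simp add: continuous_on_add)
next
  case (Suc k)
  have "Ck k U (pd i (\<lambda>u. f u + g u))" for i
  proof (rule Ck_cong[OF assms(1) _ Suc.IH])
    show "Ck k U (pd i f)" "Ck k U (pd i g)" using Suc by auto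
    show "pd i f w + pd i g w = pd i (\<lambda>u. f u + g u) w" if "w \<in> U" for w
      using pd_eq_derivative[OF has_derivative_add[OF diff_on_open_has_derivative[OF assms(1), of f w]
          diff_on_open_has_derivative[OF assms(1), of g w]]] Suc.prems that by (simp add: pd_def)
  qed
  then show ?case using Suc.prems by (simp add: differentiable_on_add)
qed

lemma Ck_sum:
  assumes "open U" "\<And>i. i \<in> A \<Longrightarrow> Ck k U (f i)"
  shows "Ck k U (\<lambda>u. \<Sum>i\<in>A. f i u)"
  using assms(2)
proof (induction A rule: infinite_finite_induct)
  case (insert x F)
  then show ?case by (simp add: Ck_add assms(1))
qed (auto simp: Ck_const)

text \<open>The product rule reproduces the same bilinear form one order lower, so a single
  induction serves multiplication, scaling and inner products.\<close>

lemma (in bounded_bilinear) Ck_bilinear: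
  assumes "open U" "Ck k U f" "Ck k U g"
  shows "Ck k U (\<lambda>u. prod (f u) (g u))"
  using assms(2,3)
proof (induction k arbitrary: f g)
  case 0 then show ?case by (simp add: continuous_on)
next
  case (Suc k)
  have FG: "(f has_derivative FD f u) (at u)"
    "(g has_derivative FD g u) (at u)" if "u \<in> U" for u
    using Suc.prems that assms(1) diff_on_open_has_derivative by auto
  have "Ck k U (pd i (\<lambda>u. prod (f u) (g u)))" for i
  proof (rule Ck_cong[OF assms(1)])
    show "Ck k U (\<lambda>u. prod (f u) (pd i g u) + prod (pd i f u) (g u))"
      using Suc.prems Ck_mono1[OF Suc.prems(1)] Ck_mono1[OF Suc.prems(2)]
      by (intro Ck_add assms(1) Suc.IH) auto
    show "prod (f u) (pd i g u) + prod (pd i f u) (g u) = pd i (\<lambda>u. prod (f u) (g u)) u" if "u \<in> U" for u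
      using pd_eq_derivative[OF FDERIV[OF FG[OF that]]] by (simp add: pd_def)
  qed
  moreover have "(\<lambda>u. prod (f u) (g u)) differentiable_on U"
    unfolding differentiable_on_eq_differentiable_at[OF assms(1)] differentiable_def
    using FDERIV[OF FG] by blast
  ultimately show ?case by simp
qed

lemmas Ck_mult = bounded_bilinear.Ck_bilinear[OF bounded_bilinear_mult]
lemmas Ck_scaleR = bounded_bilinear.Ck_bilinear[OF bounded_bilinear_scaleR]
lemmas Ck_inner = bounded_bilinear.Ck_bilinear[OF bounded_bilinear_inner]

lemma Ck_cmul: "open U \<Longrightarrow> Ck k U f \<Longrightarrow> Ck k U (\<lambda>u. c *\<^sub>R f u)"
  by (intro Ck_scaleR Ck_const)

lemma Ck_minus: "open U \<Longrightarrow> Ck k U f \<Longrightarrow> Ck k U (\<lambda>u. - f u)"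
  using Ck_cmul[of U k f "-1"] by simp

lemma Ck_diff: "open U \<Longrightarrow> Ck k U f \<Longrightarrow> Ck k U g \<Longrightarrow> Ck k U (\<lambda>u. f u - g u)"
  using Ck_add[of U k f "\<lambda>u. - g u"] Ck_minus[of U k g] by simp

lemma Ck_prod:
  fixes f :: "'i \<Rightarrow> real^3 \<Rightarrow> real"
  assumes "open U" "\<And>i. i \<in> A \<Longrightarrow> Ck k U (f i)"
  shows "Ck k U (\<lambda>u. \<Prod>i\<in>A. f i u)"
  using assms(2)
proof (induction A rule: infinite_finite_induct)
  case (insert x F)
  then show ?case by (simp add: Ck_mult assms(1))
qed (auto simp: Ck_const)

text \<open>The derivative is again built from \<open>inverse (f u)\<close>, so the induction
  hypothesis applies to it; the square root below works in the same way.\<close>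

lemma Ck_inverse:
  fixes f :: "real^3 \<Rightarrow> real"
  assumes "open U" "Ck k U f" "\<And>u. u \<in> U \<Longrightarrow> f u \<noteq> 0"
  shows "Ck k U (\<lambda>u. inverse (f u))"
  using assms(2)
proof (induction k)
  case 0 then show ?case using assms by (simp add: continuous_on_inverse)
next
  case (Suc k)
  have F: "((\<lambda>u. inverse (f u)) has_derivative (\<lambda>h. - (inverse (f u) * FD f u h * inverse (f u)))) (at u)"
    if "u \<in> U" for u
    using Suc.prems that assms by (intro Deriv.has_derivative_inverse diff_on_open_has_derivative[of U]) auto
  have "Ck k U (pd i (\<lambda>u. inverse (f u)))" for i
  proof (rule Ck_cong[OF assms(1)])
    show "Ck k U (\<lambda>u. - (inverse (f u) * pd i f u * inverse (f u)))"
      using Suc.prems Suc.IH[OF Ck_mono1[OF Suc.prems]] by (intro Ck_minus Ck_mult assms(1)) auto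
    show "- (inverse (f u) * pd i f u * inverse (f u)) = pd i (\<lambda>u. inverse (f u)) u" if "u \<in> U" for u
      using pd_eq_derivative[OF F[OF that]] by (simp add: pd_def)
  qed
  moreover have "(\<lambda>u. inverse (f u)) differentiable_on U"
    unfolding differentiable_on_eq_differentiable_at[OF assms(1)] differentiable_def
    using F by blast
  ultimately show ?case by simp
qed

lemma Ck_sqrt:
  fixes f :: "real^3 \<Rightarrow> real"
  assumes "open U" "Ck k U f" "\<And>u. u \<in> U \<Longrightarrow> f u > 0"
  shows "Ck k U (\<lambda>u. sqrt (f u))"
  using assms(2)
proof (induction k)
  case 0 then show ?case using assms by (simp add: continuous_on_real_sqrt)
next
  case (Suc k)
  have F: "((\<lambda>u. sqrt (f u)) has_derivative (\<lambda>h. FD f u h * (inverse (sqrt (f u)) / 2))) (at u)"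
    if "u \<in> U" for u
    using diff_on_open_has_derivative[OF assms(1), of f u] Suc.prems that assms(3)[OF that]
    by (auto intro!: derivative_eq_intros simp: field_simps)
  have "Ck k U (pd i (\<lambda>u. sqrt (f u)))" for i
  proof (rule Ck_cong[OF assms(1)])
    show "Ck k U (\<lambda>u. pd i f u * ((1/2) *\<^sub>R inverse (sqrt (f u))))"
      using Suc.prems Suc.IH[OF Ck_mono1[OF Suc.prems]]
      by (intro Ck_cmul Ck_mult Ck_inverse assms(1)) (auto dest: assms(3))
    show "pd i f u * ((1/2) *\<^sub>R inverse (sqrt (f u))) = pd i (\<lambda>u. sqrt (f u)) u" if "u \<in> U" for u
      using pd_eq_derivative[OF F[OF that]] by (simp add: pd_def)
  qed
  moreover have "(\<lambda>u. sqrt (f u)) differentiable_on U"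
    unfolding differentiable_on_eq_differentiable_at[OF assms(1)] differentiable_def
    using F by blast
  ultimately show ?case by simp
qed

lemma Ck_divide:
  fixes f g :: "real^3 \<Rightarrow> real"
  assumes "open U" "Ck k U f" "Ck k U g" "\<And>u. u \<in> U \<Longrightarrow> g u \<noteq> 0"
  shows "Ck k U (\<lambda>u. f u / g u)"
  unfolding divide_inverse by (intro Ck_mult Ck_inverse assms)

lemma Ck_norm:
  fixes f :: "real^3 \<Rightarrow> 'b::real_inner"
  assumes "open U" "Ck k U f" "\<And>u. u \<in> U \<Longrightarrow> f u \<noteq> 0"
  shows "Ck k U (\<lambda>u. norm (f u))"
  unfolding norm_eq_sqrt_inner by (intro Ck_sqrt Ck_inner assms) (use assms in auto)

lemma Ck_normalize:
  fixes f :: "real^3 \<Rightarrow> 'b::real_inner"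
  assumes "open U" "Ck k U f" "\<And>u. u \<in> U \<Longrightarrow> f u \<noteq> 0"
  shows "Ck k U (\<lambda>u. f u /\<^sub>R norm (f u))"
  by (intro Ck_scaleR Ck_inverse Ck_norm assms) (use assms in auto)

lemma frechet_derivative_pd:
  assumes "f differentiable (at u)"
  shows "FD f u a = (\<Sum>i\<in>UNIV. a $ i *\<^sub>R pd i f u)"
proof -
  interpret linear "FD f u"
    using assms linear_frechet_derivative by blast
  have "FD f u a = FD f u (\<Sum>i\<in>UNIV. a $ i *\<^sub>R axis i 1)"
    by (metis (no_types) basis_expansion scalar_mult_eq_scaleR)
  then show ?thesis by (simp add: sum scale pd_def)
qed

text \<open>The direction may vary with the point, as it does for moving frames and for the trace
  that defines the principal curvature.\<close>

lemma Ck_frechet_derivative: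
  assumes "open U" "Ck (Suc k) U f" "Ck k U X"
  shows "Ck k U (\<lambda>u. FD f u (X u))"
proof (rule Ck_cong[OF assms(1)])
  show "Ck k U (\<lambda>u. \<Sum>i\<in>UNIV. (X u \<bullet> axis i 1) *\<^sub>R pd i f u)"
    by (intro Ck_sum Ck_scaleR Ck_inner Ck_const) (use assms in auto)
  show "(\<Sum>i\<in>UNIV. (X w \<bullet> axis i 1) *\<^sub>R pd i f w) = FD f w (X w)" if "w \<in> U" for w
    using frechet_derivative_pd[of f w "X w"] assms that
    by (simp add: differentiable_on_eq_differentiable_at inner_axis)
qed

lemma Ck2_symmetric:
  fixes f :: "real^3 \<Rightarrow> 'b::real_inner"
  assumes "open U" "Ck (Suc (Suc 0)) U f" "u \<in> U"
  shows "FD (\<lambda>w. FD f w a) u b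
       = FD (\<lambda>w. FD f w b) u a"
proof (rule second_derivative_symmetric[OF assms(1,3)])
  show "(f has_derivative FD f w) (at w)" if "w \<in> U" for w
    using that assms diff_on_open_has_derivative by auto
  have "Ck 1 U (\<lambda>w. FD f w a)" for a
    using Ck_frechet_derivative[OF assms(1), of "Suc 0" f "\<lambda>_. a"] assms Ck_const[of "Suc 0" U a]
    by (metis One_nat_def)
  then have D: "((\<lambda>w. FD f w a) has_derivative FD (\<lambda>w. FD f w a) u) (at u)" for a
    using diff_on_open_has_derivative[OF assms(1)] assms(3) by auto
  show "((\<lambda>w. FD f w a) has_derivative FD (\<lambda>w. FD f w a) u) (at u)"
    by (rule D)
  show "((\<lambda>w. FD f w b) has_derivative FD (\<lambda>w. FD f w b) u) (at u)"
    by (rule D)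
qed

section \<open>The model hypersurface\<close>

lemma LBINT_has_real_derivative:
  fixes f :: "real \<Rightarrow> real"
  assumes "continuous_on UNIV f"
  shows "((\<lambda>x. LBINT y=0..ereal x. f y) has_real_derivative f x) (at x)"
proof -
  \<comment> \<open>The margin 1 makes \<open>x\<close> an interior point, so the derivative within
    the interval is two-sided, for negative \<open>x\<close> as well.\<close>
  define a b where "a = min 0 x - 1" and "b = max 0 x + 1"
  have ab: "a \<le> 0" "0 \<le> b" "a < x" "x < b" by (auto simp: a_def b_def)
  have "((\<lambda>u. LBINT y=ereal 0..ereal u. f y) has_vector_derivative f x) (at x within {a..b})"
    by (rule interval_integral_FTC2) (use ab assms in \<open>auto intro: continuous_on_subset\<close>)
  then have "((\<lambda>u. LBINT y=ereal 0..ereal u. f y) has_vector_derivative f x) (at x)"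
    using ab at_within_interior[of x "{a..b}"] by (simp add: interior_atLeastAtMost_real)
  then show ?thesis
    by (simp add: has_real_derivative_iff_has_vector_derivative zero_ereal_def)
qed

text \<open>\<open>k = 1 / sqrt 2\<close> is the lemniscatic modulus.\<close>

abbreviation lem_F :: "real \<Rightarrow> real" where "lem_F \<phi> \<equiv> elliptic_F \<phi> (1 / sqrt 2)"

lemma half_sin_sq: "1 - (1 / sqrt 2)\<^sup>2 * (sin \<theta>)\<^sup>2 = 1 - (sin \<theta>)\<^sup>2 / 2" for \<theta> :: real
  by (simp add: power_divide)

lemma half_sin_sq_pos: "1 - (sin \<theta>)\<^sup>2 / 2 \<ge> 1/2" for \<theta> :: real
  using sin_le_one[of \<theta>] sin_ge_minus_one[of \<theta>] abs_square_le_1[of "sin \<theta>"] by simp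

lemma sqrt_half_sin_sq_nonzero: "sqrt (1 - (sin \<theta>)\<^sup>2 / 2) \<noteq> 0" for \<theta> :: real
proof -
  have "1 - (sin \<theta>)\<^sup>2 / 2 > 0" using half_sin_sq_pos[of \<theta>] by linarith
  then show ?thesis by simp
qed

lemma lem_F_deriv: "(lem_F has_real_derivative 1 / sqrt (1 - (sin \<phi>)\<^sup>2 / 2)) (at \<phi>)"
proof -
  have "continuous_on UNIV (\<lambda>\<theta>::real. 1 / sqrt (1 - (1 / sqrt 2)\<^sup>2 * (sin \<theta>)\<^sup>2))"
    unfolding half_sin_sq using sqrt_half_sin_sq_nonzero
    by (intro continuous_intros) auto
  from LBINT_has_real_derivative[OF this, of \<phi>] show ?thesis
    unfolding elliptic_F_def half_sin_sq .
qed

lemma lem_F_0: "lem_F 0 = 0"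
  by (simp add: elliptic_F_def zero_ereal_def[symmetric])

text \<open>The integrand is at least 1. This expansion bound yields both injectivity and
  surjectivity of \<open>lem_F\<close>, hence the meaning of the \<open>THE\<close> in
  \<open>jacobi_am\<close>.\<close>

lemma lem_F_growth:
  assumes "x \<le> y" shows "lem_F y - lem_F x \<ge> y - x"
proof (cases "x = y")
  case False
  then have "x < y" using assms by simp
  from MVT2[OF this, of lem_F "\<lambda>\<phi>. 1 / sqrt (1 - (sin \<phi>)\<^sup>2 / 2)"]
  obtain z where z: "lem_F y - lem_F x = (y - x) * (1 / sqrt (1 - (sin z)\<^sup>2 / 2))"
    using lem_F_deriv by blast
  have "sqrt (1 - (sin z)\<^sup>2 / 2) \<le> 1" "sqrt (1 - (sin z)\<^sup>2 / 2) > 0"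
    using half_sin_sq_pos[of z] by auto
  then have "1 / sqrt (1 - (sin z)\<^sup>2 / 2) \<ge> 1" by simp
  then have "(y - x) * (1 / sqrt (1 - (sin z)\<^sup>2 / 2)) \<ge> (y - x) * 1"
    using assms by (intro mult_left_mono) auto
  then show ?thesis using z by simp
qed simp

lemma lem_F_strict_mono: "x < y \<Longrightarrow> lem_F x < lem_F y"
  using lem_F_growth[of x y] by simp

lemma lem_F_inj: "lem_F x = lem_F y \<longleftrightarrow> x = y"
  using lem_F_strict_mono by (metis less_irrefl linorder_neqE)

lemma lem_F_surj: "\<exists>\<phi>. lem_F \<phi> = x"
proof -
  have cont: "isCont lem_F y" for y using lem_F_deriv DERIV_isCont by blast
  have "lem_F (- \<bar>x\<bar>) \<le> x" "x \<le> lem_F \<bar>x\<bar>"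
    using lem_F_growth[of "- \<bar>x\<bar>" 0] lem_F_growth[of 0 "\<bar>x\<bar>"] lem_F_0 by linarith+
  then show ?thesis
    using IVT[of lem_F "- \<bar>x\<bar>" x "\<bar>x\<bar>"] cont by auto
qed

lemma jacobi_am_lem_F [simp]: "jacobi_am (lem_F \<phi>) (1 / sqrt 2) = \<phi>"
  unfolding jacobi_am_def by (rule the_equality) (auto simp: lem_F_inj)

lemma lem_F_jacobi_am: "lem_F (jacobi_am x (1 / sqrt 2)) = x"
  using lem_F_surj[of x] jacobi_am_lem_F by metis

lemma jacobi_am_strict_mono: "x < y \<Longrightarrow> jacobi_am x (1 / sqrt 2) < jacobi_am y (1 / sqrt 2)"
  using lem_F_strict_mono lem_F_jacobi_am by (metis linorder_neqE less_asym)

text \<open>A monotone function whose range is open has no jumps.\<close>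

lemma continuous_jacobi_am: "continuous_on UNIV (\<lambda>x. jacobi_am x (1 / sqrt 2))"
proof (rule continuous_onI_mono)
  have "range (\<lambda>x. jacobi_am x (1 / sqrt 2)) = UNIV"
    using jacobi_am_lem_F by (metis surjI)
  then show "open (range (\<lambda>x. jacobi_am x (1 / sqrt 2)))" by simp
  show "jacobi_am x (1 / sqrt 2) \<le> jacobi_am y (1 / sqrt 2)" if "x \<le> y" for x y
    using that jacobi_am_strict_mono[of x y] by (cases "x = y") auto
qed

abbreviation lem_sd :: "real \<Rightarrow> real" where "lem_sd x \<equiv> jacobi_sd x (1 / sqrt 2)"

lemma lem_sd_eq: "lem_sd x = sin (jacobi_am x (1 / sqrt 2)) / sqrt (1 - (sin (jacobi_am x (1 / sqrt 2)))\<^sup>2 / 2)"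
  by (simp add: jacobi_sd_def jacobi_sn_def jacobi_dn_def power_divide)

lemma lem_sd_lem_F: "lem_sd (lem_F \<phi>) = sin \<phi> / sqrt (1 - (sin \<phi>)\<^sup>2 / 2)"
  by (simp add: lem_sd_eq)

lemma continuous_lem_sd: "continuous_on UNIV lem_sd"
proof -
  have "continuous_on UNIV (\<lambda>x. sin (jacobi_am x (1 / sqrt 2)) / sqrt (1 - (sin (jacobi_am x (1 / sqrt 2)))\<^sup>2 / 2))"
    using sqrt_half_sin_sq_nonzero by (intro continuous_intros continuous_jacobi_am) auto
  then show ?thesis by (simp add: lem_sd_eq)
qed

section \<open>Height along the profile curve\<close>

definition height :: "real \<Rightarrow> real \<Rightarrow> real" where
  "height a t = 1/2 * (LBINT \<tau>=0..t. (lem_sd (a * \<tau>))\<^sup>2)"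

lemma height_deriv: "(height a has_real_derivative (lem_sd (a * t))\<^sup>2 / 2) (at t)"
proof -
  have "continuous_on UNIV (\<lambda>\<tau>. (lem_sd (a * \<tau>))\<^sup>2)"
    by (intro continuous_on_power continuous_on_compose2[OF continuous_lem_sd]) (auto intro!: continuous_intros)
  from DERIV_cmult[OF LBINT_has_real_derivative[OF this, of t], of "1/2"]
  show ?thesis unfolding height_def[abs_def] by simp
qed

text \<open>The derivative \<open>sd^2 / 2\<close> is nonnegative but vanishes at the zeros of sd.
  Strictness comes from one point of strict increase, found between \<open>s\<close> and
  \<open>t\<close> because the zeros of the sine are isolated.\<close>

lemma height_strict_mono:
  assumes "a > 0" "s < t"
  shows "height a s < height a t"
proof -
  have mono: "height a x \<le> height a y" if "x \<le> y" for x y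
    using that height_deriv[of a] by (intro DERIV_nonneg_imp_nondecreasing[of x y "height a"]) (auto intro!: exI[of _ "(lem_sd (a * _))\<^sup>2 / 2"])
  define p q where "p = jacobi_am (a * s) (1 / sqrt 2)" and "q = jacobi_am (a * t) (1 / sqrt 2)"
  have pq: "p < q" using jacobi_am_strict_mono assms by (simp add: p_def q_def)
  obtain r where r: "p < r" "r < q" "sin r \<noteq> 0"
  proof (cases "sin ((p + q) / 2) = 0")
    case False
    then show ?thesis using that[of "(p + q) / 2"] pq by simp
  next
    case True
    \<comment> \<open>The midpoint is a zero of the sine; a shift by \<open>d < pi\<close> leaves
      the zero set, and \<open>d \<le> (q - p) / 4\<close> keeps the shifted point between
      \<open>p\<close> and \<open>q\<close>.\<close>
    define d where "d = min (pi / 2) ((q - p) / 4)"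
    have d: "0 < d" "d < pi" "d \<le> (q - p) / 4" using pq pi_gt_zero by (auto simp: d_def min_def)
    have "cos ((p + q) / 2) \<noteq> 0" using True sin_zero_abs_cos_one by fastforce
    then have "sin ((p + q) / 2 + d) \<noteq> 0"
      using True sin_gt_zero[OF d(1,2)] by (simp add: sin_add)
    then show ?thesis using that[of "(p + q) / 2 + d"] d pq by (simp add: field_simps)
  qed
  define u where "u = lem_F r / a"
  have u: "s < u" "u < t"
    using lem_F_strict_mono[OF r(1)] lem_F_strict_mono[OF r(2)] assms
    by (simp_all add: u_def p_def q_def lem_F_jacobi_am field_simps)
  have "(lem_sd (a * u))\<^sup>2 / 2 > 0"
    using r assms half_sin_sq_pos[of r] by (simp add: u_def lem_sd_lem_F)
  then obtain e where e: "e > 0" "\<And>h. 0 < h \<Longrightarrow> h < e \<Longrightarrow> height a u < height a (u + h)"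
    using DERIV_pos_inc_right[OF height_deriv[of a u]] by blast
  define h where "h = min (e / 2) (t - u)"
  have "height a u < height a (u + h)" using e u by (intro e(2)) (auto simp: h_def min_def)
  moreover have "height a s \<le> height a u" "height a (u + h) \<le> height a t"
    using u by (auto intro!: mono simp: h_def)
  ultimately show ?thesis by simp
qed

lemma height_inj: "a > 0 \<Longrightarrow> height a s = height a t \<longleftrightarrow> s = t"
  using height_strict_mono by (metis less_irrefl linorder_neqE)

section \<open>The model as a set of revolution\<close>

lemma vec4_eq_iff: "(x::'b^4) = y \<longleftrightarrow> x $ 1 = y $ 1 \<and> x $ 2 = y $ 2 \<and> x $ 3 = y $ 3 \<and> x $ 4 = y $ 4"
  by (simp add: vec_eq_iff forall_4)

text \<open>The radius may have either sign, as sd does. The latitude is chosen with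
  \<open>cos u \<ge> 0\<close>; at the poles the longitude is arbitrary and set to 0.\<close>

lemma spherical_coordinates:
  fixes x y z r :: real
  assumes "x\<^sup>2 + y\<^sup>2 + z\<^sup>2 = r\<^sup>2"
  shows "\<exists>u v. x = r * sin u \<and> y = r * cos u * sin v \<and> z = r * cos u * cos v"
proof (cases "r = 0")
  case True
  then show ?thesis using assms by (auto simp: add_nonneg_eq_0_iff)
next
  case False
  define w where "w = sqrt ((y / r)\<^sup>2 + (z / r)\<^sup>2)"
  have w2: "w\<^sup>2 = (y / r)\<^sup>2 + (z / r)\<^sup>2" by (simp add: w_def)
  have "(w)\<^sup>2 + (x / r)\<^sup>2 = 1"
    unfolding w2 using assms False by (simp add: power_divide field_simps)
  then obtain u where u: "w = cos u" "x / r = sin u"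
    using sincos_total_2pi by metis
  obtain v where v: "y = r * w * sin v" "z = r * w * cos v"
  proof (cases "w = 0")
    case True
    then have "y = 0" "z = 0" using w2 False by (auto simp: add_nonneg_eq_0_iff)
    then show ?thesis using that[of 0] True by simp
  next
    case w: False
    have "(z / (r * w))\<^sup>2 + (y / (r * w))\<^sup>2 = 1"
    proof -
      have "(z / (r * w))\<^sup>2 + (y / (r * w))\<^sup>2 = ((y / r)\<^sup>2 + (z / r)\<^sup>2) / w\<^sup>2"
        by (simp add: power_divide power_mult_distrib add_divide_distrib)
      then show ?thesis using w by (simp only: w2[symmetric]) simp
    qed
    then obtain v where "z / (r * w) = cos v" "y / (r * w) = sin v"
      using sincos_total_2pi by metis
    then show ?thesis using that[of v] w False by (simp add: field_simps)
  qed
  have "x = r * sin u" using u False by (simp add: field_simps)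
  then show ?thesis using v u by blast
qed

lemma vector_4:
  "vector [a, b, c, d] $ (1::4) = a" "vector [a, b, c, d] $ (2::4) = b"
  "vector [a, b, c, d] $ (3::4) = c" "vector [a, b, c, d] $ (4::4) = d" for a b c d :: real
  unfolding vector_def by simp_all

text \<open>Eliminating the two angles leaves a relation between the distance from the axis and the
  height, coupled by the profile parameter; this is the only form in which the model is used
  later.\<close>

lemma model_image_iff:
  "p \<in> model_image a \<longleftrightarrow>
    (\<exists>t. (p $ 1)\<^sup>2 + (p $ 2)\<^sup>2 + (p $ 3)\<^sup>2 = (1/a * lem_sd (a * t))\<^sup>2 \<and> p $ 4 = height a t)"
proof
  assume "p \<in> model_image a"
  then obtain t u v where p: "p = model_param a t u v" by (auto simp: model_image_def)
  define R where "R = 1/a * lem_sd (a * t)"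
  have c: "p $ 1 = R * sin u" "p $ 2 = R * cos u * sin v" "p $ 3 = R * cos u * cos v" "p $ 4 = height a t"
    unfolding p model_param_def R_def height_def by (simp_all add: vector_4)
  have "(R * sin u)\<^sup>2 + (R * cos u * sin v)\<^sup>2 + (R * cos u * cos v)\<^sup>2
    = R\<^sup>2 * ((sin u)\<^sup>2 + (cos u)\<^sup>2 * ((sin v)\<^sup>2 + (cos v)\<^sup>2))"
    by (simp only: power_mult_distrib) (simp only: algebra_simps)
  also have "\<dots> = R\<^sup>2" by simp
  finally show "\<exists>t. (p $ 1)\<^sup>2 + (p $ 2)\<^sup>2 + (p $ 3)\<^sup>2 = (1/a * lem_sd (a * t))\<^sup>2 \<and> p $ 4 = height a t"
    using c R_def by metis
next
  assume "\<exists>t. (p $ 1)\<^sup>2 + (p $ 2)\<^sup>2 + (p $ 3)\<^sup>2 = (1/a * lem_sd (a * t))\<^sup>2 \<and> p $ 4 = height a t"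
  then obtain t where t: "(p $ 1)\<^sup>2 + (p $ 2)\<^sup>2 + (p $ 3)\<^sup>2 = (1/a * lem_sd (a * t))\<^sup>2" "p $ 4 = height a t"
    by blast
  obtain u v where "p $ 1 = 1/a * lem_sd (a * t) * sin u" "p $ 2 = 1/a * lem_sd (a * t) * cos u * sin v"
    "p $ 3 = 1/a * lem_sd (a * t) * cos u * cos v"
    using spherical_coordinates[OF t(1)] by blast
  then have "p = model_param a t u v"
    using t(2) unfolding vec4_eq_iff model_param_def height_def by (simp add: vector_4)
  then show "p \<in> model_image a" by (auto simp: model_image_def)
qed

section \<open>Gauss equation\<close>

text \<open>The range of \<open>L\<close> has dimension 3 in \<open>real^4\<close>, so its
  orthogonal complement is a line.\<close>

lemma unit_normal_unique_direction:
  fixes L :: "real^3 \<Rightarrow> real^4"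
  assumes L: "linear L" "inj L" and n: "norm n = 1" "\<And>a. n \<bullet> L a = 0"
    and v: "\<And>a. v \<bullet> L a = 0"
  shows "v = (v \<bullet> n) *\<^sub>R n"
proof -
  have sub: "subspace (range L)" using L by (simp add: linear_subspace_image)
  define C where "C = {y \<in> UNIV. \<forall>x\<in>range L. orthogonal x y}"
  have "dim C + dim (range L) = dim (UNIV :: (real^4) set)"
    unfolding C_def by (rule dim_subspace_orthogonal_to_vectors) (use sub in auto)
  moreover have "dim (range L) = 3" using dim_image_eq[OF L(1), of UNIV] L(2) by (simp)
  ultimately have dC: "dim C = 1" by simp
  define w where "w = v - (v \<bullet> n) *\<^sub>R n"
  have nC: "n \<in> C" "w \<in> C"
    using n v by (auto simp: C_def orthogonal_def w_def inner_diff_left inner_commute inner_diff_right)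
  have "w = 0"
  proof (rule ccontr)
    assume w0: "w \<noteq> 0"
    have nw: "n \<bullet> w = 0" using n by (simp add: w_def inner_diff_right inner_commute norm_eq_1)
    have "n \<noteq> w" using nw n w0 by auto
    have "independent {n, w}"
      by (rule pairwise_orthogonal_independent) (use nw w0 n in \<open>auto simp: pairwise_def orthogonal_def inner_commute\<close>)
    then have "card {n, w} \<le> dim C" using nC by (intro independent_card_le_dim) auto
    then show False using \<open>n \<noteq> w\<close> dC by simp
  qed
  then show ?thesis by (simp add: w_def)
qed

lemma orthogonal_tangent_normal_zero:
  fixes L :: "real^3 \<Rightarrow> real^4"
  assumes "linear L" "inj L" "norm n = 1" "\<And>a. n \<bullet> L a = 0" "\<And>a. v \<bullet> L a = 0" "v \<bullet> n = 0"
  shows "v = 0"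
  using unit_normal_unique_direction[OF assms(1-5)] assms(6) by simp

lemma unit_normal_exists:
  fixes L :: "real^3 \<Rightarrow> real^4"
  assumes "linear L"
  obtains n where "norm n = 1" "\<And>a. n \<bullet> L a = 0"
proof -
  have "dim (range L) \<le> 3" using dim_image_le[OF assms, of UNIV] by simp
  then have "dim (range L) < DIM(real^4)" by simp
  then obtain x where x: "x \<noteq> 0" "\<And>y. y \<in> span (range L) \<Longrightarrow> orthogonal x y"
    using orthogonal_to_subspace_exists by blast
  show ?thesis
    by (rule that[of "x /\<^sub>R norm x"]) (use x in \<open>auto simp: span_base orthogonal_def\<close>)
qed

text \<open>Orthonormality of the images makes the map \<open>P\<close> from coordinates to vectors
  injective, hence onto by dimension.\<close>

lemma frame_expansion:
  fixes L :: "real^3 \<Rightarrow> real^4"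
  assumes L: "linear L" and e: "\<And>i j. L (e i) \<bullet> L (e j) = (if i = j then 1 else 0)"
  shows "a = (\<Sum>i\<in>(UNIV::3 set). (L a \<bullet> L (e i)) *\<^sub>R e i)"
proof -
  interpret linear L by fact
  define P where "P x = (\<Sum>i\<in>UNIV. (x $ i) *\<^sub>R e i)" for x :: "real^3"
  have comp: "L (P x) \<bullet> L (e i) = x $ i" for x i
    by (simp add: P_def sum scale inner_sum_left e if_distrib cong: if_cong)
  have lP: "linear P"
    by (rule linearI) (simp_all add: P_def algebra_simps sum.distrib scaleR_sum_right)
  have "inj P"
    by (rule injI) (metis comp vec_eq_iff)
  then have "surj P" using linear_injective_imp_surjective[OF lP] by simp
  then obtain x where x: "a = P x" by (metis surjD)
  show ?thesis unfolding x comp by (simp add: P_def)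
qed

lemma matrix_inv_right_inverse: "invertible A \<Longrightarrow> A ** matrix_inv A = mat 1"
  for A :: "real^'n^'n"
  unfolding invertible_def matrix_inv_def by (rule someI2_ex) auto

lemma Ck_det:
  fixes A :: "real^3 \<Rightarrow> real^'n^'n"
  assumes "open U" "\<And>i j. Ck k U (\<lambda>u. A u $ i $ j)"
  shows "Ck k U (\<lambda>u. det (A u))"
  unfolding det_def by (intro Ck_sum Ck_mult Ck_const Ck_prod assms)

text \<open>Cramer's rule writes the entries of the inverse as quotients of polynomials in the
  entries, which shows that the inverse metric inherits the class C^k.\<close>

lemma matrix_inv_cramer:
  fixes A :: "real^'n^'n"
  assumes "det A \<noteq> 0"
  shows "matrix_inv A $ k $ l = det (\<chi> i j. if j = k then axis l 1 $ i else A $ i $ j) / det A"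
proof -
  have "A *v (matrix_inv A *v axis l 1) = axis l 1"
    using assms by (simp add: matrix_vector_mul_assoc invertible_det_nz matrix_inv_right_inverse)
  then have "matrix_inv A *v axis l 1 = (\<chi> k. det (\<chi> i j. if j = k then axis l 1 $ i else A $ i $ j) / det A)"
    using cramer[OF assms] by blast
  then show ?thesis by (simp add: matrix_vector_mult_basis column_def vec_eq_iff)
qed

lemma Ck_matrix_inv:
  fixes A :: "real^3 \<Rightarrow> real^'n^'n"
  assumes U: "open U" and A: "\<And>i j. Ck k U (\<lambda>u. A u $ i $ j)" and nz: "\<And>u. u \<in> U \<Longrightarrow> det (A u) \<noteq> 0"
  shows "Ck k U (\<lambda>u. matrix_inv (A u) $ i $ j)"
proof (rule Ck_cong[OF U])
  have "Ck k U (\<lambda>u. if c = i then axis j 1 $ r else A u $ r $ c)" for r c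
    using A Ck_const by (cases "c = i") auto
  then have "Ck k U (\<lambda>u. det (\<chi> r c. if c = i then axis j 1 $ r else A u $ r $ c))"
    using Ck_det[OF U, of k "\<lambda>u. \<chi> r c. if c = i then axis j 1 $ r else A u $ r $ c"] by simp
  then show "Ck k U (\<lambda>u. det (\<chi> r c. if c = i then axis j 1 $ r else A u $ r $ c) / det (A u))"
    by (rule Ck_divide[OF U _ Ck_det[OF U A] nz])
  show "det (\<chi> r c. if c = i then axis j 1 $ r else A u $ r $ c) / det (A u) = matrix_inv (A u) $ i $ j" if "u \<in> U" for u
    using matrix_inv_cramer[OF nz[OF that]] by simp
qed

lemma pd_bilinear:
  assumes "bounded_bilinear prd" "f differentiable (at u)" "g differentiable (at u)"
  shows "pd i (\<lambda>u. prd (f u) (g u)) u = prd (f u) (pd i g u) + prd (pd i f u) (g u)"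
  using pd_eq_derivative[OF bounded_bilinear.FDERIV[OF assms(1)]] assms(2,3)
  by (simp add: frechet_derivative_works pd_def)

lemma pd_sum:
  assumes "finite A" "\<And>l. l \<in> A \<Longrightarrow> f l differentiable (at u)"
  shows "pd i (\<lambda>u. \<Sum>l\<in>A. f l u) u = (\<Sum>l\<in>A. pd i (f l) u)"
proof -
  have "((\<lambda>u. \<Sum>l\<in>A. f l u) has_derivative (\<lambda>h. \<Sum>l\<in>A. FD (f l) u h)) (at u)"
    by (rule has_derivative_sum) (use assms frechet_derivative_works in blast)
  from pd_eq_derivative[OF this, of i] show ?thesis by (simp add: pd_def)
qed

section \<open>Christoffel symbols of the induced metric and the Gauss equation\<close>

locale immersed_patch =
  fixes U :: "(real^3) set" and \<phi> :: "real^3 \<Rightarrow> real^4"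
  assumes smooth: "smooth_on U \<phi>"
    and immersion: "\<And>u. u \<in> U \<Longrightarrow> inj (FD \<phi> u)"
begin

lemma open_U: "open U" using smooth by (simp add: smooth_on_def)

lemma Ck_\<phi>: "Ck k U \<phi>" using smooth by (rule smooth_on_Ck)

lemma Ck_pd: "Ck k U (pd i \<phi>)" using Ck_\<phi>[of "Suc k"] by simp

lemma Ck_pd_pd: "Ck k U (pd i (pd j \<phi>))" using Ck_\<phi>[of "Suc (Suc k)"] by simp

lemma has_derivative_\<phi>: "u \<in> U \<Longrightarrow> (\<phi> has_derivative FD \<phi> u) (at u)"
  by (rule diff_on_open_has_derivative[OF open_U]) (use Ck_\<phi>[of "Suc 0"] in auto)

lemma differentiable_\<phi>: "u \<in> U \<Longrightarrow> \<phi> differentiable (at u)"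
  using has_derivative_\<phi> differentiable_def by blast

lemma Ck_at: "Ck (Suc 0) U f \<Longrightarrow> u \<in> U \<Longrightarrow> f differentiable (at u)"
  using differentiable_on_eq_differentiable_at[OF open_U] by auto

lemma linear_FD: "u \<in> U \<Longrightarrow> linear (FD \<phi> u)"
  using linear_frechet_derivative differentiable_\<phi> by blast

lemma pd_commute: "u \<in> U \<Longrightarrow> pd i (pd j \<phi>) u = pd j (pd i \<phi>) u"
  using Ck2_symmetric[OF open_U Ck_\<phi>, of u "axis i 1" "axis j 1"] by (simp add: pd_def[abs_def])

lemma pd_pd_commute: "u \<in> U \<Longrightarrow> pd i (pd j (pd k \<phi>)) u = pd j (pd i (pd k \<phi>)) u"
proof -
  assume u: "u \<in> U"
  have "Ck (Suc (Suc 0)) U (pd k \<phi>)" by (rule Ck_pd)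
  from Ck2_symmetric[OF open_U this u, of "axis i 1" "axis j 1"]
  show ?thesis by (simp add: pd_def[abs_def])
qed

abbreviation "g \<equiv> induced_metric \<phi>"

lemma metric_entry: "g u $ i $ j = pd i \<phi> u \<bullet> pd j \<phi> u"
  by (simp add: induced_metric_def)

lemma inner_at_metric: "u \<in> U \<Longrightarrow> inner_at g u a b = FD \<phi> u a \<bullet> FD \<phi> u b"
  by (simp add: inner_at_def metric_entry frechet_derivative_pd differentiable_\<phi> inner_sum_left
      inner_sum_right sum_distrib_left mult_ac) (rule sum.swap)

lemma det_metric_nonzero:
  assumes u: "u \<in> U" shows "det (g u) \<noteq> 0"
proof -
  have "a = 0" if "g u *v a = 0" for a
  proof -
    have "inner_at g u a a = a \<bullet> (g u *v a)"
      by (simp add: inner_at_def inner_vec_def matrix_vector_mult_def sum_distrib_left mult_ac)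
    then have "FD \<phi> u a = 0" using that inner_at_metric[OF u, of a a] by simp
    then show "a = 0" using linear_injective_0[OF linear_FD[OF u]] immersion[OF u] by blast
  qed
  then have "\<exists>B. B ** g u = mat 1" by (simp add: matrix_left_invertible_ker)
  then have "invertible (g u)" by (simp add: invertible_left_inverse)
  then show ?thesis by (simp add: invertible_det_nz)
qed

lemma pd_metric: "u \<in> U \<Longrightarrow> pd i (\<lambda>w. g w $ j $ l) u = pd i (pd j \<phi>) u \<bullet> pd l \<phi> u + pd j \<phi> u \<bullet> pd i (pd l \<phi>) u"
  unfolding metric_entry using pd_bilinear[OF bounded_bilinear_inner Ck_at Ck_at, of "pd j \<phi>" u "pd l \<phi>" i] Ck_pd
  by simp

text \<open>The product rule turns the three metric derivatives into six terms; by symmetry of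
  second partials four of them cancel and the other two coincide.\<close>

lemma christoffel_eq:
  assumes u: "u \<in> U"
  shows "christoffel g k i j u = (\<Sum>l\<in>UNIV. matrix_inv (g u) $ k $ l * (pd i (pd j \<phi>) u \<bullet> pd l \<phi> u))"
proof -
  have "pd i (\<lambda>w. g w $ j $ l) u + pd j (\<lambda>w. g w $ i $ l) u - pd l (\<lambda>w. g w $ i $ j) u
      = 2 * (pd i (pd j \<phi>) u \<bullet> pd l \<phi> u)" for l
    using u by (simp add: pd_metric pd_commute[OF u, of j i] pd_commute[OF u, of l] inner_commute)
  then show ?thesis unfolding christoffel_def by (simp add: sum_distrib_left mult_ac)
qed

lemma christoffel_lower:
  assumes u: "u \<in> U"
  shows "(\<Sum>k\<in>UNIV. g u $ s $ k * christoffel g k i j u) = pd i (pd j \<phi>) u \<bullet> pd s \<phi> u"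
proof -
  have inv: "g u ** matrix_inv (g u) = mat 1"
    using det_metric_nonzero[OF u] by (simp add: invertible_det_nz matrix_inv_right_inverse)
  define v where "v = (\<chi> l. pd i (pd j \<phi>) u \<bullet> pd l \<phi> u)"
  have "(\<chi> k. christoffel g k i j u) = matrix_inv (g u) *v v"
    by (simp add: christoffel_eq[OF u] matrix_vector_mult_def v_def)
  then have "g u *v (\<chi> k. christoffel g k i j u) = v"
    by (simp add: matrix_vector_mul_assoc inv)
  then have "(g u *v (\<chi> k. christoffel g k i j u)) $ s = v $ s" by simp
  then show ?thesis by (simp add: matrix_vector_mult_def v_def)
qed

lemma Ck_metric: "Ck k U (\<lambda>u. g u $ i $ j)"
  unfolding metric_entry by (intro Ck_inner open_U Ck_pd)

lemma Ck_christoffel: "Ck k U (christoffel g l i j)"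
proof (rule Ck_cong[OF open_U])
  show "Ck k U (\<lambda>u. \<Sum>m\<in>UNIV. matrix_inv (g u) $ l $ m * (pd i (pd j \<phi>) u \<bullet> pd m \<phi> u))"
    by (intro Ck_sum Ck_mult Ck_matrix_inv Ck_metric Ck_inner Ck_pd Ck_pd_pd open_U det_metric_nonzero)
qed (simp add: christoffel_eq)

text \<open>By \<open>christoffel_lower\<close> the Christoffel symbols are exactly the tangential
  components of the second partials, so what remains after subtracting both parts is orthogonal to a
  basis of \<open>real^4\<close>.\<close>

lemma gauss_formula:
  assumes u: "u \<in> U" and n: "norm n = 1" "\<And>a. n \<bullet> FD \<phi> u a = 0"
  shows "pd i (pd j \<phi>) u = (\<Sum>k\<in>UNIV. christoffel g k i j u *\<^sub>R pd k \<phi> u) + (pd i (pd j \<phi>) u \<bullet> n) *\<^sub>R n"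
proof -
  define v where "v = pd i (pd j \<phi>) u - (\<Sum>k\<in>UNIV. christoffel g k i j u *\<^sub>R pd k \<phi> u) - (pd i (pd j \<phi>) u \<bullet> n) *\<^sub>R n"
  have nk: "n \<bullet> pd k \<phi> u = 0" "pd k \<phi> u \<bullet> n = 0" for k using n by (auto simp: pd_def inner_commute)
  have vs: "v \<bullet> pd s \<phi> u = 0" for s
  proof -
    have "(\<Sum>k\<in>UNIV. christoffel g k i j u * (pd k \<phi> u \<bullet> pd s \<phi> u)) = pd i (pd j \<phi>) u \<bullet> pd s \<phi> u"
      unfolding christoffel_lower[OF u, symmetric] metric_entry by (simp add: inner_commute mult.commute)
    then show ?thesis by (simp add: v_def inner_diff_left inner_sum_left nk)
  qed
  have "v = 0"
  proof (rule orthogonal_tangent_normal_zero[OF linear_FD[OF u] immersion[OF u] n])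
    show "v \<bullet> FD \<phi> u a = 0" for a
      using vs by (simp add: frechet_derivative_pd differentiable_\<phi>[OF u] inner_sum_right)
    show "v \<bullet> n = 0" using n by (simp add: v_def inner_diff_left inner_sum_left nk norm_eq_1)
  qed
  then show ?thesis by (simp add: v_def algebra_simps)
qed

text \<open>Differentiating the lowered identity \<open>christoffel_lower\<close>, rather than the
  formula with \<open>matrix_inv\<close>, keeps derivatives of the inverse metric out of the
  computation.\<close>

lemma christoffel_derivative_lower:
  assumes u: "u \<in> U"
  shows "(\<Sum>l\<in>UNIV. g u $ s $ l * pd i (christoffel g l j k) u) =
    pd i (pd j (pd k \<phi>)) u \<bullet> pd s \<phi> u + pd j (pd k \<phi>) u \<bullet> pd i (pd s \<phi>) u
    - (\<Sum>l\<in>UNIV. (pd i (pd s \<phi>) u \<bullet> pd l \<phi> u + pd s \<phi> u \<bullet> pd i (pd l \<phi>) u) * christoffel g l j k u)"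
proof -
  have 1: "(\<lambda>w. g w $ s $ l) differentiable (at u)" "christoffel g l j k differentiable (at u)" for l
    using Ck_at[OF Ck_metric u] Ck_at[OF Ck_christoffel u] by auto
  have "pd i (\<lambda>w. \<Sum>l\<in>UNIV. g w $ s $ l * christoffel g l j k w) u = pd i (\<lambda>w. pd j (pd k \<phi>) w \<bullet> pd s \<phi> w) u"
    by (rule pd_cong[OF open_U u]) (rule christoffel_lower)
  also have "\<dots> = pd i (pd j (pd k \<phi>)) u \<bullet> pd s \<phi> u + pd j (pd k \<phi>) u \<bullet> pd i (pd s \<phi>) u"
    using pd_bilinear[OF bounded_bilinear_inner Ck_at[OF Ck_pd_pd u] Ck_at[OF Ck_pd u], of i j k s] by simp
  also have "pd i (\<lambda>w. \<Sum>l\<in>UNIV. g w $ s $ l * christoffel g l j k w) u =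
      (\<Sum>l\<in>UNIV. pd i (\<lambda>w. g w $ s $ l * christoffel g l j k w) u)"
    by (rule pd_sum) (auto intro: differentiable_mult 1)
  also have "\<dots> = (\<Sum>l\<in>UNIV. g u $ s $ l * pd i (christoffel g l j k) u) + (\<Sum>l\<in>UNIV. pd i (\<lambda>w. g w $ s $ l) u * christoffel g l j k u)"
    by (subst pd_bilinear[OF bounded_bilinear_mult 1]) (rule sum.distrib)
  finally show ?thesis by (simp add: pd_metric[OF u])
qed

text \<open>The normal \<open>n\<close> belongs to the one point \<open>u\<close>; no normal field
  is differentiated. Third derivatives cancel by antisymmetry in \<open>i\<close> and
  \<open>j\<close>, the tangential parts of the products of second derivatives cancel against the
  quadratic Christoffel terms, and the normal parts remain.\<close>

lemma gauss_equation:
  assumes u: "u \<in> U" and n: "norm n = 1" "\<And>a. n \<bullet> FD \<phi> u a = 0"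
  defines "h \<equiv> \<lambda>i j. pd i (pd j \<phi>) u \<bullet> n"
  shows "(\<Sum>l\<in>UNIV. g u $ s $ l * riemann g l i j k u) = h i s * h j k - h j s * h i k"
proof -
  have quad: "(\<Sum>l\<in>UNIV. g u $ s $ l * (\<Sum>m\<in>UNIV. christoffel g m j k u * christoffel g l i m u))
      = (\<Sum>l\<in>UNIV. (pd s \<phi> u \<bullet> pd i (pd l \<phi>) u) * christoffel g l j k u)" for i j
  proof -
    have "(\<Sum>l\<in>UNIV. g u $ s $ l * (\<Sum>m\<in>UNIV. christoffel g m j k u * christoffel g l i m u))
      = (\<Sum>l\<in>UNIV. \<Sum>m\<in>UNIV. christoffel g m j k u * (g u $ s $ l * christoffel g l i m u))"
      by (simp add: sum_distrib_left mult_ac)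
    also have "\<dots> = (\<Sum>m\<in>UNIV. christoffel g m j k u * (\<Sum>l\<in>UNIV. g u $ s $ l * christoffel g l i m u))"
      by (subst sum.swap) (simp add: sum_distrib_left)
    also have "\<dots> = (\<Sum>m\<in>UNIV. christoffel g m j k u * (pd i (pd m \<phi>) u \<bullet> pd s \<phi> u))"
      by (simp add: christoffel_lower[OF u])
    finally show ?thesis by (simp add: mult_ac inner_commute)
  qed
  have half: "(\<Sum>l\<in>UNIV. g u $ s $ l * pd i (christoffel g l j k) u)
      + (\<Sum>l\<in>UNIV. g u $ s $ l * (\<Sum>m\<in>UNIV. christoffel g m j k u * christoffel g l i m u))
      = pd i (pd j (pd k \<phi>)) u \<bullet> pd s \<phi> u + h i s * h j k" for i j
  proof -
    have nk: "n \<bullet> pd k \<phi> u = 0" for k using n by (auto simp: pd_def)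
    have "pd j (pd k \<phi>) u \<bullet> pd i (pd s \<phi>) u
        = (\<Sum>l\<in>UNIV. christoffel g l j k u *\<^sub>R pd l \<phi> u) \<bullet> pd i (pd s \<phi>) u + h j k * (n \<bullet> pd i (pd s \<phi>) u)"
      by (subst gauss_formula[OF u n]) (simp add: inner_add_left h_def)
    then have "pd j (pd k \<phi>) u \<bullet> pd i (pd s \<phi>) u
        = (\<Sum>l\<in>UNIV. (pd i (pd s \<phi>) u \<bullet> pd l \<phi> u) * christoffel g l j k u) + h i s * h j k"
      unfolding inner_sum_left inner_scaleR_left by (simp add: h_def inner_commute mult.commute)
    then show ?thesis
      unfolding christoffel_derivative_lower[OF u] quad by (simp add: distrib_right sum.distrib)
  qed
  have "(\<Sum>l\<in>UNIV. g u $ s $ l * riemann g l i j k u) =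
      ((\<Sum>l\<in>UNIV. g u $ s $ l * pd i (christoffel g l j k) u)
      + (\<Sum>l\<in>UNIV. g u $ s $ l * (\<Sum>m\<in>UNIV. christoffel g m j k u * christoffel g l i m u)))
     - ((\<Sum>l\<in>UNIV. g u $ s $ l * pd j (christoffel g l i k) u)
      + (\<Sum>l\<in>UNIV. g u $ s $ l * (\<Sum>m\<in>UNIV. christoffel g m i k u * christoffel g l j m u)))"
    unfolding riemann_def by (simp add: sum_subtractf sum.distrib algebra_simps)
  then show ?thesis unfolding half using pd_pd_commute[OF u, of i j k] by simp
qed

lemma unit_normal:
  assumes u: "u \<in> U"
  shows "norm (unit_normal \<phi> u) = 1" "unit_normal \<phi> u \<bullet> FD \<phi> u a = 0"
proof -
  have "\<exists>n. norm n = 1 \<and> (\<forall>v. n \<bullet> FD \<phi> u v = 0)"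
    using unit_normal_exists[OF linear_FD[OF u]] by metis
  from someI_ex[OF this] show "norm (unit_normal \<phi> u) = 1" "unit_normal \<phi> u \<bullet> FD \<phi> u a = 0"
    unfolding unit_normal_def by blast+
qed

abbreviation "II \<equiv> second_fundamental_form \<phi>"

lemma curvature_inner:
  assumes u: "u \<in> U"
  shows "inner_at g u (curvature_op g u a b b) a = II u a a * II u b b - (II u a b)\<^sup>2"
proof -
  define h where "h i j = pd i (pd j \<phi>) u \<bullet> unit_normal \<phi> u" for i j
  have hs: "h i j = h j i" for i j unfolding h_def using pd_commute[OF u] by simp
  have R: "(\<Sum>l\<in>UNIV. g u $ l $ s * riemann g l i j k u) = h i s * h j k - h j s * h i k" for s i j k
    using gauss_equation[OF u unit_normal[OF u], of s i j k] unfolding h_def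
    by (simp add: metric_entry inner_commute)
  have "inner_at g u (curvature_op g u a b b) a =
      (\<Sum>s\<in>UNIV. \<Sum>l\<in>UNIV. g u $ l $ s * a $ s * (\<Sum>i\<in>UNIV. \<Sum>j\<in>UNIV. \<Sum>k\<in>UNIV. riemann g l i j k u * a $ i * b $ j * b $ k))"
    unfolding inner_at_def curvature_op_def by (subst sum.swap) (simp add: mult_ac)
  also have "\<dots> = (\<Sum>s\<in>UNIV. \<Sum>i\<in>UNIV. \<Sum>j\<in>UNIV. \<Sum>k\<in>UNIV. a $ s * a $ i * b $ j * b $ k * (\<Sum>l\<in>UNIV. g u $ l $ s * riemann g l i j k u))"
    unfolding sum_3 by (simp add: algebra_simps)
  also have "\<dots> = (\<Sum>s\<in>UNIV. \<Sum>i\<in>UNIV. \<Sum>j\<in>UNIV. \<Sum>k\<in>UNIV. (a $ s * a $ i * h s i) * (b $ j * b $ k * h j k))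
      - (\<Sum>s\<in>UNIV. \<Sum>i\<in>UNIV. \<Sum>j\<in>UNIV. \<Sum>k\<in>UNIV. (a $ s * b $ j * h s j) * (a $ i * b $ k * h i k))"
    unfolding R sum_subtractf[symmetric] by (simp add: right_diff_distrib mult_ac hs[of _ s for s])
  also have "(\<Sum>s\<in>UNIV. \<Sum>i\<in>UNIV. \<Sum>j\<in>UNIV. \<Sum>k\<in>UNIV. (a $ s * a $ i * h s i) * (b $ j * b $ k * h j k)) = II u a a * II u b b"
    unfolding second_fundamental_form_def h_def[symmetric] sum_distrib_right unfolding sum_distrib_left ..
  also have "(\<Sum>s\<in>UNIV. \<Sum>i\<in>UNIV. \<Sum>j\<in>UNIV. \<Sum>k\<in>UNIV. (a $ s * b $ j * h s j) * (a $ i * b $ k * h i k))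
     = (\<Sum>s\<in>UNIV. \<Sum>j\<in>UNIV. \<Sum>i\<in>UNIV. \<Sum>k\<in>UNIV. (a $ s * b $ j * h s j) * (a $ i * b $ k * h i k))"
    by (rule sum.cong[OF refl], rule sum.swap)
  also have "\<dots> = (II u a b)\<^sup>2"
    unfolding second_fundamental_form_def h_def[symmetric] power2_eq_square sum_distrib_right
    unfolding sum_distrib_left ..
  finally show ?thesis .
qed

end

section \<open>The equality case\<close>

lemma transpose_entry: "transpose A $ i $ j = A $ j $ i"
  by (simp add: transpose_def)

text \<open>In an orthonormal basis starting with \<open>x, y\<close>, the difference of the two sides of \<open>le\<close> is
  \<open>(h\<^sub>1\<^sub>1 + h\<^sub>2\<^sub>2 - h\<^sub>3\<^sub>3)\<^sup>2 + 2 (h\<^sub>1\<^sub>1 - h\<^sub>2\<^sub>2)\<^sup>2 + 8 h\<^sub>1\<^sub>2\<^sup>2 + 4 h\<^sub>1\<^sub>3\<^sup>2 + 4 h\<^sub>2\<^sub>3\<^sup>2\<close>.\<close>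

lemma casorati_equality_algebra:
  fixes H :: "real^3^3" and x y :: "real^3"
  defines "q \<equiv> \<lambda>v w. v \<bullet> (H *v w)"
  assumes sym: "transpose H = H"
    and xy: "norm x = 1" "norm y = 1" "x \<bullet> y = 0"
    and le: "(\<Sum>i\<in>UNIV. \<Sum>j\<in>UNIV. (H$i$j)\<^sup>2) + 2 * ((q x x)\<^sup>2 + 2 * (q x y)\<^sup>2 + (q y y)\<^sup>2)
       \<le> (trace H)\<^sup>2 - (\<Sum>i\<in>UNIV. \<Sum>j\<in>UNIV. (H$i$j)\<^sup>2)"
  shows "\<exists>l z. norm z = 1 \<and> (\<forall>v w. q v w = l * (v \<bullet> w + (z \<bullet> v) * (z \<bullet> w)))"
proof -
  \<comment> \<open>The normal of the plane spanned by \<open>x\<close> and \<open>y\<close> turns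
    out to be the direction of the doubled curvature.\<close>
  define z where "z = cross3 x y"
  have z: "norm z = 1" "x \<bullet> z = 0" "y \<bullet> z = 0"
    using norm_cross_dot[of x y] xy norm_ge_zero[of "cross3 x y"] unfolding z_def
    by (auto simp: dot_cross_self power2_eq_1_iff)
  define Q :: "real^3^3" where "Q = vector [x, y, z]"
  have Q: "Q $ 1 = x" "Q $ 2 = y" "Q $ 3 = z" by (simp_all add: Q_def)
  have dots: "x \<bullet> x = 1" "y \<bullet> y = 1" "z \<bullet> z = 1" "y \<bullet> x = 0" "z \<bullet> x = 0" "z \<bullet> y = 0"
    using xy z by (auto simp: norm_eq_1 inner_commute)
  have QQt: "Q ** transpose Q = mat 1"
  proof -
    have "(Q ** transpose Q) $ i $ j = Q $ i \<bullet> Q $ j" for i j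
      by (simp add: matrix_matrix_mult_def transpose_def inner_vec_def)
    then show ?thesis by (simp add: vec_eq_iff forall_3 Q mat_def dots xy z)
  qed
  then have QtQ: "transpose Q ** Q = mat 1" using matrix_left_right_inverse by blast
  define B where "B = Q ** H ** transpose Q"
  have Hq: "H = transpose Q ** B ** Q"
    unfolding B_def by (metis QtQ matrix_mul_assoc matrix_mul_lid matrix_mul_rid)
  have tQ: "transpose Q *v axis k 1 = Q $ k" for k
    by (simp only: matrix_vector_mult_basis) (simp add: column_def transpose_def vec_eq_iff)
  have Bq: "B $ i $ j = q (Q $ i) (Q $ j)" for i j
  proof -
    have "B $ i $ j = axis i 1 \<bullet> (B *v axis j 1)"
      by (simp add: inner_axis' matrix_vector_mult_basis column_def)
    also have "\<dots> = (transpose Q *v axis i 1) \<bullet> (H *v (transpose Q *v axis j 1))"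
      unfolding B_def by (simp add: dot_lmul_matrix flip: matrix_vector_mul_assoc)
    finally show ?thesis unfolding q_def tQ .
  qed
  have tr: "trace B = trace H"
    unfolding B_def by (metis QtQ matrix_mul_assoc matrix_mul_lid trace_mul_sym)
  have symB: "transpose B = B"
    unfolding B_def by (simp add: matrix_transpose_mul sym matrix_mul_assoc)
  have tr2: "trace (B ** B) = trace (H ** H)"
  proof -
    have "B ** B = Q ** H ** (transpose Q ** Q) ** H ** transpose Q"
      unfolding B_def by (simp only: matrix_mul_assoc)
    then have "B ** B = Q ** (H ** H ** transpose Q)" by (simp add: QtQ matrix_mul_assoc)
    then have "trace (B ** B) = trace (H ** H ** transpose Q ** Q)" using trace_mul_sym by metis
    then show ?thesis by (simp add: QtQ flip: matrix_mul_assoc)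
  qed
  \<comment> \<open>For a symmetric matrix the sum of squared entries is the trace of the square,
    hence unchanged by the rotation \<open>Q\<close>.\<close>
  have fro: "trace (A ** A) = (\<Sum>i\<in>UNIV. \<Sum>j\<in>UNIV. (A$i$j)\<^sup>2)" if "transpose A = A" for A :: "real^3^3"
  proof -
    have "A $ i $ j = A $ j $ i" for i j using that by (metis transpose_entry)
    then have "A $ i $ k * A $ k $ i = (A $ i $ k)\<^sup>2" for i k by (metis power2_eq_square)
    then show ?thesis unfolding trace_def matrix_matrix_mult_def by simp
  qed
  have s: "B$2$1 = B$1$2" "B$3$1 = B$1$3" "B$3$2 = B$2$3"
    using symB by (metis transpose_entry)+
  have "(\<Sum>i\<in>UNIV. \<Sum>j\<in>UNIV. (B$i$j)\<^sup>2) + 2 * ((B$1$1)\<^sup>2 + 2 * (B$1$2)\<^sup>2 + (B$2$2)\<^sup>2)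
       \<le> (trace B)\<^sup>2 - (\<Sum>i\<in>UNIV. \<Sum>j\<in>UNIV. (B$i$j)\<^sup>2)"
    using le unfolding Bq Q fro[OF sym, symmetric] fro[OF symB, symmetric] tr tr2
    by (simp add: Bq[symmetric] fro[OF symB, symmetric] tr2)
  then have "(B$1$1 + B$2$2 - B$3$3)\<^sup>2 + 2 * (B$1$1 - B$2$2)\<^sup>2 + 8 * (B$1$2)\<^sup>2 + 4 * (B$1$3)\<^sup>2 + 4 * (B$2$3)\<^sup>2 \<le> 0"
    unfolding sum_3 trace_def s by (simp add: power2_eq_square algebra_simps)
  then have "(B$1$1 + B$2$2 - B$3$3)\<^sup>2 = 0" "(B$1$1 - B$2$2)\<^sup>2 = 0" "(B$1$2)\<^sup>2 = 0" "(B$1$3)\<^sup>2 = 0" "(B$2$3)\<^sup>2 = 0"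
    using zero_le_power2[of "B$1$1 + B$2$2 - B$3$3"] zero_le_power2[of "B$1$1 - B$2$2"]
      zero_le_power2[of "B$1$2"] zero_le_power2[of "B$1$3"] zero_le_power2[of "B$2$3"] by linarith+
  then have e: "B$2$2 = B$1$1" "B$3$3 = 2 * B$1$1" "B$1$2 = 0" "B$1$3 = 0" "B$2$3 = 0" by simp_all
  have Q3: "(Q *v v) $ 3 = z \<bullet> v" for v by (simp add: matrix_mult_dot Q)
  have "q v w = B$1$1 * (v \<bullet> w + (z \<bullet> v) * (z \<bullet> w))" for v w
  proof -
    have "q v w = (Q *v v) \<bullet> (B *v (Q *v w))"
      unfolding q_def Hq by (metis dot_lmul_matrix matrix_vector_mul_assoc vector_transpose_matrix)
    also have "\<dots> = B$1$1 * ((Q *v v) \<bullet> (Q *v w) + (Q *v v) $ 3 * (Q *v w) $ 3)"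
      by (simp add: inner_vec_def matrix_vector_mult_def[of B] sum_3 e s algebra_simps)
    also have "(Q *v v) \<bullet> (Q *v w) = v \<bullet> w"
      by (metis QtQ dot_lmul_matrix matrix_vector_mul_assoc matrix_vector_mul_lid vector_transpose_matrix transpose_transpose)
    finally show ?thesis unfolding Q3 .
  qed
  then show ?thesis using z by blast
qed

lemma atLeastAtMost_1_3: "{1..3} = {1, 2, 3::nat}" by auto
lemma atLeastAtMost_1_2: "{1..2} = {1, 2::nat}" by auto

lemma sum_pairs_1_3: "(\<Sum>j\<in>{1..3::nat}. \<Sum>i\<in>{1..<j}. f i j) = f 1 2 + f 1 3 + f 2 3"
  for f :: "nat \<Rightarrow> nat \<Rightarrow> real"
  by (simp add: eval_nat_numeral)

context immersed_patch
begin

text \<open>This gives meaning to the \<open>SOME\<close> frames in the curvature definitions. The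
  frame is an orthonormal basis of the image of \<open>L\<close> in \<open>real^4\<close>, pulled
  back.\<close>

lemma orthonormal_frame_exists:
  assumes u: "u \<in> U" and L: "subspace L"
  shows "\<exists>e. orthonormal_frame g u L e"
proof -
  interpret lin: linear "FD \<phi> u" by (rule linear_FD[OF u])
  have inj: "inj (FD \<phi> u)" by (rule immersion[OF u])
  have sub: "subspace (FD \<phi> u ` L)" by (rule linear_subspace_image[OF linear_FD[OF u] L])
  have dimL: "dim (FD \<phi> u ` L) = dim L"
    by (rule dim_image_eq[OF linear_FD[OF u]]) (use inj in \<open>auto intro: inj_on_subset\<close>)
  obtain B where B: "B \<subseteq> FD \<phi> u ` L" "pairwise orthogonal B" "\<And>x. x \<in> B \<Longrightarrow> norm x = 1"
    "independent B" "card B = dim (FD \<phi> u ` L)"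
    using orthonormal_basis_subspace[OF sub] by metis
  have "finite B" using B(4) independent_imp_finite by blast
  then obtain b where b: "bij_betw b {1..dim L} B"
    using ex_bij_betw_nat_finite_1[of B] B(5) dimL by auto
  have "\<exists>x. x \<in> L \<and> FD \<phi> u x = b i" if "i \<in> {1..dim L}" for i
  proof -
    have "b i \<in> FD \<phi> u ` L" using b B(1) that by (auto simp: bij_betw_def)
    then show ?thesis by force
  qed
  then obtain e where e: "\<And>i. i \<in> {1..dim L} \<Longrightarrow> e i \<in> L \<and> FD \<phi> u (e i) = b i" by metis
  have "b i \<bullet> b j = (if i = j then 1 else 0)" if "i \<in> {1..dim L}" "j \<in> {1..dim L}" for i j
  proof (cases "i = j")
    case True
    then show ?thesis using b B(3) that by (auto simp: bij_betw_def norm_eq_1)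
  next
    case False
    then have "b i \<noteq> b j" using b that by (auto simp: bij_betw_def inj_on_def)
    then show ?thesis using False b B(2) that by (auto simp: bij_betw_def pairwise_def orthogonal_def)
  qed
  then have "orthonormal_frame g u L e"
    unfolding orthonormal_frame_def inner_at_metric[OF u] using e by simp
  then show ?thesis by blast
qed

lemma II_bilinear:
  "II u (\<Sum>i\<in>UNIV. x i *\<^sub>R e i) (\<Sum>j\<in>UNIV. y j *\<^sub>R f j) = (\<Sum>i\<in>UNIV. \<Sum>j\<in>UNIV. x i * y j * II u (e i) (f j))"
  for x y :: "3 \<Rightarrow> real"
  unfolding second_fundamental_form_def sum_3 by (simp add: algebra_simps)

lemma II_sym: "u \<in> U \<Longrightarrow> II u a b = II u b a"
  unfolding second_fundamental_form_def by (subst sum.swap) (simp add: pd_commute mult_ac)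

text \<open>The infimum over planes is replaced by the minimum of \<open>val\<close> over
  orthonormal pairs, attained by compactness. Only the bound of the infimum from below by this
  minimum is used: together with equality it gives the hypothesis of
  \<open>casorati_equality_algebra\<close> at the minimizing pair.\<close>

lemma casorati_equality_shape:
  assumes u: "u \<in> U"
    and eq: "normalized_scalar_curvature g u = delta_casorati \<phi> u"
  shows "\<exists>l \<tau>. norm (FD \<phi> u \<tau>) = 1 \<and>
    (\<forall>a b. II u a b = l * (FD \<phi> u a \<bullet> FD \<phi> u b + (FD \<phi> u \<tau> \<bullet> FD \<phi> u a) * (FD \<phi> u \<tau> \<bullet> FD \<phi> u b)))"
proof -
  interpret lin: linear "FD \<phi> u" by (rule linear_FD[OF u])
  define en where "en = (SOME e. orthonormal_frame g u UNIV e)"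
  have en: "orthonormal_frame g u UNIV en"
    unfolding en_def using orthonormal_frame_exists[OF u subspace_UNIV] by (rule someI_ex)
  define e :: "3 \<Rightarrow> real^3" where "e = (\<lambda>i. if i = 1 then en 1 else if i = 2 then en 2 else en 3)"
  have e123: "e 1 = en 1" "e 2 = en 2" "e 3 = en 3" by (auto simp: e_def)
  have ee: "FD \<phi> u (e i) \<bullet> FD \<phi> u (e j) = (if i = j then 1 else 0)" for i j
    using en exhaust_3[of i] exhaust_3[of j]
    unfolding orthonormal_frame_def inner_at_metric[OF u] by (auto simp: atLeastAtMost_1_3 e123)
  define H :: "real^3^3" where "H = (\<chi> i j. II u (e i) (e j))"
  have sym: "transpose H = H" by (simp add: H_def transpose_def vec_eq_iff II_sym[OF u])
  define q where "q v w = v \<bullet> (H *v w)" for v w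
  define c where "c a = (\<chi> i. FD \<phi> u a \<bullet> FD \<phi> u (e i))" for a
  have exp: "a = (\<Sum>i\<in>UNIV. (c a $ i) *\<^sub>R e i)" for a
    unfolding c_def using frame_expansion[OF linear_FD[OF u] ee, of a] by simp
  have IIq: "II u a b = q (c a) (c b)" for a b
  proof -
    have "II u a b = (\<Sum>i\<in>UNIV. \<Sum>j\<in>UNIV. c a $ i * c b $ j * II u (e i) (e j))"
      by (subst exp[of a], subst exp[of b]) (rule II_bilinear)
    then show ?thesis
      by (simp add: q_def inner_vec_def matrix_vector_mult_def H_def sum_distrib_left mult_ac)
  qed
  have cc: "c a \<bullet> c b = FD \<phi> u a \<bullet> FD \<phi> u b" for a b
  proof -
    have "FD \<phi> u a = (\<Sum>i\<in>UNIV. c a $ i *\<^sub>R FD \<phi> u (e i))" for a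
      by (subst exp[of a]) (simp add: lin.sum lin.scale)
    then have "FD \<phi> u a \<bullet> FD \<phi> u b = (\<Sum>i\<in>UNIV. c a $ i *\<^sub>R FD \<phi> u (e i)) \<bullet> FD \<phi> u b" by metis
    moreover have "c a \<bullet> c b = (\<Sum>i\<in>UNIV. c a $ i * c b $ i)" by (simp add: inner_vec_def)
    ultimately show ?thesis unfolding inner_sum_left inner_scaleR_left by (simp add: c_def inner_commute)
  qed
  define fro where "fro = (\<Sum>i\<in>UNIV. \<Sum>j\<in>UNIV. (H$i$j)\<^sup>2)"
  have sc: "sectional_curvature g u (en i) (en j) = II u (en i) (en i) * II u (en j) (en j) - (II u (en i) (en j))\<^sup>2"
    if "i \<in> {1..3}" "j \<in> {1..3}" "i \<noteq> j" for i j
    using en that unfolding sectional_curvature_def curvature_inner[OF u] orthonormal_frame_def by simp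
  \<comment> \<open>The sum of the three sectional curvatures is the second elementary symmetric
    function of \<open>H\<close>, that is half of \<open>(trace H)\<^sup>2 - fro\<close>.\<close>
  have rho: "normalized_scalar_curvature g u = ((trace H)\<^sup>2 - fro) / 6"
    unfolding normalized_scalar_curvature_def Let_def en_def[symmetric] fro_def trace_def sum_3 H_def
    using II_sym[OF u, of "e 2" "e 1"] II_sym[OF u, of "e 3" "e 1"] II_sym[OF u, of "e 3" "e 2"]
    unfolding sum_pairs_1_3 by (simp add: sc e123 power2_eq_square algebra_simps)
  have d3: "dim (UNIV :: (real^3) set) = 3" by simp
  have cas: "casorati_curvature \<phi> u UNIV = fro / 3"
    unfolding casorati_curvature_def Let_def en_def[symmetric] fro_def sum_3 H_def d3 atLeastAtMost_1_3
    by (simp add: e123)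
  define K where "K = {p :: (real^3) \<times> (real^3). norm (fst p) = 1 \<and> norm (snd p) = 1 \<and> fst p \<bullet> snd p = 0}"
  define val where "val p = (q (fst p) (fst p))\<^sup>2 + 2 * (q (fst p) (snd p))\<^sup>2 + (q (snd p) (snd p))\<^sup>2" for p
  have "compact K"
  proof -
    have "K \<subseteq> sphere 0 1 \<times> sphere 0 1" by (auto simp: K_def)
    moreover have "closed K"
      unfolding K_def by (intro closed_Collect_conj closed_Collect_eq continuous_intros)
    moreover have "compact (sphere (0::real^3) 1 \<times> sphere (0::real^3) 1)"
      by (intro compact_Times compact_sphere)
    ultimately show ?thesis using closed_Int_compact by (metis inf.absorb1)
  qed
  moreover have "K \<noteq> {}"
  proof -
    have "(axis 1 1, axis 2 1) \<in> K" by (auto simp: K_def inner_axis_axis)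
    then show ?thesis by blast
  qed
  moreover have "continuous_on K val"
  proof -
    have H: "continuous_on K (\<lambda>p. H *v f p)" if "continuous_on K f" for f
      using that by (intro linear_continuous_on_compose[where g="(*v) H"]) auto
    show ?thesis unfolding val_def q_def by (intro continuous_intros H)
  qed
  ultimately obtain p where p: "p \<in> K" "\<And>p'. p' \<in> K \<Longrightarrow> val p \<le> val p'"
    using continuous_attains_inf[of K val] by blast
  have casL: "casorati_curvature \<phi> u L \<ge> val p / 2" if L: "subspace L" "dim L = 2" for L
  proof -
    define f where "f = (SOME e. orthonormal_frame g u L e)"
    have f: "orthonormal_frame g u L f"
      unfolding f_def using orthonormal_frame_exists[OF u L(1)] by (rule someI_ex)
    have "(c (f 1), c (f 2)) \<in> K"
      using f unfolding orthonormal_frame_def L inner_at_metric[OF u] K_def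
      by (auto simp: cc norm_eq_1)
    moreover have "casorati_curvature \<phi> u L = val (c (f 1), c (f 2)) / 2"
      unfolding casorati_curvature_def Let_def f_def[symmetric] L atLeastAtMost_1_2
      using II_sym[OF u, of "f 2" "f 1"] by (simp add: val_def IIq)
    ultimately show ?thesis using p(2) by simp
  qed
  obtain L0 :: "(real^3) set" where L0: "subspace L0" "dim L0 = 2"
    using choose_subspace_of_subspace[of 2 "UNIV :: (real^3) set"] by (auto simp: subspace_span)
  define m where "m = Inf {casorati_curvature \<phi> u L | L. subspace L \<and> dim L = 2}"
  have "m \<ge> val p / 2"
    unfolding m_def by (rule cInf_greatest) (use casL L0 in auto)
  \<comment> \<open>Six times the assumed equality reads
    \<open>(trace H)\<^sup>2 - fro = fro + 4 * m\<close>, and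
    \<open>m \<ge> val p / 2\<close>.\<close>
  then have "fro + 2 * val p \<le> (trace H)\<^sup>2 - fro"
    using eq unfolding rho delta_casorati_def cas m_def[symmetric] by (simp add: field_simps)
  then obtain l z where lz: "norm z = 1" "\<And>v w. q v w = l * (v \<bullet> w + (z \<bullet> v) * (z \<bullet> w))"
    using casorati_equality_algebra[OF sym, of "fst p" "snd p"] p(1)
    unfolding K_def fro_def val_def q_def by auto
  define \<tau> where "\<tau> = (\<Sum>i\<in>UNIV. z $ i *\<^sub>R e i)"
  have c\<tau>: "c \<tau> = z"
    by (simp add: c_def \<tau>_def lin.sum lin.scale inner_sum_left ee vec_eq_iff if_distrib cong: if_cong)
  have "norm (FD \<phi> u \<tau>) = 1" using cc[of \<tau> \<tau>] lz(1) unfolding c\<tau> by (simp add: norm_eq_1)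
  moreover have "II u a b = l * (FD \<phi> u a \<bullet> FD \<phi> u b + (FD \<phi> u \<tau> \<bullet> FD \<phi> u a) * (FD \<phi> u \<tau> \<bullet> FD \<phi> u b))" for a b
    unfolding IIq lz(2) cc[symmetric] c\<tau> ..
  ultimately show ?thesis by blast
qed

end

section \<open>Smooth normal and principal curvature\<close>

abbreviation shape_op :: "(real^3 \<Rightarrow> real^4) \<Rightarrow> real^3 \<Rightarrow> real^4 \<Rightarrow> real^3 \<Rightarrow> real^4" where
  "shape_op \<phi> u T a \<equiv> FD \<phi> u a + (T \<bullet> FD \<phi> u a) *\<^sub>R T"

text \<open>Unlike \<open>unit_normal\<close>, which is chosen pointwise, \<open>N\<close> is a smooth field, and then so is the
  double principal curvature \<open>l\<close>, a quarter of the trace of the shape operator; \<open>T\<close> is only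
  determined where \<open>l \<noteq> 0\<close>, and only up to sign.\<close>

definition shape_field :: "(real^3) set \<Rightarrow> (real^3 \<Rightarrow> real^4) \<Rightarrow> (real^3 \<Rightarrow> real^4) \<Rightarrow> (real^3 \<Rightarrow> real) \<Rightarrow> bool" where
  "shape_field W \<phi> N l \<longleftrightarrow> open W \<and> (\<forall>k. Ck k W N) \<and> (\<forall>k. Ck k W l) \<and>
    (\<forall>u\<in>W. norm (N u) = 1 \<and> (\<forall>a. N u \<bullet> FD \<phi> u a = 0) \<and>
      (\<exists>T. norm T = 1 \<and> T \<in> range (FD \<phi> u) \<and>
        (\<forall>a. FD N u a = - l u *\<^sub>R shape_op \<phi> u T a)))"

lemma second_derivative_pd:
  assumes U: "open U" and f: "Ck (Suc (Suc 0)) U f" and u: "u \<in> U"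
  shows "FD (\<lambda>w. FD f w b) u a = (\<Sum>i\<in>UNIV. \<Sum>j\<in>UNIV. (a $ i * b $ j) *\<^sub>R pd i (pd j f) u)"
proof -
  have pd: "pd j f differentiable (at u)" for j
    using f u differentiable_on_eq_differentiable_at[OF U] by auto
  have fd: "f differentiable (at w)" if "w \<in> U" for w
    using f that differentiable_on_eq_differentiable_at[OF U] by auto
  have "((\<lambda>w. \<Sum>j\<in>UNIV. b $ j *\<^sub>R pd j f w) has_derivative (\<lambda>a. \<Sum>j\<in>UNIV. b $ j *\<^sub>R FD (pd j f) u a)) (at u)"
    using pd frechet_derivative_works by (intro has_derivative_sum has_derivative_scaleR_right) blast
  then have "((\<lambda>w. FD f w b) has_derivative (\<lambda>a. \<Sum>j\<in>UNIV. b $ j *\<^sub>R FD (pd j f) u a)) (at u)"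
    by (rule has_derivative_transform_within_open[OF _ U u]) (simp add: frechet_derivative_pd fd)
  then have "FD (\<lambda>w. FD f w b) u = (\<lambda>a. \<Sum>j\<in>UNIV. b $ j *\<^sub>R FD (pd j f) u a)"
    by (rule frechet_derivative_at[symmetric])
  then have "FD (\<lambda>w. FD f w b) u a = (\<Sum>j\<in>UNIV. b $ j *\<^sub>R FD (pd j f) u a)"
    by (rule fun_cong)
  also have "\<dots> = (\<Sum>j\<in>UNIV. \<Sum>i\<in>UNIV. (a $ i * b $ j) *\<^sub>R pd i (pd j f) u)"
    by (simp add: frechet_derivative_pd pd scaleR_sum_right mult.commute)
  finally show ?thesis by (subst sum.swap)
qed

context immersed_patch
begin

lemma FD_eq_0_iff: "u \<in> U \<Longrightarrow> FD \<phi> u a = 0 \<longleftrightarrow> a = 0"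
  using linear_injective_0[OF linear_FD] immersion linear_0[OF linear_FD] by metis

lemma Ck_FD: "Ck k U X \<Longrightarrow> Ck k U (\<lambda>u. FD \<phi> u (X u))"
  by (rule Ck_frechet_derivative[OF open_U Ck_\<phi>])

lemma Ck_unit_field:
  assumes "Ck k U X" "\<And>u. u \<in> U \<Longrightarrow> X u \<noteq> 0"
  shows "Ck k U (\<lambda>u. X u /\<^sub>R norm (FD \<phi> u (X u)))"
  by (intro Ck_scaleR Ck_inverse Ck_norm Ck_FD open_U assms) (use assms(2) FD_eq_0_iff in auto)

text \<open>Gram-Schmidt for the induced metric on the coordinate vectors. The construction is
  triangular: \<open>w2\<close> has second coordinate 1 and \<open>w3\<close> has third coordinate
  1, so they vanish nowhere and the frame exists on all of \<open>U\<close>.\<close>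

lemma orthonormal_frame_field:
  obtains f :: "3 \<Rightarrow> real^3 \<Rightarrow> real^3" where "\<And>k i. Ck k U (f i)"
    "\<And>u i j. u \<in> U \<Longrightarrow> FD \<phi> u (f i u) \<bullet> FD \<phi> u (f j u) = (if i = j then 1 else 0)"
proof -
  define nrm where "nrm X u = X u /\<^sub>R norm (FD \<phi> u (X u))" for X :: "real^3 \<Rightarrow> real^3" and u
  define f1 where "f1 = nrm (\<lambda>_. axis 1 1)"
  define w2 where "w2 u = axis 2 1 - (FD \<phi> u (axis 2 1) \<bullet> FD \<phi> u (f1 u)) *\<^sub>R f1 u" for u
  define f2 where "f2 = nrm w2"
  define w3 where "w3 u = axis 3 1 - (FD \<phi> u (axis 3 1) \<bullet> FD \<phi> u (f1 u)) *\<^sub>R f1 u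
    - (FD \<phi> u (axis 3 1) \<bullet> FD \<phi> u (f2 u)) *\<^sub>R f2 u" for u
  define f3 where "f3 = nrm w3"
  have comp: "f1 u $ 2 = 0" "f1 u $ 3 = 0" for u by (simp_all add: f1_def nrm_def axis_def)
  then have "w2 u $ 2 = 1" and w23: "w2 u $ 3 = 0" for u by (simp_all add: w2_def axis_def)
  then have w2: "w2 u \<noteq> 0" for u by (metis zero_index zero_neq_one)
  have "f2 u $ 3 = 0" for u by (simp add: f2_def nrm_def w23)
  then have "w3 u $ 3 = 1" for u by (simp add: w3_def comp)
  then have w3: "w3 u \<noteq> 0" for u by (metis zero_index zero_neq_one)
  have a1: "axis 1 1 \<noteq> (0::real^3)" by (simp add: axis_eq_0_iff)
  have C1: "Ck k U f1" for k
    unfolding f1_def nrm_def by (rule Ck_unit_field) (simp_all add: Ck_const a1)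
  have C2: "Ck k U f2" for k
    unfolding f2_def nrm_def by (rule Ck_unit_field[OF _ w2], unfold w2_def)
      (intro Ck_diff Ck_scaleR Ck_inner Ck_FD Ck_const open_U C1)
  have C3: "Ck k U f3" for k
    unfolding f3_def nrm_def by (rule Ck_unit_field[OF _ w3], unfold w3_def)
      (intro Ck_diff Ck_scaleR Ck_inner Ck_FD Ck_const open_U C1 C2)
  define f where "f i = (if i = 1 then f1 else if i = 2 then f2 else f3)" for i :: 3
  have fs: "f 1 = f1" "f 2 = f2" "f 3 = f3" by (simp_all add: f_def)
  show ?thesis
  proof
    show "Ck k U (f i)" for k i using C1 C2 C3 by (simp add: f_def)
    fix u i j assume u: "u \<in> U"
    interpret linear "FD \<phi> u" by (rule linear_FD[OF u])
    have nn: "FD \<phi> u (nrm X u) \<bullet> FD \<phi> u (nrm X u) = 1" if "X u \<noteq> 0" for X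
    proof -
      have "norm (FD \<phi> u (nrm X u)) = 1"
        using that FD_eq_0_iff[OF u, of "X u"] by (simp add: nrm_def scale)
      then show ?thesis by (simp add: norm_eq_1)
    qed
    have s: "FD \<phi> u (f1 u) \<bullet> FD \<phi> u (f1 u) = 1" "FD \<phi> u (f2 u) \<bullet> FD \<phi> u (f2 u) = 1" "FD \<phi> u (f3 u) \<bullet> FD \<phi> u (f3 u) = 1"
      unfolding f1_def f2_def f3_def by (simp_all add: nn a1 w2 w3)
    have "FD \<phi> u (w2 u) \<bullet> FD \<phi> u (f1 u) = 0"
      by (simp add: w2_def diff scale inner_diff_left s)
    then have o21: "FD \<phi> u (f2 u) \<bullet> FD \<phi> u (f1 u) = 0" by (simp add: f2_def nrm_def scale)
    have "FD \<phi> u (w3 u) \<bullet> FD \<phi> u (f1 u) = 0" "FD \<phi> u (w3 u) \<bullet> FD \<phi> u (f2 u) = 0"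
      using o21 inner_commute[of "FD \<phi> u (f1 u)" "FD \<phi> u (f2 u)"]
      by (simp_all add: w3_def diff scale inner_diff_left s)
    then have o3: "FD \<phi> u (f3 u) \<bullet> FD \<phi> u (f1 u) = 0" "FD \<phi> u (f3 u) \<bullet> FD \<phi> u (f2 u) = 0"
      by (simp_all add: f3_def nrm_def scale)
    show "FD \<phi> u (f i u) \<bullet> FD \<phi> u (f j u) = (if i = j then 1 else 0)"
    proof -
      have o': "FD \<phi> u (f1 u) \<bullet> FD \<phi> u (f2 u) = 0" "FD \<phi> u (f1 u) \<bullet> FD \<phi> u (f3 u) = 0" "FD \<phi> u (f2 u) \<bullet> FD \<phi> u (f3 u) = 0"
        using o21 o3 by (metis inner_commute)+
      have "\<forall>i j. FD \<phi> u (f i u) \<bullet> FD \<phi> u (f j u) = (if i = j then 1 else 0)"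
        unfolding forall_3 fs s o21 o3 o' by simp
      then show ?thesis by blast
    qed
  qed
qed

lemma has_derivative_FD: "u \<in> U \<Longrightarrow> ((\<lambda>w. FD \<phi> w a) has_derivative FD (\<lambda>w. FD \<phi> w a) u) (at u)"
  by (rule diff_on_open_has_derivative[OF open_U Ck_differentiable[of 0]])
     (auto simp del: Ck.simps intro: Ck_FD Ck_const)

end

lemma has_derivative_const_on:
  assumes "(f has_derivative f') (at u)" "open W" "u \<in> W" "\<And>w. w \<in> W \<Longrightarrow> f w = c"
  shows "f' a = 0"
proof -
  have "((\<lambda>_. c) has_derivative f') (at u)"
    by (rule has_derivative_transform_within_open[OF assms(1-3)]) (rule assms(4))
  then have "f' = (\<lambda>_. 0)" by (rule has_derivative_unique) (rule has_derivative_const)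
  then show ?thesis by simp
qed

locale ideal_patch = immersed_patch +
  assumes ideal: "\<And>u. u \<in> U \<Longrightarrow> normalized_scalar_curvature (induced_metric \<phi>) u = delta_casorati \<phi> u"
begin

text \<open>The pointwise shape from \<open>casorati_equality_shape\<close> is transferred to a
  differentiable normal through the Weingarten relation, obtained by differentiating
  \<open>N u \<bullet> FD \<phi> u b = 0\<close>.\<close>

lemma shape_field_exists:
  assumes u0: "u0 \<in> U"
  obtains W N l where "u0 \<in> W" "W \<subseteq> U" "shape_field W \<phi> N l"
    "\<forall>u\<in>W. l u = 0 \<longrightarrow> (\<forall>a b. II u a b = 0)"
proof -
  obtain f :: "3 \<Rightarrow> real^3 \<Rightarrow> real^3" where f: "\<And>k i. Ck k U (f i)"
    "\<And>u i j. u \<in> U \<Longrightarrow> FD \<phi> u (f i u) \<bullet> FD \<phi> u (f j u) = (if i = j then 1 else 0)"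
    using orthonormal_frame_field by blast
  define E where "E i u = FD \<phi> u (f i u)" for i u
  have E: "E i u \<bullet> E j u = (if i = j then 1 else 0)" if "u \<in> U" for i j u
    using f(2)[OF that] by (simp add: E_def)
  have Eexp: "FD \<phi> u a = (\<Sum>i\<in>UNIV. (FD \<phi> u a \<bullet> E i u) *\<^sub>R E i u)" if u: "u \<in> U" for u a
  proof -
    interpret linear "FD \<phi> u" by (rule linear_FD[OF u])
    have "a = (\<Sum>i\<in>UNIV. (FD \<phi> u a \<bullet> E i u) *\<^sub>R f i u)"
      unfolding E_def by (rule frame_expansion[OF linear_FD[OF u]]) (rule f(2)[OF u])
    then have "FD \<phi> u a = FD \<phi> u (\<Sum>i\<in>UNIV. (FD \<phi> u a \<bullet> E i u) *\<^sub>R f i u)" by metis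
    then show ?thesis by (simp add: sum scale E_def)
  qed
  have CE: "Ck k U (E i)" for k i unfolding E_def[abs_def] by (intro Ck_FD f)
  define n0 where "n0 = unit_normal \<phi> u0"
  have n0: "norm n0 = 1" "\<And>a. n0 \<bullet> FD \<phi> u0 a = 0"
    unfolding n0_def using unit_normal[OF u0] by auto
  \<comment> \<open>Removing the tangential part of the fixed vector \<open>n0\<close> with the
    frame field gives a normal that equals \<open>n0\<close> at \<open>u0\<close> and so stays
    nonzero nearby.\<close>
  define Nt where "Nt u = n0 - (\<Sum>i\<in>UNIV. (n0 \<bullet> E i u) *\<^sub>R E i u)" for u
  have CNt: "Ck k U Nt" for k
    unfolding Nt_def[abs_def] by (intro Ck_diff Ck_const Ck_sum Ck_scaleR Ck_inner CE open_U)
  define W where "W = U \<inter> Nt -` (- {0})"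
  have W: "open W" "W \<subseteq> U" unfolding W_def using Ck_continuous[OF CNt]
    by (auto intro: continuous_open_preimage open_U)
  have u0W: "u0 \<in> W" using u0 n0 by (auto simp: W_def Nt_def E_def)
  define N where "N u = Nt u /\<^sub>R norm (Nt u)" for u
  have CN: "Ck k W N" for k
    unfolding N_def[abs_def] by (rule Ck_normalize[OF W(1) Ck_subset[OF W CNt]]) (simp add: W_def)
  have N1: "norm (N u) = 1" if "u \<in> W" for u using that by (simp add: N_def W_def)
  have NE: "Nt u \<bullet> E j u = 0" if "u \<in> U" for u j
    by (simp add: Nt_def inner_diff_left inner_sum_left E[OF that] if_distrib cong: if_cong)
  have Nperp: "N u \<bullet> FD \<phi> u a = 0" if "u \<in> W" for u a
  proof -
    have u: "u \<in> U" using that W by auto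
    show ?thesis by (subst Eexp[OF u]) (simp add: N_def inner_sum_right NE[OF u])
  qed
  \<comment> \<open>The operator id + T \<otimes> T has trace 3 + 1 on the tangent space.\<close>
  define l where "l u = - (1/4) * (\<Sum>i\<in>UNIV. FD N u (f i u) \<bullet> E i u)" for u
  have Cl: "Ck k W l" for k
    unfolding l_def[abs_def]
    by (intro Ck_mult Ck_const Ck_sum Ck_inner Ck_frechet_derivative[OF W(1) CN] Ck_subset[OF W CE] Ck_subset[OF W f(1)] W)
  have dN: "(N has_derivative FD N u) (at u)" if "u \<in> W" for u
    using diff_on_open_has_derivative[OF W(1), of N u] that CN[of "Suc 0"] by simp
  have main: "(\<exists>T. norm T = 1 \<and> T \<in> range (FD \<phi> u) \<and>
        (\<forall>a. FD N u a = - l u *\<^sub>R shape_op \<phi> u T a)) \<and> (l u = 0 \<longrightarrow> II u a b = 0)"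
    if uW: "u \<in> W" for u a b
  proof -
    have u: "u \<in> U" using uW W by auto
    obtain l' \<tau> where lt: "norm (FD \<phi> u \<tau>) = 1"
      "\<And>a b. II u a b = l' * (FD \<phi> u a \<bullet> FD \<phi> u b + (FD \<phi> u \<tau> \<bullet> FD \<phi> u a) * (FD \<phi> u \<tau> \<bullet> FD \<phi> u b))"
      using casorati_equality_shape[OF u ideal[OF u]] by blast
    define T where "T = FD \<phi> u \<tau>"
    define \<nu> where "\<nu> = unit_normal \<phi> u"
    \<comment> \<open>The sign between \<open>N\<close> and the arbitrarily chosen
      \<open>unit_normal\<close> may jump from point to point; only the product
      \<open>s * l'\<close> is a smooth function.\<close>
    define s where "s = N u \<bullet> \<nu>"
    have Ns: "N u = s *\<^sub>R \<nu>"
      unfolding s_def \<nu>_def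
      by (rule unit_normal_unique_direction[OF linear_FD[OF u] immersion[OF u] unit_normal[OF u] Nperp[OF uW]])
    then have s: "\<bar>s\<bar> = 1" using N1[OF uW] unit_normal(1)[OF u] by (simp add: \<nu>_def)
    have NP: "FD N u a \<bullet> FD \<phi> u b = - s * l' * (FD \<phi> u a \<bullet> FD \<phi> u b + (T \<bullet> FD \<phi> u a) * (T \<bullet> FD \<phi> u b))" for a b
    proof -
      have "N u \<bullet> FD (\<lambda>w. FD \<phi> w b) u a + FD N u a \<bullet> FD \<phi> u b = 0"
        by (rule has_derivative_const_on[OF has_derivative_inner[OF dN[OF uW] has_derivative_FD[OF u]] W(1) uW])
           (rule Nperp)
      moreover have "\<nu> \<bullet> FD (\<lambda>w. FD \<phi> w b) u a = II u a b"
        unfolding second_derivative_pd[OF open_U Ck_\<phi> u] second_fundamental_form_def \<nu>_def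
        by (simp add: inner_sum_right inner_commute mult_ac)
      ultimately show ?thesis unfolding Ns lt(2) T_def by (simp add: algebra_simps)
    qed
    have NN: "FD N u a \<bullet> N u = 0" for a
    proof -
      have "N u \<bullet> FD N u a + FD N u a \<bullet> N u = 0"
        by (rule has_derivative_const_on[OF has_derivative_inner[OF dN[OF uW] dN[OF uW]] W(1) uW, of 1])
           (use N1 norm_eq_1 in blast)
      then show ?thesis by (simp add: inner_commute)
    qed
    have PN: "FD \<phi> u a \<bullet> N u = 0" for a using Nperp[OF uW] by (simp add: inner_commute)
    have FN: "FD N u a = - (s * l') *\<^sub>R shape_op \<phi> u T a" for a
    proof -
      have "FD N u a + (s * l') *\<^sub>R shape_op \<phi> u T a = 0"
        by (rule orthogonal_tangent_normal_zero[OF linear_FD[OF u] immersion[OF u] N1[OF uW] Nperp[OF uW]])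
           (simp_all add: inner_add_left NP NN PN T_def algebra_simps)
      then show ?thesis by (simp add: add_eq_0_iff)
    qed
    have TT: "(\<Sum>i\<in>UNIV. (T \<bullet> E i u) * (T \<bullet> E i u)) = 1"
    proof -
      have "T \<bullet> T = T \<bullet> (\<Sum>i\<in>UNIV. (T \<bullet> E i u) *\<^sub>R E i u)" unfolding T_def using Eexp[OF u, of \<tau>] by metis
      then show ?thesis using lt(1) by (simp add: inner_sum_right T_def norm_eq_1)
    qed
    have "(\<Sum>i\<in>UNIV. FD N u (f i u) \<bullet> E i u) = - (s * l') * (\<Sum>i\<in>UNIV. 1 + (T \<bullet> E i u) * (T \<bullet> E i u))"
      unfolding FN E_def[symmetric] sum_distrib_left by (simp add: inner_add_left E[OF u])
    also have "\<dots> = - (s * l') * 4" by (simp add: sum.distrib TT)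
    finally have ls: "l u = s * l'" by (simp add: l_def)
    show ?thesis
      using s lt FN T_def unfolding ls by auto
  qed
  show ?thesis
    by (rule that[OF u0W W(2), of N l]) (use W CN Cl N1 Nperp main in \<open>auto simp: shape_field_def\<close>)
qed

end

section \<open>Codazzi equations\<close>

text \<open>\<open>N\<close> is the unit normal making the double principal curvature \<open>l\<close> positive, \<open>T\<close> a unit
  principal direction for the simple principal curvature \<open>2 l\<close>, and \<open>\<mu>\<close> the derivative of \<open>l\<close> along \<open>T\<close>.\<close>

definition rot_struct :: "(real^3) set \<Rightarrow> (real^3 \<Rightarrow> real^4) \<Rightarrow> (real^3 \<Rightarrow> real^4) \<Rightarrow> (real^3 \<Rightarrow> real^4) \<Rightarrow>
    (real^3 \<Rightarrow> real) \<Rightarrow> (real^3 \<Rightarrow> real) \<Rightarrow> bool" where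
  "rot_struct W \<phi> N T l \<mu> \<longleftrightarrow> (\<forall>u\<in>W.
     l u > 0 \<and> norm (N u) = 1 \<and> norm (T u) = 1 \<and> T u \<in> range (FD \<phi> u) \<and> (\<forall>a. N u \<bullet> FD \<phi> u a = 0) \<and>
     (\<phi> has_derivative FD \<phi> u) (at u) \<and>
     (N has_derivative (\<lambda>a. - l u *\<^sub>R shape_op \<phi> u (T u) a)) (at u) \<and>
     (l has_derivative (\<lambda>a. \<mu> u * (T u \<bullet> FD \<phi> u a))) (at u) \<and>
     (T has_derivative (\<lambda>a. (\<mu> u / l u) *\<^sub>R (FD \<phi> u a - (T u \<bullet> FD \<phi> u a) *\<^sub>R T u)
        + (2 * l u * (T u \<bullet> FD \<phi> u a)) *\<^sub>R N u)) (at u) \<and>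
     (\<mu> has_derivative (\<lambda>a. - 2 * l u ^ 3 * (T u \<bullet> FD \<phi> u a))) (at u))"

locale principal_patch = immersed_patch U \<phi> for U \<phi> +
  fixes W :: "(real^3) set" and N T :: "real^3 \<Rightarrow> real^4" and l :: "real^3 \<Rightarrow> real" and w0 :: "real^3"
  assumes W: "open W" "W \<subseteq> U"
    and CN: "\<And>k. Ck k W N" and CT: "\<And>k. Ck k W T" and Cl: "\<And>k. Ck k W l"
    and l_pos: "\<And>u. u \<in> W \<Longrightarrow> l u > 0"
    and N1: "\<And>u. u \<in> W \<Longrightarrow> norm (N u) = 1"
    and T1: "\<And>u. u \<in> W \<Longrightarrow> norm (T u) = 1"
    and T_range: "\<And>u. u \<in> W \<Longrightarrow> T u \<in> range (FD \<phi> u)"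
    and N_perp: "\<And>u a. u \<in> W \<Longrightarrow> N u \<bullet> FD \<phi> u a = 0"
    and dN: "\<And>u a. u \<in> W \<Longrightarrow> FD N u a = - l u *\<^sub>R shape_op \<phi> u (T u) a"
    and w0: "\<And>u. u \<in> W \<Longrightarrow> T u \<bullet> FD \<phi> u w0 \<noteq> 0"
      \<comment> \<open>a constant direction transversal to the kernel of \<open>T\<close>, making \<open>\<mu>\<close> visibly smooth\<close>
begin

abbreviation th :: "real^3 \<Rightarrow> real^3 \<Rightarrow> real" where "th u a \<equiv> T u \<bullet> FD \<phi> u a"

definition \<mu> :: "real^3 \<Rightarrow> real" where "\<mu> u = FD l u w0 / th u w0"

lemma in_U: "u \<in> W \<Longrightarrow> u \<in> U" using W by auto

lemma W_derivative: "Ck (Suc k) W f \<Longrightarrow> u \<in> W \<Longrightarrow> (f has_derivative FD f u) (at u)"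
  by (rule diff_on_open_has_derivative[OF W(1)]) auto

lemmas N_derivative = W_derivative[OF CN]
lemmas T_derivative = W_derivative[OF CT]
lemmas l_derivative = W_derivative[OF Cl]

lemma Ck_\<phi>W: "Ck k W \<phi>" by (rule Ck_subset[OF W Ck_\<phi>])

lemma C\<mu>: "Ck k W \<mu>"
  unfolding \<mu>_def[abs_def]
  by (intro Ck_divide Ck_frechet_derivative[OF W(1)] Ck_inner Ck_const CT Cl Ck_\<phi>W W(1) w0)

lemmas \<mu>_derivative = W_derivative[OF C\<mu>]

lemma FD_derivative: "Ck (Suc (Suc k)) W f \<Longrightarrow> u \<in> W \<Longrightarrow> ((\<lambda>w. FD f w a) has_derivative FD (\<lambda>w. FD f w a) u) (at u)"
  by (rule W_derivative[of k]) (rule Ck_frechet_derivative[OF W(1) _ Ck_const])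

lemma FD_symmetric:
  fixes f :: "real^3 \<Rightarrow> 'c::real_inner"
  shows "Ck (Suc (Suc 0)) W f \<Longrightarrow> u \<in> W \<Longrightarrow> FD (\<lambda>w. FD f w a) u b = FD (\<lambda>w. FD f w b) u a"
  by (rule Ck2_symmetric[OF W(1)])

lemma TT: "u \<in> W \<Longrightarrow> T u \<bullet> T u = 1" using T1 by (simp add: norm_eq_1)

lemma NN: "u \<in> W \<Longrightarrow> N u \<bullet> N u = 1" using N1 by (simp add: norm_eq_1)

lemma NT: "u \<in> W \<Longrightarrow> N u \<bullet> T u = 0" using T_range N_perp by fastforce

lemma T_dT: assumes u: "u \<in> W" shows "T u \<bullet> FD T u a = 0"
proof -
  have "T u \<bullet> FD T u a + FD T u a \<bullet> T u = 0"
    by (rule has_derivative_const_on[OF has_derivative_inner[OF T_derivative[OF u] T_derivative[OF u]] W(1) u, of 1])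
       (rule TT)
  then show ?thesis by (simp add: inner_commute)
qed

lemma N_dT: assumes u: "u \<in> W" shows "N u \<bullet> FD T u a = 2 * l u * th u a"
proof -
  have "N u \<bullet> FD T u a + FD N u a \<bullet> T u = 0"
    by (rule has_derivative_const_on[OF has_derivative_inner[OF N_derivative[OF u] T_derivative[OF u]] W(1) u, of 0])
       (rule NT)
  then show ?thesis unfolding dN[OF u] by (simp add: inner_add_left TT[OF u] inner_commute algebra_simps)
qed

lemma th_derivative:
  assumes u: "u \<in> W"
  shows "((\<lambda>w. th w a) has_derivative (\<lambda>b. T u \<bullet> FD (\<lambda>w. FD \<phi> w a) u b + FD T u b \<bullet> FD \<phi> u a)) (at u)"
  by (rule has_derivative_inner[OF T_derivative[OF u] FD_derivative[OF Ck_\<phi>W u]])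

text \<open>This is the symmetry of the second derivative of \<open>N\<close>; all terms with second
  derivatives of \<open>\<phi>\<close> are symmetric in \<open>a\<close> and \<open>b\<close> and
  drop out.\<close>

lemma codazzi:
  assumes u: "u \<in> W"
  shows "FD l u b *\<^sub>R shape_op \<phi> u (T u) a + l u *\<^sub>R ((FD T u b \<bullet> FD \<phi> u a) *\<^sub>R T u + th u a *\<^sub>R FD T u b)
    = FD l u a *\<^sub>R (FD \<phi> u b + th u b *\<^sub>R T u) + l u *\<^sub>R ((FD T u a \<bullet> FD \<phi> u b) *\<^sub>R T u + th u b *\<^sub>R FD T u a)"
proof -
  define P where "P a b = FD (\<lambda>w. FD \<phi> w a) u b" for a b
  have P: "P a b = P b a" unfolding P_def by (rule FD_symmetric[OF Ck_\<phi>W u])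
  define D where "D a b = - l u *\<^sub>R (P a b + (th u a *\<^sub>R FD T u b + (T u \<bullet> P a b + FD T u b \<bullet> FD \<phi> u a) *\<^sub>R T u))
      + (- FD l u b) *\<^sub>R shape_op \<phi> u (T u) a" for a b
  have D: "FD (\<lambda>w. FD N w a) u b = D a b" for a b
  proof -
    have "((\<lambda>w. - l w *\<^sub>R (FD \<phi> w a + th w a *\<^sub>R T w)) has_derivative D a) (at u)"
      unfolding P_def D_def[abs_def]
      by (rule has_derivative_scaleR[OF has_derivative_minus[OF l_derivative[OF u]]
          has_derivative_add[OF FD_derivative[OF Ck_\<phi>W u] has_derivative_scaleR[OF th_derivative[OF u] T_derivative[OF u]]]])
    then have "((\<lambda>w. FD N w a) has_derivative D a) (at u)"
      by (rule has_derivative_transform_within_open[OF _ W(1) u]) (simp add: dN)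
    from frechet_derivative_at[OF this] show ?thesis by simp
  qed
  have "FD (\<lambda>w. FD N w a) u b = FD (\<lambda>w. FD N w b) u a" by (rule FD_symmetric[OF CN u])
  then show ?thesis unfolding D D_def P by (simp add: algebra_simps)
qed

text \<open>Two linear conditions on three unknowns; \<open>p\<close> is the transpose of the
  derivative of \<open>\<phi>\<close>.\<close>

lemma exists_orthogonal:
  assumes u: "u \<in> W"
  obtains X where "X \<noteq> 0" "th u X = 0" "FD \<phi> u X \<bullet> FD \<phi> u Y = 0"
proof -
  interpret linear "FD \<phi> u" by (rule linear_FD[OF in_U[OF u]])
  define p where "p v = (\<chi> i. v \<bullet> FD \<phi> u (axis i 1))" for v
  have p: "p v \<bullet> X = v \<bullet> FD \<phi> u X" for v X
  proof -
    have e: "FD \<phi> u X = (\<Sum>i\<in>UNIV. X $ i *\<^sub>R FD \<phi> u (axis i 1))"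
      using frechet_derivative_pd[OF differentiable_\<phi>[OF in_U[OF u]], of X] by (simp add: pd_def)
    have "p v \<bullet> X = (\<Sum>i\<in>UNIV. p v $ i * X $ i)" by (simp add: inner_vec_def)
    then show ?thesis by (subst e) (simp add: p_def inner_sum_right mult.commute)
  qed
  have "dim {p (T u), p (FD \<phi> u Y)} \<le> card {p (T u), p (FD \<phi> u Y)}" by (rule dim_le_card') simp
  also have "\<dots> \<le> 2" by (simp add: card_insert_if)
  finally have "dim {p (T u), p (FD \<phi> u Y)} < DIM(real^3)" by simp
  then obtain X where X: "X \<noteq> 0" "\<And>y. y \<in> span {p (T u), p (FD \<phi> u Y)} \<Longrightarrow> orthogonal X y"
    using orthogonal_to_subspace_exists by blast
  then have "p (T u) \<bullet> X = 0" "p (FD \<phi> u Y) \<bullet> X = 0"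
    using X(2)[of "p (T u)"] X(2)[of "p (FD \<phi> u Y)"]
    by (simp_all add: span_base orthogonal_def inner_commute[of X])
  then show ?thesis
    using that[of X] X(1) unfolding p by (simp add: inner_commute)
qed

text \<open>The classical fact that a multiple principal curvature is constant along its own
  distribution: the multiplicity two supplies a direction \<open>X\<close> orthogonal to
  \<open>Y\<close> in the same eigenspace, and the component of \<open>codazzi\<close> along
  \<open>X\<close> isolates the derivative of \<open>l\<close> along \<open>Y\<close>.\<close>

lemma dl_perp:
  assumes u: "u \<in> W" and Y: "th u Y = 0"
  shows "FD l u Y = 0"
proof -
  obtain X where X: "X \<noteq> 0" "th u X = 0" "FD \<phi> u X \<bullet> FD \<phi> u Y = 0" using exists_orthogonal[OF u] by blast
  have "FD l u Y *\<^sub>R FD \<phi> u X + l u *\<^sub>R ((FD T u Y \<bullet> FD \<phi> u X) *\<^sub>R T u)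
    = FD l u X *\<^sub>R FD \<phi> u Y + l u *\<^sub>R ((FD T u X \<bullet> FD \<phi> u Y) *\<^sub>R T u)"
    using codazzi[OF u, of Y X] X(2) Y by simp
  then have "FD \<phi> u X \<bullet> (FD l u Y *\<^sub>R FD \<phi> u X + l u *\<^sub>R ((FD T u Y \<bullet> FD \<phi> u X) *\<^sub>R T u))
    = FD \<phi> u X \<bullet> (FD l u X *\<^sub>R FD \<phi> u Y + l u *\<^sub>R ((FD T u X \<bullet> FD \<phi> u Y) *\<^sub>R T u))" by simp
  moreover have "FD \<phi> u X \<bullet> T u = 0" using X(2) by (simp add: inner_commute)
  ultimately have "FD l u Y * (FD \<phi> u X \<bullet> FD \<phi> u X) = 0"
    using X(3) by (simp only: inner_add_right inner_scaleR_right)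
  moreover have "FD \<phi> u X \<noteq> 0" using X FD_eq_0_iff in_U[OF u] by blast
  ultimately show ?thesis by simp
qed

lemma linear_W: assumes "u \<in> W" shows "linear (FD l u)" "linear (FD T u)" "linear (FD \<mu> u)" "linear (FD \<phi> u)"
  using has_derivative_linear[OF l_derivative[OF assms]] has_derivative_linear[OF T_derivative[OF assms]]
    has_derivative_linear[OF \<mu>_derivative[OF assms]] linear_FD[OF in_U[OF assms]] by auto

lemma dl: assumes u: "u \<in> W" shows "FD l u a = \<mu> u * th u a"
proof -
  interpret l: linear "FD l u" using linear_W[OF u] by blast
  interpret p: linear "FD \<phi> u" using linear_W[OF u] by blast
  define c where "c = th u a / th u w0"
  have "th u (a - c *\<^sub>R w0) = 0" using w0[OF u] by (simp add: p.diff p.scale inner_diff_right c_def)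
  from dl_perp[OF u this] have "FD l u a = c * FD l u w0" by (simp add: l.diff l.scale)
  then show ?thesis by (simp add: c_def \<mu>_def)
qed

text \<open>The component of \<open>codazzi\<close> along \<open>T\<close>. It says that the
  one-form \<open>th\<close> is closed; later \<open>th\<close> appears as the differential of the
  profile parameter.\<close>

lemma dT_sym: assumes u: "u \<in> W" shows "FD T u a \<bullet> FD \<phi> u b = FD T u b \<bullet> FD \<phi> u a"
proof -
  have "T u \<bullet> (FD l u b *\<^sub>R shape_op \<phi> u (T u) a + l u *\<^sub>R ((FD T u b \<bullet> FD \<phi> u a) *\<^sub>R T u + th u a *\<^sub>R FD T u b))
    = T u \<bullet> (FD l u a *\<^sub>R (FD \<phi> u b + th u b *\<^sub>R T u) + l u *\<^sub>R ((FD T u a \<bullet> FD \<phi> u b) *\<^sub>R T u + th u b *\<^sub>R FD T u a))"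
    using codazzi[OF u] by simp
  then have "l u * (FD T u b \<bullet> FD \<phi> u a) = l u * (FD T u a \<bullet> FD \<phi> u b)"
    by (simp add: inner_add_right TT[OF u] T_dT[OF u] dl[OF u] algebra_simps)
  then show ?thesis using l_pos[OF u] by simp
qed

lemma tau_exists: assumes u: "u \<in> W" obtains \<tau> where "FD \<phi> u \<tau> = T u" "th u \<tau> = 1"
  using T_range[OF u] TT[OF u] by (metis imageE)

text \<open>By \<open>dT_sym\<close> the derivative of \<open>T\<close> along itself has no
  tangential part, so the integral curves of \<open>T\<close> are geodesics of the hypersurface;
  they are the profile curves.\<close>

lemma dT_tau:
  assumes u: "u \<in> W" and \<tau>: "FD \<phi> u \<tau> = T u" shows "FD T u \<tau> = (2 * l u) *\<^sub>R N u"
proof -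
  have "FD T u \<tau> = (FD T u \<tau> \<bullet> N u) *\<^sub>R N u"
    by (rule unit_normal_unique_direction[OF linear_FD[OF in_U[OF u]] immersion[OF in_U[OF u]] N1[OF u] N_perp[OF u]])
       (metis dT_sym[OF u] \<tau> T_dT[OF u] inner_commute)
  then show ?thesis using N_dT[OF u, of \<tau>] \<tau> TT[OF u] by (simp add: inner_commute)
qed

text \<open>Obtained from \<open>codazzi\<close> with one argument along \<open>T\<close>. The
  factor \<open>\<mu> / l\<close> will be r'/r for the radius r: the parallels are umbilic inside
  the hypersurface.\<close>

lemma dT:
  assumes u: "u \<in> W"
  shows "FD T u a = (\<mu> u / l u) *\<^sub>R (FD \<phi> u a - th u a *\<^sub>R T u) + (2 * l u * th u a) *\<^sub>R N u"
proof -
  obtain \<tau> where \<tau>: "FD \<phi> u \<tau> = T u" "th u \<tau> = 1" using tau_exists[OF u] by blast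
  have s: "FD T u a \<bullet> T u = 0" "FD T u \<tau> \<bullet> FD \<phi> u a = 0"
    using T_dT[OF u, of a] dT_tau[OF u \<tau>(1)] N_perp[OF u] by (simp_all add: inner_commute)
  have t: "th u \<tau> = 1" "FD l u \<tau> = \<mu> u" using \<tau> dl[OF u] by auto
  have "\<mu> u *\<^sub>R shape_op \<phi> u (T u) a + l u *\<^sub>R (0 *\<^sub>R T u + th u a *\<^sub>R FD T u \<tau>)
     = (\<mu> u * th u a) *\<^sub>R (T u + 1 *\<^sub>R T u) + l u *\<^sub>R (0 *\<^sub>R T u + 1 *\<^sub>R FD T u a)"
    using codazzi[OF u, of \<tau> a] unfolding t s \<tau>(1) dl[OF u, of a] TT[OF u] .
  then have "l u *\<^sub>R FD T u a = \<mu> u *\<^sub>R shape_op \<phi> u (T u) a + l u *\<^sub>R (th u a *\<^sub>R FD T u \<tau>) - (\<mu> u * th u a) *\<^sub>R (T u + T u)"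
    by simp
  also have "\<dots> = \<mu> u *\<^sub>R (FD \<phi> u a - th u a *\<^sub>R T u) + (l u * th u a) *\<^sub>R ((2 * l u) *\<^sub>R N u)"
    unfolding dT_tau[OF u \<tau>(1)] by (simp add: scaleR_add_right scaleR_diff_right)
  finally have "l u *\<^sub>R FD T u a = \<mu> u *\<^sub>R (FD \<phi> u a - th u a *\<^sub>R T u) + (l u * th u a) *\<^sub>R ((2 * l u) *\<^sub>R N u)" .
  then have "(1 / l u) *\<^sub>R (l u *\<^sub>R FD T u a) = (1 / l u) *\<^sub>R (\<mu> u *\<^sub>R (FD \<phi> u a - th u a *\<^sub>R T u) + (l u * th u a) *\<^sub>R ((2 * l u) *\<^sub>R N u))"
    by simp
  then show ?thesis using l_pos[OF u] by (simp add: scaleR_right_distrib)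
qed

lemma th_derivative_sym:
  assumes u: "u \<in> W"
  shows "T u \<bullet> FD (\<lambda>w. FD \<phi> w a) u b + FD T u b \<bullet> FD \<phi> u a = T u \<bullet> FD (\<lambda>w. FD \<phi> w b) u a + FD T u a \<bullet> FD \<phi> u b"
  unfolding FD_symmetric[OF Ck_\<phi>W u, of a b] dT_sym[OF u, of a b] ..

text \<open>Symmetry of the second derivative of \<open>l\<close>: since \<open>th\<close> is
  closed, the differential of \<open>\<mu>\<close> is proportional to \<open>th\<close>.\<close>

lemma d\<mu>_sym:
  assumes u: "u \<in> W"
  shows "FD \<mu> u b * th u a = FD \<mu> u a * th u b"
proof -
  have D: "FD (\<lambda>w. FD l w a) u b = \<mu> u * (T u \<bullet> FD (\<lambda>w. FD \<phi> w a) u b + FD T u b \<bullet> FD \<phi> u a) + FD \<mu> u b * th u a" for a b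
  proof -
    have "((\<lambda>w. FD l w a) has_derivative (\<lambda>b. \<mu> u * (T u \<bullet> FD (\<lambda>w. FD \<phi> w a) u b + FD T u b \<bullet> FD \<phi> u a) + FD \<mu> u b * th u a)) (at u)"
      by (rule has_derivative_transform_within_open[OF has_derivative_mult[OF \<mu>_derivative[OF u] th_derivative[OF u]] W(1) u])
         (simp add: dl)
    from fun_cong[OF frechet_derivative_at[OF this], of b] show ?thesis by simp
  qed
  show ?thesis
    using FD_symmetric[OF Cl u, of a b] th_derivative_sym[OF u, of a b] unfolding D by simp
qed

text \<open>Symmetry of the second derivative of \<open>T\<close>, evaluated on \<open>T\<close> and
  a direction \<open>X\<close> in the kernel of \<open>th\<close>, is a Riccati equation for
  \<open>\<nu> = \<mu> / l\<close> along \<open>T\<close>: the derivative of \<open>\<nu>\<close> is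
  \<open>- \<nu>^2 - 2 l^2\<close>. It is the Gauss equation for a plane containing
  \<open>T\<close>, whose curvature is the product of \<open>l\<close> and
  \<open>2 * l\<close>.\<close>

lemma d\<mu>:
  assumes u: "u \<in> W"
  shows "FD \<mu> u a = - 2 * l u ^ 3 * th u a"
proof -
  obtain \<tau> where \<tau>: "FD \<phi> u \<tau> = T u" "th u \<tau> = 1" using tau_exists[OF u] by blast
  obtain X where X: "X \<noteq> 0" "th u X = 0" using exists_orthogonal[OF u] by blast
  define \<nu> where "\<nu> w = \<mu> w / l w" for w
  define d\<nu> where "d\<nu> b = (FD \<mu> u b * l u - \<mu> u * FD l u b) / (l u * l u)" for b
  have dnu: "(\<nu> has_derivative d\<nu>) (at u)"
    unfolding \<nu>_def[abs_def] d\<nu>_def[abs_def]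
    by (rule has_derivative_divide'[OF \<mu>_derivative[OF u] l_derivative[OF u]]) (use l_pos[OF u] in auto)
  define P where "P a b = FD (\<lambda>w. FD \<phi> w a) u b" for a b
  define Q where "Q a b = T u \<bullet> P a b + FD T u b \<bullet> FD \<phi> u a" for a b
  have PQ: "P a b = P b a" "Q a b = Q b a" for a b
    unfolding Q_def P_def using FD_symmetric[OF Ck_\<phi>W u] th_derivative_sym[OF u] by blast+
  define D where "D a b = (\<nu> u *\<^sub>R (P a b - (th u a *\<^sub>R FD T u b + Q a b *\<^sub>R T u)) + d\<nu> b *\<^sub>R (FD \<phi> u a - th u a *\<^sub>R T u))
      + ((2 * (l u * th u a)) *\<^sub>R FD N u b + (2 * (l u * Q a b + FD l u b * th u a)) *\<^sub>R N u)" for a b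
  have D: "FD (\<lambda>w. FD T w a) u b = D a b" for a b
  proof -
    have "((\<lambda>w. \<nu> w *\<^sub>R (FD \<phi> w a - th w a *\<^sub>R T w) + (2 * (l w * th w a)) *\<^sub>R N w) has_derivative D a) (at u)"
      unfolding P_def Q_def D_def[abs_def]
      by (rule has_derivative_add[OF has_derivative_scaleR[OF dnu
            has_derivative_diff[OF FD_derivative[OF Ck_\<phi>W u] has_derivative_scaleR[OF th_derivative[OF u] T_derivative[OF u]]]]
          has_derivative_scaleR[OF has_derivative_mult_right[OF has_derivative_mult[OF l_derivative[OF u] th_derivative[OF u]]] N_derivative[OF u]]])
    then have "((\<lambda>w. FD T w a) has_derivative D a) (at u)"
      by (rule has_derivative_transform_within_open[OF _ W(1) u]) (simp add: dT \<nu>_def mult.assoc)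
    from frechet_derivative_at[OF this] show ?thesis by simp
  qed
  have "FD (\<lambda>w. FD T w X) u \<tau> = FD (\<lambda>w. FD T w \<tau>) u X" by (rule FD_symmetric[OF CT u])
  then have "d\<nu> \<tau> *\<^sub>R FD \<phi> u X = - (\<nu> u *\<^sub>R FD T u X) + (2 * l u) *\<^sub>R FD N u X"
    unfolding D D_def PQ(1)[of \<tau> X] PQ(2)[of \<tau> X] by (simp add: X \<tau> TT[OF u] dl[OF u] algebra_simps)
  moreover have "FD T u X = \<nu> u *\<^sub>R FD \<phi> u X" "FD N u X = - l u *\<^sub>R FD \<phi> u X"
    using X by (simp_all add: dT[OF u] dN[OF u] \<nu>_def)
  ultimately have "d\<nu> \<tau> *\<^sub>R FD \<phi> u X = - ((\<nu> u * \<nu> u) *\<^sub>R FD \<phi> u X) - (2 * l u * l u) *\<^sub>R FD \<phi> u X"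
    by simp
  moreover have "(d\<nu> \<tau> + \<nu> u * \<nu> u + 2 * l u * l u) *\<^sub>R FD \<phi> u X =
      d\<nu> \<tau> *\<^sub>R FD \<phi> u X + (\<nu> u * \<nu> u) *\<^sub>R FD \<phi> u X + (2 * l u * l u) *\<^sub>R FD \<phi> u X"
    by (simp only: scaleR_left_distrib)
  ultimately have "(d\<nu> \<tau> + \<nu> u * \<nu> u + 2 * l u * l u) *\<^sub>R FD \<phi> u X = 0"
    by simp
  moreover have "FD \<phi> u X \<noteq> 0" using X FD_eq_0_iff in_U[OF u] by blast
  ultimately have "d\<nu> \<tau> + \<nu> u * \<nu> u + 2 * l u * l u = 0" by simp
  then have "FD \<mu> u \<tau> = - 2 * l u ^ 3"
  proof -
    assume "d\<nu> \<tau> + \<nu> u * \<nu> u + 2 * l u * l u = 0"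
    then have "l u * (FD \<mu> u \<tau> + 2 * l u ^ 3) = 0"
      using l_pos[OF u] unfolding d\<nu>_def \<nu>_def dl[OF u] \<tau>(2) by (simp add: field_simps power3_eq_cube)
    then show ?thesis using l_pos[OF u] by simp
  qed
  then show ?thesis using d\<mu>_sym[OF u, of \<tau> a] \<tau> by simp
qed

lemma rot_struct_principal: "rot_struct W \<phi> N T l \<mu>"
  unfolding rot_struct_def
proof (intro ballI conjI allI)
  fix u assume u: "u \<in> W"
  show "l u > 0" "norm (N u) = 1" "norm (T u) = 1" "T u \<in> range (FD \<phi> u)" "\<And>a. N u \<bullet> FD \<phi> u a = 0"
    using u l_pos N1 T1 T_range N_perp by auto
  show "(\<phi> has_derivative FD \<phi> u) (at u)" using has_derivative_\<phi> in_U[OF u] by blast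
  show "(N has_derivative (\<lambda>a. - l u *\<^sub>R shape_op \<phi> u (T u) a)) (at u)"
    using N_derivative[OF u] by (simp add: dN[OF u, abs_def])
  show "(l has_derivative (\<lambda>a. \<mu> u * th u a)) (at u)"
    using l_derivative[OF u] by (simp add: dl[OF u, abs_def])
  show "(T has_derivative (\<lambda>a. (\<mu> u / l u) *\<^sub>R (FD \<phi> u a - th u a *\<^sub>R T u) + (2 * l u * th u a) *\<^sub>R N u)) (at u)"
    using T_derivative[OF u] by (simp add: dT[OF u, abs_def])
  show "(\<mu> has_derivative (\<lambda>a. - 2 * l u ^ 3 * th u a)) (at u)"
    using \<mu>_derivative[OF u] by (simp add: d\<mu>[OF u, abs_def])
qed

end

section \<open>Axis and profile curve\<close>

text \<open>Reversing \<open>T\<close> reverses \<open>\<mu>\<close>, and with them the axis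
  direction, while the energy is kept.\<close>

lemma rot_struct_flip:
  assumes "rot_struct W \<phi> N T l \<mu>"
  shows "rot_struct W \<phi> N (\<lambda>u. - T u) l (\<lambda>u. - \<mu> u)"
  unfolding rot_struct_def
proof (intro ballI conjI allI)
  fix u assume "u \<in> W"
  note r = bspec[OF assms[unfolded rot_struct_def] this]
  show "l u > 0" "norm (N u) = 1" "norm (- T u) = 1" "\<And>a. N u \<bullet> FD \<phi> u a = 0"
    "(\<phi> has_derivative FD \<phi> u) (at u)" using r by auto
  show "- T u \<in> range (FD \<phi> u)"
  proof -
    obtain \<tau> where \<tau>: "T u = FD \<phi> u \<tau>" using r by blast
    have "linear (FD \<phi> u)" using r has_derivative_linear by blast
    then have "FD \<phi> u (- \<tau>) = - T u" using \<tau> by (simp add: linear_neg)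
    then show ?thesis by (metis rangeI)
  qed
  show "(N has_derivative (\<lambda>a. - l u *\<^sub>R shape_op \<phi> u (- T u) a)) (at u)"
    "(l has_derivative (\<lambda>a. - \<mu> u * (- T u \<bullet> FD \<phi> u a))) (at u)"
    using r by simp_all
  have "((\<lambda>u. - T u) has_derivative (\<lambda>a. - ((\<mu> u / l u) *\<^sub>R (FD \<phi> u a - (T u \<bullet> FD \<phi> u a) *\<^sub>R T u)
        + (2 * l u * (T u \<bullet> FD \<phi> u a)) *\<^sub>R N u))) (at u)"
    using r by (intro has_derivative_minus) simp
  then show "((\<lambda>u. - T u) has_derivative (\<lambda>a. (- \<mu> u / l u) *\<^sub>R (FD \<phi> u a - (- T u \<bullet> FD \<phi> u a) *\<^sub>R - T u)
        + (2 * l u * (- T u \<bullet> FD \<phi> u a)) *\<^sub>R N u)) (at u)" by simp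
  have "((\<lambda>u. - \<mu> u) has_derivative (\<lambda>a. - (- 2 * l u ^ 3 * (T u \<bullet> FD \<phi> u a)))) (at u)"
    using r by (intro has_derivative_minus) simp
  then show "((\<lambda>u. - \<mu> u) has_derivative (\<lambda>a. - 2 * l u ^ 3 * (- T u \<bullet> FD \<phi> u a))) (at u)" by simp
qed

context immersed_patch
begin

text \<open>In a \<open>shape_field\<close> the direction \<open>T\<close> exists only pointwise and
  up to sign. A differentiable choice near \<open>u0\<close> is extracted from the derivative of
  \<open>N\<close>, and multiplying \<open>N\<close> by the sign of \<open>l u0\<close> makes
  \<open>l\<close> positive.\<close>

lemma shape_field_rot_struct:
  assumes sh: "shape_field W \<phi> N l" and WU: "W \<subseteq> U" and u0: "u0 \<in> W" and l0: "l u0 \<noteq> 0"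
  obtains r s N' T l' \<mu> where "r > 0" "ball u0 r \<subseteq> W" "rot_struct (ball u0 r) \<phi> N' T l' \<mu>"
    "\<bar>s\<bar> = (1::real)" "\<forall>u\<in>ball u0 r. l' u = s * l u"
proof -
  have W: "open W" and CN: "\<And>k. Ck k W N" and Cl: "\<And>k. Ck k W l"
    and N1: "\<And>u. u \<in> W \<Longrightarrow> norm (N u) = 1" and Np: "\<And>u a. u \<in> W \<Longrightarrow> N u \<bullet> FD \<phi> u a = 0"
    and T: "\<And>u. u \<in> W \<Longrightarrow> \<exists>T. norm T = 1 \<and> T \<in> range (FD \<phi> u) \<and>
        (\<forall>a. FD N u a = - l u *\<^sub>R shape_op \<phi> u T a)"
    using sh unfolding shape_field_def by blast+
  define s where "s = sgn (l u0)"
  have s: "\<bar>s\<bar> = 1" "s * s = 1" using l0 by (auto simp: s_def sgn_if)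
  define W1 where "W1 = {u \<in> W. s * l u \<in> {0<..}}"
  have contl: "continuous_on W (\<lambda>u. s * l u)" using Ck_continuous[OF Cl] by (intro continuous_intros)
  have W1: "open W1" "W1 \<subseteq> W" "u0 \<in> W1"
    using continuous_open_preimage[OF contl W, of "{0<..}"] u0 l0
    by (auto simp: W1_def vimage_def Int_def s_def sgn_if)
  have l_nz: "l u \<noteq> 0" if "u \<in> W1" for u using that by (auto simp: W1_def)
  obtain T0 w0 where T0: "norm T0 = 1" "T0 = FD \<phi> u0 w0"
    "\<And>a. FD N u0 a = - l u0 *\<^sub>R shape_op \<phi> u0 T0 a"
    using T[OF u0] by blast
  \<comment> \<open>\<open>V u\<close> equals
    \<open>(T \<bullet> FD \<phi> u w0) *\<^sub>R T\<close>, an expression insensitive to the sign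
    of \<open>T\<close>. Since \<open>w0\<close> is chosen to represent \<open>T0\<close>, it is
    nonzero at \<open>u0\<close> and hence nearby.\<close>
  define V where "V u = - ((1 / l u) *\<^sub>R FD N u w0) - FD \<phi> u w0" for u
  have CV: "Ck k W1 V" for k
    unfolding V_def[abs_def]
    by (intro Ck_diff Ck_minus Ck_scaleR Ck_divide Ck_const Ck_frechet_derivative[OF W1(1)]
        Ck_subset[OF W1(1,2) CN] Ck_subset[OF W1(1,2) Cl] Ck_subset[OF W1(1) order_trans[OF W1(2) WU] Ck_\<phi>] W1(1) l_nz)
  have V: "\<exists>T. norm T = 1 \<and> T \<in> range (FD \<phi> u) \<and> V u = (T \<bullet> FD \<phi> u w0) *\<^sub>R T \<and>
      (\<forall>a. FD N u a = - l u *\<^sub>R shape_op \<phi> u T a)" if u: "u \<in> W1" for u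
  proof -
    obtain T where T: "norm T = 1" "T \<in> range (FD \<phi> u)" "\<And>a. FD N u a = - l u *\<^sub>R shape_op \<phi> u T a"
      using T[of u] u W1 by blast
    have "V u = (T \<bullet> FD \<phi> u w0) *\<^sub>R T" using l_nz[OF u] by (simp add: V_def T(3))
    then show ?thesis using T by blast
  qed
  have "V u0 = T0" using T0 l0 by (simp add: V_def T0(3) norm_eq_1)
  then have V0: "V u0 \<noteq> 0" using T0 by auto
  define W2 where "W2 = W1 \<inter> V -` (- {0})"
  have "open W2" unfolding W2_def
    by (rule continuous_open_preimage[OF Ck_continuous[OF CV[of 0]] W1(1)]) (simp add: open_Compl)
  moreover have "u0 \<in> W2" using V0 W1 by (simp add: W2_def)
  ultimately obtain r where r: "r > 0" "ball u0 r \<subseteq> W2" using open_contains_ball by blast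
  have sub: "ball u0 r \<subseteq> W1" "ball u0 r \<subseteq> W" "ball u0 r \<subseteq> U" using r W1 WU by (auto simp: W2_def)
  define T' where "T' u = V u /\<^sub>R norm (V u)" for u
  have T': "norm (T' u) = 1 \<and> T' u \<in> range (FD \<phi> u) \<and> T' u \<bullet> FD \<phi> u w0 \<noteq> 0 \<and>
      (\<forall>a. FD N u a = - l u *\<^sub>R shape_op \<phi> u (T' u) a)" if u: "u \<in> ball u0 r" for u
  proof -
    have nz: "V u \<noteq> 0" using u r by (auto simp: W2_def)
    obtain T where T: "norm T = 1" "T \<in> range (FD \<phi> u)" "V u = (T \<bullet> FD \<phi> u w0) *\<^sub>R T"
      "\<And>a. FD N u a = - l u *\<^sub>R shape_op \<phi> u T a"
      using V u sub by blast
    have t: "T \<bullet> FD \<phi> u w0 \<noteq> 0" using nz T(3) by auto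
    have eq: "T' u = sgn (T \<bullet> FD \<phi> u w0) *\<^sub>R T"
      using T(1) by (simp add: T'_def T(3) sgn_div_norm divide_inverse_commute)
    have sg: "sgn (T \<bullet> FD \<phi> u w0) = 1 \<or> sgn (T \<bullet> FD \<phi> u w0) = -1" using t by (auto simp: sgn_if)
    interpret linear "FD \<phi> u" using linear_FD sub u by blast
    obtain \<tau> where "T = FD \<phi> u \<tau>" using T(2) by blast
    then have "T' u \<in> range (FD \<phi> u)" unfolding eq by (metis scale rangeI)
    then show ?thesis using T sg t unfolding eq by auto
  qed
  define N' where "N' u = s *\<^sub>R N u" for u
  define l' where "l' u = s * l u" for u
  have dN': "FD N' u a = s *\<^sub>R FD N u a" if "u \<in> W" for u a
  proof -
    have "(N has_derivative FD N u) (at u)"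
      by (rule diff_on_open_has_derivative[OF W _ that]) (use CN[of "Suc 0"] in simp)
    from has_derivative_scaleR_right[OF this, of s] have "(N' has_derivative (\<lambda>a. s *\<^sub>R FD N u a)) (at u)"
      unfolding N'_def[abs_def] .
    from frechet_derivative_at[OF this] show ?thesis by metis
  qed
  interpret principal_patch U \<phi> "ball u0 r" N' T' l' w0
  proof
    show "open (ball u0 r)" "ball u0 r \<subseteq> U" using sub by auto
    show "Ck k (ball u0 r) N'" for k
      unfolding N'_def[abs_def] by (intro Ck_cmul Ck_subset[OF _ sub(2) CN]) auto
    show "Ck k (ball u0 r) T'" for k
      unfolding T'_def[abs_def] by (rule Ck_normalize[OF _ Ck_subset[OF _ sub(1) CV]]) (use r in \<open>auto simp: W2_def\<close>)
    show "Ck k (ball u0 r) l'" for k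
      unfolding l'_def[abs_def] by (intro Ck_mult Ck_const Ck_subset[OF _ sub(2) Cl]) auto
    fix u assume u: "u \<in> ball u0 r"
    then have uW: "u \<in> W" using sub by blast
    show "l' u > 0" using u sub by (auto simp: l'_def W1_def)
    show "norm (N' u) = 1" using N1[OF uW] s by (simp add: N'_def)
    show "norm (T' u) = 1" "T' u \<in> range (FD \<phi> u)" "T' u \<bullet> FD \<phi> u w0 \<noteq> 0" using T'[OF u] by auto
    show "N' u \<bullet> FD \<phi> u a = 0" for a using Np[OF uW] by (simp add: N'_def)
    show "FD N' u a = - l' u *\<^sub>R shape_op \<phi> u (T' u) a" for a
      unfolding dN'[OF uW] using T'[OF u] by (simp add: l'_def)
  qed
  show ?thesis
    by (rule that[OF r(1) sub(2) rot_struct_principal s(1)]) (simp add: l'_def)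
qed

end

text \<open>Along the profile curve \<open>(r, z)\<close> one has \<open>r = l / c\<close>, \<open>r' = \<mu> / c\<close> and \<open>z' = l\<^sup>2 / c\<close>, where \<open>c\<close> is the
  energy.  The amplitude \<open>am (a t)\<close> is recovered from \<open>r' = 2 C / (1 + C\<^sup>2)\<close> with \<open>C = cos (am (a t))\<close>,
  which gives \<open>C = \<mu> / (c + l\<^sup>2)\<close>; unlike \<open>r\<close>, it also distinguishes the two branches of the profile.\<close>

definition energy :: "real \<Rightarrow> real \<Rightarrow> real" where "energy l m = sqrt (m\<^sup>2 + l ^ 4)"

definition axis_vec :: "real \<Rightarrow> real \<Rightarrow> real^4 \<Rightarrow> real^4 \<Rightarrow> real^4" where
  "axis_vec l m T N = (1 / energy l m) *\<^sub>R (l\<^sup>2 *\<^sub>R T + m *\<^sub>R N)"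

text \<open>The position relative to the axis: the unit vector orthogonal to \<open>axis_vec\<close>
  in the plane of \<open>T\<close> and \<open>N\<close>, scaled by the radius
  \<open>l / c\<close>.\<close>

definition radial_vec :: "real \<Rightarrow> real \<Rightarrow> real^4 \<Rightarrow> real^4 \<Rightarrow> real^4" where
  "radial_vec l m T N = (l / (energy l m)\<^sup>2) *\<^sub>R (m *\<^sub>R T - l\<^sup>2 *\<^sub>R N)"

definition profile_time :: "real \<Rightarrow> real \<Rightarrow> real" where
  "profile_time l m = lem_F (arccos (m / (energy l m + l\<^sup>2))) / sqrt (2 * energy l m)"

definition profile_height :: "real \<Rightarrow> real \<Rightarrow> real" where
  "profile_height l m = height (sqrt (2 * energy l m)) (profile_time l m)"

text \<open>The point of height 0 on the axis, which the final isometry moves to the origin.\<close>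

definition base_point :: "real \<Rightarrow> real \<Rightarrow> real^4 \<Rightarrow> real^4 \<Rightarrow> real^4 \<Rightarrow> real^4" where
  "base_point l m T N p = p - radial_vec l m T N - profile_height l m *\<^sub>R axis_vec l m T N"

lemma energy_pos: "l > 0 \<Longrightarrow> energy l m > 0"
  by (simp add: energy_def add_nonneg_pos)

lemma energy_sq: "(energy l m)\<^sup>2 = m\<^sup>2 + l ^ 4"
  by (simp add: energy_def)

text \<open>Everything follows from the factorization \<open>m^2 = (c - l^2) (c + l^2)\<close>. The
  last identity says that \<open>sd(a t) / a\<close> has absolute value \<open>l / c\<close> when
  \<open>a^2 = 2 c\<close>.\<close>

lemma profile_arccos:
  fixes l m :: real
  assumes l: "l > 0"
  defines "c \<equiv> energy l m"
  defines "x \<equiv> m / (c + l\<^sup>2)"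
  shows "1 - x\<^sup>2 = 2 * l\<^sup>2 / (c + l\<^sup>2)" "-1 < x" "x < 1"
    "(sin (arccos x))\<^sup>2 = 2 * l\<^sup>2 / (c + l\<^sup>2)" "1 - (sin (arccos x))\<^sup>2 / 2 = c / (c + l\<^sup>2)"
    "(lem_sd (lem_F (arccos x)))\<^sup>2 = 2 * l\<^sup>2 / c"
proof -
  have c: "c > 0" unfolding c_def by (rule energy_pos[OF l])
  define A where "A = c + l\<^sup>2"
  have A: "A > 0" using c by (simp add: A_def add_pos_nonneg)
  have m2: "m\<^sup>2 = (c - l\<^sup>2) * A"
    using energy_sq[of l m] unfolding c_def[symmetric] A_def by (simp add: power2_eq_square power4_eq_xxxx algebra_simps)
  have "1 - x\<^sup>2 = 1 - m\<^sup>2 / A\<^sup>2" by (simp add: x_def A_def power_divide)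
  also have "\<dots> = 1 - (c - l\<^sup>2) / A" unfolding m2 using A by (simp add: power2_eq_square)
  also have "\<dots> = 2 * l\<^sup>2 / A" using A by (simp add: A_def field_simps)
  finally show 1: "1 - x\<^sup>2 = 2 * l\<^sup>2 / (c + l\<^sup>2)" by (simp add: A_def)
  have "1 - x\<^sup>2 > 0" unfolding 1 using A l by (simp add: A_def)
  then have "\<bar>x\<bar> < 1" by (simp add: abs_square_less_1)
  then show x: "-1 < x" "x < 1" by auto
  show 2: "(sin (arccos x))\<^sup>2 = 2 * l\<^sup>2 / (c + l\<^sup>2)"
    using x 1 by (simp add: sin_squared_eq)
  show 3: "1 - (sin (arccos x))\<^sup>2 / 2 = c / (c + l\<^sup>2)"
    unfolding 2 using A by (simp add: A_def field_simps)
  show "(lem_sd (lem_F (arccos x)))\<^sup>2 = 2 * l\<^sup>2 / c"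
  proof -
    have "(lem_sd (lem_F (arccos x)))\<^sup>2 = (sin (arccos x))\<^sup>2 / (1 - (sin (arccos x))\<^sup>2 / 2)"
      using half_sin_sq_pos[of "arccos x"] by (simp add: lem_sd_lem_F power_divide)
    also have "\<dots> = 2 * l\<^sup>2 / c" unfolding 3 unfolding 2 using A c by (simp add: A_def)
    finally show ?thesis .
  qed
qed

text \<open>\<open>algebra_simps\<close> collects \<open>x + x\<close> into the componentwise product \<open>x * 2\<close>.\<close>

lemma vec_times_2: "x * 2 = 2 *\<^sub>R x" for x :: "real^4"
  by (simp add: mult_2_right scaleR_2)

lemma convex_zero_derivative_constant:
  fixes f :: "real^3 \<Rightarrow> 'b::real_normed_vector"
  assumes "convex W" "\<And>u. u \<in> W \<Longrightarrow> (f has_derivative (\<lambda>_. 0)) (at u)" "u \<in> W" "v \<in> W"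
  shows "f u = f v"
  using has_derivative_zero_constant[OF assms(1), of f] assms(2-) has_derivative_at_withinI by metis

locale rot_patch =
  fixes W :: "(real^3) set" and \<phi> N T l \<mu>
  assumes W: "open W" "convex W" and rot: "rot_struct W \<phi> N T l \<mu>"
begin

abbreviation th :: "real^3 \<Rightarrow> real^3 \<Rightarrow> real" where "th u a \<equiv> T u \<bullet> FD \<phi> u a"

lemma rotD:
  assumes "u \<in> W"
  shows "l u > 0" "norm (N u) = 1" "norm (T u) = 1" "T u \<in> range (FD \<phi> u)" "N u \<bullet> FD \<phi> u a = 0"
    and d\<phi>: "(\<phi> has_derivative FD \<phi> u) (at u)"
    and dN: "(N has_derivative (\<lambda>a. - l u *\<^sub>R shape_op \<phi> u (T u) a)) (at u)"
    and dl: "(l has_derivative (\<lambda>a. \<mu> u * th u a)) (at u)"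
    and dT: "(T has_derivative (\<lambda>a. (\<mu> u / l u) *\<^sub>R (FD \<phi> u a - th u a *\<^sub>R T u) + (2 * l u * th u a) *\<^sub>R N u)) (at u)"
    and d\<mu>: "(\<mu> has_derivative (\<lambda>a. - 2 * l u ^ 3 * th u a)) (at u)"
  using assms rot unfolding rot_struct_def by blast+

abbreviation "en u \<equiv> energy (l u) (\<mu> u)"
abbreviation "ax u \<equiv> axis_vec (l u) (\<mu> u) (T u) (N u)"
abbreviation "rad u \<equiv> radial_vec (l u) (\<mu> u) (T u) (N u)"
abbreviation "ht u \<equiv> profile_height (l u) (\<mu> u)"

lemma energy_constant:
  assumes "u \<in> W" "v \<in> W"
  shows "en u = en v"
proof -
  have "((\<lambda>u. (\<mu> u)\<^sup>2 + l u ^ 4) has_derivative (\<lambda>_. 0)) (at u)" if u: "u \<in> W" for u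
    by (rule derivative_eq_intros dl[OF u] d\<mu>[OF u] refl)+
       (simp add: fun_eq_iff power2_eq_square power3_eq_cube power4_eq_xxxx algebra_simps eval_nat_numeral)
  from convex_zero_derivative_constant[OF W(2) this assms]
  show ?thesis by (simp add: energy_def)
qed

lemma profile_time_derivative:
  assumes u: "u \<in> W"
  shows "((\<lambda>u. profile_time (l u) (\<mu> u)) has_derivative th u) (at u)"
proof -
  define c where "c = en u"
  have c: "c > 0" unfolding c_def by (rule energy_pos[OF rotD(1)[OF u]])
  define A where "A = c + (l u)\<^sup>2"
  have A: "A > 0" using c by (simp add: A_def add_pos_nonneg)
  \<comment> \<open>The energy is frozen at its value \<open>c\<close>, which is the same at all
    points of the convex set \<open>W\<close>; only \<open>l\<close> and \<open>\<mu>\<close> remain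
    to be differentiated.\<close>
  define X where "X w = \<mu> w / (c + (l w)\<^sup>2)" for w
  have l: "l u > 0" using rotD(1)[OF u] .
  have m2: "(\<mu> u)\<^sup>2 = (c - (l u)\<^sup>2) * A"
    using energy_sq[of "l u" "\<mu> u"] unfolding c_def[symmetric] A_def
    by (simp add: power2_eq_square power4_eq_xxxx algebra_simps)
  have X: "-1 < X u" "X u < 1" "1 - (X u)\<^sup>2 = 2 * (l u)\<^sup>2 / A" "1 - (sin (arccos (X u)))\<^sup>2 / 2 = c / A"
    using profile_arccos[OF l, of "\<mu> u"] unfolding c_def[symmetric] X_def A_def by auto
  have dX: "(X has_derivative (\<lambda>a. - 2 * l u * c / A * th u a)) (at u)"
  proof -
    have d: "((\<lambda>w. c + (l w)\<^sup>2) has_derivative (\<lambda>a. 2 * l u * (\<mu> u * th u a))) (at u)"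
      by (rule derivative_eq_intros dl[OF u] refl)+ (simp add: fun_eq_iff)
    have "(X has_derivative (\<lambda>a. ((- 2 * l u ^ 3 * th u a) * A - \<mu> u * (2 * l u * (\<mu> u * th u a))) / (A * A))) (at u)"
      unfolding X_def[abs_def] A_def
      by (rule has_derivative_divide'[OF d\<mu>[OF u] d]) (use A A_def in auto)
    moreover have "((- 2 * l u ^ 3 * th u a) * A - \<mu> u * (2 * l u * (\<mu> u * th u a))) / (A * A) = - 2 * l u * c / A * th u a" for a
    proof -
      have "(- 2 * l u ^ 3 * th u a) * A - \<mu> u * (2 * l u * (\<mu> u * th u a))
        = (- 2 * l u ^ 3 * th u a) * A - 2 * l u * (\<mu> u)\<^sup>2 * th u a" by (simp add: power2_eq_square)
      also have "\<dots> = - 2 * l u * c * th u a * A"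
        unfolding m2 by (simp add: power2_eq_square power3_eq_cube algebra_simps)
      finally show ?thesis using A by simp
    qed
    ultimately show ?thesis by simp
  qed
  define y where "y = arccos (X u)"
  have "((\<lambda>w. lem_F (arccos (X w)) / sqrt (2 * c)) has_derivative
     (\<lambda>a. (- 2 * l u * c / A * th u a) * inverse (- sqrt (1 - (X u)\<^sup>2)) * (1 / sqrt (1 - (sin y)\<^sup>2 / 2)) / sqrt (2 * c))) (at u)"
    unfolding y_def
    by (rule bounded_linear.has_derivative[OF bounded_linear_divide
        DERIV_compose_FDERIV[OF lem_F_deriv DERIV_compose_FDERIV[OF DERIV_arccos[OF X(1,2)] dX]]])
  moreover have "(- 2 * l u * c / A * th u a) * inverse (- sqrt (1 - (X u)\<^sup>2)) * (1 / sqrt (1 - (sin y)\<^sup>2 / 2)) / sqrt (2 * c) = th u a" for a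
  proof -
    \<comment> \<open>The three square roots come from the arccosine, from the elliptic integrand
      and from the scaling by \<open>a\<close>; their product cancels the derivative of
      \<open>X\<close> up to sign.\<close>
    have "sqrt (1 - (X u)\<^sup>2) * sqrt (1 - (sin y)\<^sup>2 / 2) * sqrt (2 * c) = sqrt ((2 * l u * c / A)\<^sup>2)"
      unfolding y_def X(3,4) real_sqrt_mult[symmetric] using A by (simp add: power2_eq_square field_simps)
    also have "\<dots> = 2 * l u * c / A" using A c l by (simp add: real_sqrt_abs)
    finally have q: "2 * l u * c / A = sqrt (1 - (X u)\<^sup>2) * sqrt (1 - (sin y)\<^sup>2 / 2) * sqrt (2 * c)" by simp
    have pos: "sqrt (1 - (X u)\<^sup>2) \<noteq> 0" "sqrt (1 - (sin y)\<^sup>2 / 2) \<noteq> 0" "sqrt (2 * c) \<noteq> 0"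
      unfolding y_def X(3,4) using A c l by auto
    have cancel: "(- (p * q * r) * t) * inverse (- p) * (1 / q) / r = t" if "p \<noteq> 0" "q \<noteq> 0" "r \<noteq> 0" for p q r t :: real
      using that by (simp add: field_simps)
    have "- 2 * l u * c / A = - (2 * l u * c / A)" by simp
    then show ?thesis unfolding q using cancel[OF pos] by simp
  qed
  ultimately have "((\<lambda>w. lem_F (arccos (X w)) / sqrt (2 * c)) has_derivative th u) (at u)" by simp
  then show ?thesis
    by (rule has_derivative_transform_within_open[OF _ W(1) u])
       (simp add: profile_time_def X_def c_def energy_constant[OF u])
qed

lemma profile_height_derivative:
  assumes u: "u \<in> W"
  shows "((\<lambda>u. ht u) has_derivative (\<lambda>a. (l u)\<^sup>2 / en u * th u a)) (at u)"
proof -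
  define c where "c = en u"
  have c: "c > 0" unfolding c_def by (rule energy_pos[OF rotD(1)[OF u]])
  have "((\<lambda>w. height (sqrt (2 * c)) (profile_time (l w) (\<mu> w))) has_derivative
     (\<lambda>a. th u a * ((lem_sd (sqrt (2 * c) * profile_time (l u) (\<mu> u)))\<^sup>2 / 2))) (at u)"
    by (rule DERIV_compose_FDERIV[OF height_deriv profile_time_derivative[OF u]])
  moreover have "(lem_sd (sqrt (2 * c) * profile_time (l u) (\<mu> u)))\<^sup>2 = 2 * (l u)\<^sup>2 / c"
    using profile_arccos(6)[OF rotD(1)[OF u], of "\<mu> u"] c unfolding profile_time_def c_def[symmetric] by simp
  ultimately have "((\<lambda>w. height (sqrt (2 * c)) (profile_time (l w) (\<mu> w))) has_derivative
     (\<lambda>a. (l u)\<^sup>2 / c * th u a)) (at u)" by (simp add: mult_ac)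
  then show ?thesis unfolding c_def
    by (rule has_derivative_transform_within_open[OF _ W(1) u])
       (simp add: profile_height_def energy_constant[OF u])
qed

lemma axis_vec_derivative:
  assumes u: "u \<in> W"
  shows "((\<lambda>u. ax u) has_derivative (\<lambda>_. 0)) (at u)"
proof -
  define c where "c = en u"
  have l: "l u > 0" using rotD(1)[OF u] .
  have "((\<lambda>w. (1 / c) *\<^sub>R ((l w)\<^sup>2 *\<^sub>R T w + \<mu> w *\<^sub>R N w)) has_derivative (\<lambda>_. 0)) (at u)"
    by (rule derivative_eq_intros dl[OF u] d\<mu>[OF u] dT[OF u] dN[OF u] refl)+
       (use l in \<open>simp add: fun_eq_iff power2_eq_square power3_eq_cube algebra_simps vec_times_2\<close>)
  then show ?thesis unfolding c_def
    by (rule has_derivative_transform_within_open[OF _ W(1) u])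
       (simp add: axis_vec_def energy_constant[OF u])
qed

text \<open>The radial vector changes by the displacement minus its axial part, and the axial part
  is what \<open>profile_height_derivative\<close> accounts for; hence \<open>base_point\<close> is
  constant.\<close>

lemma radial_vec_derivative:
  assumes u: "u \<in> W"
  shows "((\<lambda>u. rad u) has_derivative
    (\<lambda>a. FD \<phi> u a - ((l u)\<^sup>2 / en u * th u a) *\<^sub>R ax u)) (at u)"
proof -
  define c where "c = en u"
  have l: "l u > 0" using rotD(1)[OF u] .
  have c: "c > 0" unfolding c_def by (rule energy_pos[OF l])
  have c2: "c\<^sup>2 = (\<mu> u)\<^sup>2 + (l u)^4" unfolding c_def by (rule energy_sq)
  define R' where "R' a = (l u) *\<^sub>R (\<mu> u *\<^sub>R ((\<mu> u / l u) *\<^sub>R (FD \<phi> u a - th u a *\<^sub>R T u) + (2 * l u * th u a) *\<^sub>R N u)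
      + (- 2 * l u ^ 3 * th u a) *\<^sub>R T u
      - ((l u)\<^sup>2 *\<^sub>R (- l u *\<^sub>R shape_op \<phi> u (T u) a) + (2 * l u * (\<mu> u * th u a)) *\<^sub>R N u))
      + (\<mu> u * th u a) *\<^sub>R (\<mu> u *\<^sub>R T u - (l u)\<^sup>2 *\<^sub>R N u)" for a
  have d2: "((\<lambda>w. (l w)\<^sup>2) has_derivative (\<lambda>a. 2 * l u * (\<mu> u * th u a))) (at u)"
    by (rule derivative_eq_intros dl[OF u] refl)+ (simp add: fun_eq_iff)
  have "((\<lambda>w. (1 / c\<^sup>2) *\<^sub>R (l w *\<^sub>R (\<mu> w *\<^sub>R T w - (l w)\<^sup>2 *\<^sub>R N w))) has_derivative (\<lambda>a. (1 / c\<^sup>2) *\<^sub>R R' a)) (at u)"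
    unfolding R'_def
    by (rule has_derivative_scaleR_right[OF has_derivative_scaleR[OF dl[OF u] has_derivative_diff[OF
          has_derivative_scaleR[OF d\<mu>[OF u] dT[OF u]] has_derivative_scaleR[OF d2 dN[OF u]]]]])
  moreover have "(1 / c\<^sup>2) *\<^sub>R R' a = FD \<phi> u a - ((l u)\<^sup>2 / c * th u a) *\<^sub>R ((1 / c) *\<^sub>R ((l u)\<^sup>2 *\<^sub>R T u + \<mu> u *\<^sub>R N u))" for a
  proof -
    have "R' a = c\<^sup>2 *\<^sub>R FD \<phi> u a - ((l u)\<^sup>2 * th u a) *\<^sub>R ((l u)\<^sup>2 *\<^sub>R T u + \<mu> u *\<^sub>R N u)"
      unfolding R'_def c2 using l
      by (simp add: power2_eq_square power3_eq_cube power4_eq_xxxx algebra_simps vec_times_2)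
    then show ?thesis using c by (simp add: scaleR_diff_right power2_eq_square)
  qed
  ultimately have "((\<lambda>w. (1 / c\<^sup>2) *\<^sub>R (l w *\<^sub>R (\<mu> w *\<^sub>R T w - (l w)\<^sup>2 *\<^sub>R N w))) has_derivative
      (\<lambda>a. FD \<phi> u a - ((l u)\<^sup>2 / c * th u a) *\<^sub>R ax u)) (at u)"
    by (simp add: axis_vec_def c_def)
  then show ?thesis unfolding c_def
    by (rule has_derivative_transform_within_open[OF _ W(1) u])
       (simp add: radial_vec_def energy_constant[OF u])
qed

lemma axis_vec_constant:
  "u \<in> W \<Longrightarrow> v \<in> W \<Longrightarrow> ax u = ax v"
  by (rule convex_zero_derivative_constant[OF W(2) axis_vec_derivative])

lemma base_point_constant:
  assumes "u \<in> W" "v \<in> W"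
  shows "base_point (l u) (\<mu> u) (T u) (N u) (\<phi> u) = base_point (l v) (\<mu> v) (T v) (N v) (\<phi> v)"
proof (rule convex_zero_derivative_constant[OF W(2) _ assms])
  fix u assume u: "u \<in> W"
  have "((\<lambda>u. \<phi> u - rad u - ht u *\<^sub>R ax u) has_derivative
     (\<lambda>a. FD \<phi> u a - (FD \<phi> u a - ((l u)\<^sup>2 / en u * th u a) *\<^sub>R ax u)
        - (ht u *\<^sub>R 0 + ((l u)\<^sup>2 / en u * th u a) *\<^sub>R ax u))) (at u)"
    by (rule has_derivative_diff[OF has_derivative_diff[OF d\<phi>[OF u] radial_vec_derivative[OF u]]
          has_derivative_scaleR[OF profile_height_derivative[OF u] axis_vec_derivative[OF u]]])
  then show "((\<lambda>u. base_point (l u) (\<mu> u) (T u) (N u) (\<phi> u)) has_derivative (\<lambda>_. 0)) (at u)"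
    by (simp add: base_point_def)
qed

end

section \<open>Change of chart\<close>

text \<open>Injectivity of \<open>L2\<close> bounds the increments of the continuous map \<open>\<psi>\<close> linearly by those of \<open>\<phi>1\<close>.\<close>

lemma transition_has_derivative:
  fixes \<phi>1 \<phi>2 :: "real^3 \<Rightarrow> real^4"
  assumes V: "open V" "u \<in> V" and eq: "\<And>w. w \<in> V \<Longrightarrow> \<phi>2 (\<psi> w) = \<phi>1 w"
    and cont: "continuous_on V \<psi>"
    and d1: "(\<phi>1 has_derivative L1) (at u)" and d2: "(\<phi>2 has_derivative L2) (at (\<psi> u))" and inj: "inj L2"
  shows "\<exists>D. (\<psi> has_derivative D) (at u) \<and> L1 = L2 \<circ> D"
proof -
  have l2: "linear L2" and l1: "linear L1" using d1 d2 has_derivative_linear by auto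
  obtain K where K: "linear K" "K \<circ> L2 = id" using linear_injective_left_inverse[OF l2 inj] by blast
  have KL: "K (L2 v) = v" for v using K(2) by (metis comp_apply id_apply)
  have blK: "bounded_linear K" and bl1: "bounded_linear (K \<circ> L1)"
    using K l1 linear_conv_bounded_linear linear_compose by blast+
  obtain k where k: "k > 0" "\<And>z. norm (K z) \<le> norm z * k" using bounded_linear.pos_bounded[OF blK] by blast
  obtain b where b: "b > 0" "\<And>z. norm (K (L1 z)) \<le> norm z * b" using bounded_linear.pos_bounded[OF bl1] by auto
  have "(\<psi> has_derivative (K \<circ> L1)) (at u)"
    unfolding has_derivative_at_alt
  proof (intro conjI allI impI)
    show "bounded_linear (K \<circ> L1)" by (rule bl1)
    fix e :: real assume e: "e > 0"
    \<comment> \<open>\<open>C\<close> becomes a linear bound for the increments of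
      \<open>\<psi>\<close>: \<open>k * e2 \<le> 1/2\<close> lets the increment on the right be
      absorbed into the left, and \<open>e1 \<le> 1\<close> bounds the rest.\<close>
    define C where "C = 2 * (b + k)"
    have C: "C > 0" using b k by (simp add: C_def)
    define e1 where "e1 = min 1 (e / (2 * k))"
    define e2 where "e2 = min (1 / (2 * k)) (e / (2 * k * C))"
    have e1: "e1 > 0" "e1 \<le> 1" "k * e1 \<le> e / 2" and e2: "e2 > 0" "k * e2 \<le> 1/2" "k * e2 * C \<le> e / 2"
    proof -
      show "e1 > 0" "e1 \<le> 1" "e2 > 0" using e k C by (auto simp: e1_def e2_def)
      have "k * e1 \<le> k * (e / (2 * k))" using k by (intro mult_left_mono) (auto simp: e1_def)
      then show "k * e1 \<le> e / 2" using k by simp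
      have "k * e2 \<le> k * (1 / (2 * k))" using k by (intro mult_left_mono) (auto simp: e2_def)
      then show "k * e2 \<le> 1/2" using k by simp
      have "(k * C) * e2 \<le> (k * C) * (e / (2 * k * C))" using k C by (intro mult_left_mono) (auto simp: e2_def)
      then show "k * e2 * C \<le> e / 2" using k C by (simp add: mult_ac)
    qed
    obtain r1 where r1: "r1 > 0" "\<And>w. norm (w - u) < r1 \<Longrightarrow> norm (\<phi>1 w - \<phi>1 u - L1 (w - u)) \<le> e1 * norm (w - u)"
      using d1 e1 unfolding has_derivative_at_alt by blast
    obtain r2 where r2: "r2 > 0" "\<And>z. norm (z - \<psi> u) < r2 \<Longrightarrow> norm (\<phi>2 z - \<phi>2 (\<psi> u) - L2 (z - \<psi> u)) \<le> e2 * norm (z - \<psi> u)"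
      using d2 e2 unfolding has_derivative_at_alt by blast
    have "isCont \<psi> u" using cont V continuous_on_eq_continuous_at by blast
    then obtain r3 where r3: "r3 > 0" "\<And>w. norm (w - u) < r3 \<Longrightarrow> norm (\<psi> w - \<psi> u) < r2"
      using r2(1) unfolding continuous_at_eps_delta dist_norm by blast
    obtain r4 where r4: "r4 > 0" "ball u r4 \<subseteq> V" using V open_contains_ball by blast
    define d where "d = min (min r1 r3) r4"
    have "d > 0" using r1 r3 r4 by (simp add: d_def)
    moreover have "norm (\<psi> w - \<psi> u - (K \<circ> L1) (w - u)) \<le> e * norm (w - u)" if w: "norm (w - u) < d" for w
    proof -
      have "dist u w < r4" using w by (simp add: d_def dist_norm norm_minus_commute)
      then have wV: "w \<in> V" using r4 by auto
      define p1 where "p1 = \<phi>1 w - \<phi>1 u - L1 (w - u)"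
      define p2 where "p2 = \<phi>2 (\<psi> w) - \<phi>2 (\<psi> u) - L2 (\<psi> w - \<psi> u)"
      have n1: "norm p1 \<le> e1 * norm (w - u)" unfolding p1_def using r1(2) w by (simp add: d_def)
      have n2: "norm p2 \<le> e2 * norm (\<psi> w - \<psi> u)" unfolding p2_def using r2(2) r3(2) w by (simp add: d_def)
      have "L2 (\<psi> w - \<psi> u) = L1 (w - u) + (p1 - p2)"
        unfolding p1_def p2_def by (simp add: eq[OF wV] eq[OF V(2)])
      then have "K (L2 (\<psi> w - \<psi> u)) = K (L1 (w - u)) + K (p1 - p2)" using linear_add[OF K(1)] by metis
      then have main: "\<psi> w - \<psi> u - K (L1 (w - u)) = K (p1 - p2)" unfolding KL by simp
      have "norm (K (p1 - p2)) \<le> k * (norm p1 + norm p2)"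
        using order_trans[OF k(2)[of "p1 - p2"] mult_right_mono[OF norm_triangle_ineq4[of p1 p2], of k]] k(1)
        by (simp add: mult.commute)
      also have "\<dots> \<le> k * (e1 * norm (w - u) + e2 * norm (\<psi> w - \<psi> u))"
        using n1 n2 k(1) by (intro mult_left_mono) auto
      finally have est: "norm (K (p1 - p2)) \<le> k * e1 * norm (w - u) + k * e2 * norm (\<psi> w - \<psi> u)"
        by (simp add: algebra_simps)
      have "norm (\<psi> w - \<psi> u) \<le> norm (K (L1 (w - u))) + norm (K (p1 - p2))"
        using norm_triangle_ineq[of "K (L1 (w - u))" "K (p1 - p2)"] main by (simp add: algebra_simps)
      also have "\<dots> \<le> b * norm (w - u) + (k * norm (w - u) + 1/2 * norm (\<psi> w - \<psi> u))"
      proof (intro add_mono order_trans[OF est])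
        show "norm (K (L1 (w - u))) \<le> b * norm (w - u)" using b(2)[of "w - u"] by (simp add: mult.commute)
        have "k * e1 \<le> k" using mult_left_mono[OF e1(2), of k] k(1) by simp
        then show "k * e1 * norm (w - u) \<le> k * norm (w - u)" by (rule mult_right_mono) simp
        show "k * e2 * norm (\<psi> w - \<psi> u) \<le> 1/2 * norm (\<psi> w - \<psi> u)" using e2(2) by (rule mult_right_mono) simp
      qed
      finally have Cb: "norm (\<psi> w - \<psi> u) \<le> C * norm (w - u)" by (simp add: C_def algebra_simps)
      have "k * e2 * norm (\<psi> w - \<psi> u) \<le> k * e2 * (C * norm (w - u))"
        using Cb k(1) e2(1) by (intro mult_left_mono) auto
      also have "\<dots> \<le> e / 2 * norm (w - u)" using mult_right_mono[OF e2(3), of "norm (w - u)"] by (simp add: mult_ac)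
      finally have "norm (K (p1 - p2)) \<le> e / 2 * norm (w - u) + e / 2 * norm (w - u)"
        using est mult_right_mono[OF e1(3), of "norm (w - u)"] by simp
      then show ?thesis using main by simp
    qed
    ultimately show "\<exists>d>0. \<forall>y. norm (y - u) < d \<longrightarrow> norm (\<psi> y - \<psi> u - (K \<circ> L1) (y - u)) \<le> e * norm (y - u)" by blast
  qed
  note D = this
  have "((\<lambda>w. \<phi>2 (\<psi> w)) has_derivative (\<lambda>v. L2 ((K \<circ> L1) v))) (at u)"
    by (rule has_derivative_compose[OF D d2])
  then have "(\<phi>1 has_derivative (\<lambda>v. L2 ((K \<circ> L1) v))) (at u)"
    by (rule has_derivative_transform_within_open[OF _ V]) (rule eq)
  then have "L1 = (\<lambda>v. L2 ((K \<circ> L1) v))" using d1 has_derivative_unique by blast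
  then have "L1 = L2 \<circ> (K \<circ> L1)" by (simp add: comp_def)
  then show ?thesis using D by blast
qed

section \<open>Comparison of two charts\<close>

text \<open>Compared with \<open>rot_struct\<close>, the factor \<open>l\<close> may vanish or be
  negative and \<open>T\<close> belongs to a single point. This allows a chart carrying only a
  \<open>shape_field\<close> to be compared with one carrying a rotational structure.\<close>

definition shape_at :: "(real^3 \<Rightarrow> real^4) \<Rightarrow> (real^3 \<Rightarrow> real^4) \<Rightarrow> real \<Rightarrow> real^4 \<Rightarrow> real^3 \<Rightarrow> bool" where
  "shape_at \<phi> N l T u \<longleftrightarrow> norm (N u) = 1 \<and> norm T = 1 \<and> T \<in> range (FD \<phi> u) \<and>
    (\<forall>a. N u \<bullet> FD \<phi> u a = 0) \<and> (\<phi> has_derivative FD \<phi> u) (at u) \<and> inj (FD \<phi> u) \<and>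
    (N has_derivative (\<lambda>a. - l *\<^sub>R shape_op \<phi> u T a)) (at u)"

text \<open>The two unit normals agree up to a sign, which is constant near \<open>u\<close> by
  continuity; differentiating the resulting relation between them compares the shape
  operators.\<close>

lemma transition_shape:
  assumes V: "open V" "u \<in> V" and eq: "\<And>w. w \<in> V \<Longrightarrow> \<phi>2 (\<psi> w) = \<phi>1 w"
    and cont: "continuous_on V \<psi>"
    and s1: "\<And>w. w \<in> V \<Longrightarrow> shape_at \<phi>1 N1 (l1 w) (T1 w) w"
    and s2: "\<And>w. w \<in> V \<Longrightarrow> shape_at \<phi>2 N2 (l2 w) (T2 w) (\<psi> w)"
  obtains V' s where "open V'" "u \<in> V'" "V' \<subseteq> V" "\<bar>s\<bar> = (1::real)"
    "\<And>w. w \<in> V' \<Longrightarrow> N1 w = s *\<^sub>R N2 (\<psi> w)"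
    "\<And>w. w \<in> V' \<Longrightarrow> T2 w \<in> range (FD \<phi>1 w)"
    "\<And>w a. w \<in> V' \<Longrightarrow> l1 w *\<^sub>R shape_op \<phi>1 w (T1 w) a
       = (s * l2 w) *\<^sub>R shape_op \<phi>1 w (T2 w) a"
proof -
  have tr: "\<exists>D. (\<psi> has_derivative D) (at w) \<and> FD \<phi>1 w = FD \<phi>2 (\<psi> w) \<circ> D" if w: "w \<in> V" for w
    using transition_has_derivative[where \<psi>=\<psi> and ?\<phi>1.0=\<phi>1 and ?\<phi>2.0=\<phi>2, OF V(1) w eq cont, of "FD \<phi>1 w" "FD \<phi>2 (\<psi> w)"] s1[OF w] s2[OF w]
    unfolding shape_at_def by blast
  have dir: "N1 w = (N1 w \<bullet> N2 (\<psi> w)) *\<^sub>R N2 (\<psi> w)" and rng: "T2 w \<in> range (FD \<phi>1 w)" if w: "w \<in> V" for w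
  proof -
    obtain D where D: "(\<psi> has_derivative D) (at w)" "FD \<phi>1 w = FD \<phi>2 (\<psi> w) \<circ> D" using tr[OF w] by blast
    have h1: "linear (FD \<phi>1 w)" "inj (FD \<phi>1 w)" using s1[OF w] has_derivative_linear unfolding shape_at_def by blast+
    show "N1 w = (N1 w \<bullet> N2 (\<psi> w)) *\<^sub>R N2 (\<psi> w)"
      by (rule unit_normal_unique_direction[OF h1])
         (use s1[OF w] s2[OF w] D in \<open>auto simp: shape_at_def\<close>)
    have "inj D" using h1(2) unfolding D(2) by (rule inj_on_imageI2)
    then have "surj D" using linear_injective_imp_surjective[OF has_derivative_linear[OF D(1)]] by simp
    then show "T2 w \<in> range (FD \<phi>1 w)"
      using s2[OF w] unfolding shape_at_def D(2) by (metis image_comp)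
  qed
  define f where "f w = N1 w \<bullet> N2 (\<psi> w)" for w
  have f1: "\<bar>f w\<bar> = 1" if w: "w \<in> V" for w
  proof -
    have "norm (N1 w) = \<bar>f w\<bar> * norm (N2 (\<psi> w))" by (subst dir[OF w]) (simp add: f_def)
    then show ?thesis using s1[OF w] s2[OF w] by (simp add: shape_at_def)
  qed
  have "continuous_on V N1"
    using s1 unfolding shape_at_def by (meson continuous_at_imp_continuous_on has_derivative_continuous)
  moreover have "continuous_on V (\<lambda>w. N2 (\<psi> w))"
  proof (rule continuous_on_compose2[OF _ cont])
    show "continuous_on (\<psi> ` V) N2"
    proof (rule continuous_at_imp_continuous_on, rule ballI)
      fix z assume "z \<in> \<psi> ` V"
      then obtain w where "w \<in> V" "z = \<psi> w" by blast
      then show "isCont N2 z" using s2[of w] has_derivative_continuous unfolding shape_at_def by blast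
    qed
  qed simp
  ultimately have cf: "continuous_on V (\<lambda>w. f u * f w)" unfolding f_def by (intro continuous_intros)
  define V' where "V' = V \<inter> (\<lambda>w. f u * f w) -` {0<..}"
  have V': "open V'" "V' \<subseteq> V" unfolding V'_def
    using continuous_open_preimage[OF cf V(1), of "{0<..}"] by auto
  have fu: "f u * f u = 1" using f1[OF V(2)] by (auto simp: abs_if split: if_splits)
  then have uV': "u \<in> V'" using V by (simp add: V'_def)
  have fw: "f w = f u" if "w \<in> V'" for w
    using that f1[of w] f1[OF V(2)] unfolding V'_def by (auto simp: abs_if split: if_splits)
  have N12: "N1 w = f u *\<^sub>R N2 (\<psi> w)" if "w \<in> V'" for w
    using dir[of w] fw[OF that] that V' unfolding f_def[symmetric] by auto
  show ?thesis
  proof (rule that[OF V'(1) uV' V'(2) f1[OF V(2)] N12])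
    show "T2 w \<in> range (FD \<phi>1 w)" if "w \<in> V'" for w using rng that V' by blast
    fix w a assume w': "w \<in> V'"
    then have w: "w \<in> V" using V' by blast
    obtain D where D: "(\<psi> has_derivative D) (at w)" "FD \<phi>1 w = FD \<phi>2 (\<psi> w) \<circ> D" using tr[OF w] by blast
    have "((\<lambda>w. N2 (\<psi> w)) has_derivative (\<lambda>a. - l2 w *\<^sub>R (FD \<phi>2 (\<psi> w) (D a) + (T2 w \<bullet> FD \<phi>2 (\<psi> w) (D a)) *\<^sub>R T2 w))) (at w)"
      by (rule has_derivative_compose[OF D(1)]) (use s2[OF w] in \<open>simp add: shape_at_def\<close>)
    then have "((\<lambda>w. N2 (\<psi> w)) has_derivative (\<lambda>a. - l2 w *\<^sub>R shape_op \<phi>1 w (T2 w) a)) (at w)"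
      unfolding D(2) by simp
    from has_derivative_scaleR_right[OF this, of "f u"]
    have "(N1 has_derivative (\<lambda>a. f u *\<^sub>R (- l2 w *\<^sub>R shape_op \<phi>1 w (T2 w) a))) (at w)"
      by (rule has_derivative_transform_within_open[OF _ V'(1) w']) (simp add: N12)
    moreover have "(N1 has_derivative (\<lambda>a. - l1 w *\<^sub>R shape_op \<phi>1 w (T1 w) a)) (at w)"
      using s1[OF w] by (simp add: shape_at_def)
    ultimately have "(\<lambda>a. f u *\<^sub>R (- l2 w *\<^sub>R shape_op \<phi>1 w (T2 w) a))
       = (\<lambda>a. - l1 w *\<^sub>R shape_op \<phi>1 w (T1 w) a)" by (rule has_derivative_unique)
    from fun_cong[OF this, of a]
    show "l1 w *\<^sub>R shape_op \<phi>1 w (T1 w) a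
       = (f u * l2 w) *\<^sub>R shape_op \<phi>1 w (T2 w) a" by simp
  qed
qed

text \<open>With \<open>k = T1 \<bullet> T2\<close>, the two quadratic forms evaluated on
  \<open>T1\<close> and on \<open>T2\<close> give \<open>2 * l1 = s * l2 * (1 + k\<^sup>2)\<close>
  and \<open>l1 * (1 + k\<^sup>2) = 2 * s * l2\<close>. Together they force
  \<open>k\<^sup>2 = 1\<close>, the equality case of Cauchy-Schwarz.\<close>

lemma shape_operator_determines:
  fixes T1 T2 :: "real^4" and l1 l2 s :: real
  assumes l: "l1 > 0" "l2 > 0" "\<bar>s\<bar> = 1" and T: "norm T1 = 1" "norm T2 = 1" "T1 \<in> range L" "T2 \<in> range L"
    and eq: "\<And>a. l1 *\<^sub>R (L a + (T1 \<bullet> L a) *\<^sub>R T1) = (s * l2) *\<^sub>R (L a + (T2 \<bullet> L a) *\<^sub>R T2)"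
  shows "s = 1" "l1 = l2" "T1 = T2 \<or> T1 = - T2"
proof -
  have TT: "T1 \<bullet> T1 = 1" "T2 \<bullet> T2 = 1" using T by (auto simp: norm_eq_1)
  define k where "k = T1 \<bullet> T2"
  have kk: "T2 \<bullet> T1 = k" "T1 \<bullet> T2 = k" by (simp_all add: k_def inner_commute)
  obtain a1 a2 where a: "L a1 = T1" "L a2 = T2" using T by (metis imageE)
  have "(l1 *\<^sub>R (T1 + (T1 \<bullet> T1) *\<^sub>R T1)) \<bullet> T1 = ((s * l2) *\<^sub>R (T1 + (T2 \<bullet> T1) *\<^sub>R T2)) \<bullet> T1"
    using eq[of a1] unfolding a by simp
  then have e1: "2 * l1 = s * l2 * (1 + k\<^sup>2)" by (simp only: inner_scaleR_left inner_add_left TT kk) (simp add: power2_eq_square algebra_simps)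
  have "(l1 *\<^sub>R (T2 + (T1 \<bullet> T2) *\<^sub>R T1)) \<bullet> T2 = ((s * l2) *\<^sub>R (T2 + (T2 \<bullet> T2) *\<^sub>R T2)) \<bullet> T2"
    using eq[of a2] unfolding a by simp
  then have e2: "l1 * (1 + k\<^sup>2) = s * l2 * 2" by (simp only: inner_scaleR_left inner_add_left TT kk) (simp add: power2_eq_square algebra_simps)
  have "s * l2 * 2 > 0" unfolding e2[symmetric] using l by (simp add: add_pos_nonneg)
  then have "s > 0" using l by (simp add: zero_less_mult_iff)
  then show s1: "s = 1" using l by simp
  have "l1 * ((1 + k\<^sup>2) * (1 + k\<^sup>2)) = l1 * 4"
  proof -
    have "l1 * ((1 + k\<^sup>2) * (1 + k\<^sup>2)) = (l1 * (1 + k\<^sup>2)) * (1 + k\<^sup>2)" by simp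
    also have "\<dots> = 2 * (s * l2 * (1 + k\<^sup>2))" unfolding e2 by simp
    finally show ?thesis unfolding e1[symmetric] by simp
  qed
  then have "(1 + k\<^sup>2)\<^sup>2 = 2\<^sup>2" using l by (simp add: power2_eq_square)
  then have "1 + k\<^sup>2 = 2" using power2_eq_imp_eq[of "1 + k\<^sup>2" 2] by simp
  then have k2: "k\<^sup>2 = 1" by simp
  then show "l1 = l2" using e1 s1 by simp
  have "(T1 - k *\<^sub>R T2) \<bullet> (T1 - k *\<^sub>R T2) = 0"
    using k2 by (simp add: inner_diff_left inner_diff_right TT kk power2_eq_square)
  then have "T1 = k *\<^sub>R T2" by simp
  moreover have "k = 1 \<or> k = -1" using k2 by (simp add: power2_eq_1_iff)
  ultimately show "T1 = T2 \<or> T1 = - T2" by auto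
qed

text \<open>The constants are the congruence data: \<open>c\<close> selects the model,
  \<open>E\<close> and \<open>B\<close> the isometry. Quantifying over \<open>T\<close> leaves its
  sign open.\<close>

definition adapted :: "(real^3) set \<Rightarrow> (real^3 \<Rightarrow> real^4) \<Rightarrow> real \<Rightarrow> real^4 \<Rightarrow> real^4 \<Rightarrow> bool" where
  "adapted W \<phi> c E B \<longleftrightarrow> (\<exists>N T l \<mu>. rot_struct W \<phi> N T l \<mu> \<and>
    (\<forall>u\<in>W. energy (l u) (\<mu> u) = c \<and> axis_vec (l u) (\<mu> u) (T u) (N u) = E \<and>
       base_point (l u) (\<mu> u) (T u) (N u) (\<phi> u) = B))"

lemma rot_struct_shape_at:
  "rot_struct W \<phi> N T l \<mu> \<Longrightarrow> u \<in> W \<Longrightarrow> inj (FD \<phi> u) \<Longrightarrow> shape_at \<phi> N (l u) (T u) u"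
  unfolding rot_struct_def shape_at_def by blast

lemma rot_struct_NT: "rot_struct W \<phi> N T l \<mu> \<Longrightarrow> u \<in> W \<Longrightarrow> N u \<bullet> T u = 0"
  unfolding rot_struct_def by force

lemma norm_axis_vec:
  assumes "l > 0" "norm T = 1" "norm N = 1" "N \<bullet> T = 0"
  shows "norm (axis_vec l m T N) = 1"
proof -
  have c: "energy l m > 0" by (rule energy_pos[OF assms(1)])
  have "(l\<^sup>2 *\<^sub>R T + m *\<^sub>R N) \<bullet> (l\<^sup>2 *\<^sub>R T + m *\<^sub>R N) = (energy l m)\<^sup>2"
    unfolding energy_sq using assms
    by (simp add: inner_add_left inner_add_right norm_eq_1 inner_commute power2_eq_square power4_eq_xxxx)
  then have "axis_vec l m T N \<bullet> axis_vec l m T N = 1"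
    using c by (simp add: axis_vec_def power2_eq_square)
  then show ?thesis by (simp add: norm_eq_1)
qed

text \<open>The constants are functions of \<open>N\<close>, \<open>T\<close>, \<open>l\<close> and
  \<open>\<mu>\<close> at one point. Between charts \<open>N\<close> and \<open>l\<close> agree and
  \<open>T\<close> agrees up to a sign \<open>k\<close>; comparing the derivatives of
  \<open>l\<close> shows that \<open>\<mu>\<close> changes by the same sign.\<close>

lemma adapted_unique:
  assumes a1: "adapted W1 \<phi>1 c1 E1 B1" and a2: "adapted W2 \<phi>2 c2 E2 B2"
    and V: "open V" "u \<in> V" "V \<subseteq> W1" "\<psi> ` V \<subseteq> W2"
    and eq: "\<And>w. w \<in> V \<Longrightarrow> \<phi>2 (\<psi> w) = \<phi>1 w" and cont: "continuous_on V \<psi>"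
    and inj: "\<And>w. w \<in> V \<Longrightarrow> inj (FD \<phi>1 w)" "\<And>w. w \<in> V \<Longrightarrow> inj (FD \<phi>2 (\<psi> w))"
  shows "c1 = c2 \<and> (E1 = E2 \<and> B1 = B2 \<or> E1 = - E2)"
proof -
  obtain N1 T1 l1 m1 where r1: "rot_struct W1 \<phi>1 N1 T1 l1 m1"
    "\<And>u. u \<in> W1 \<Longrightarrow> energy (l1 u) (m1 u) = c1 \<and> axis_vec (l1 u) (m1 u) (T1 u) (N1 u) = E1 \<and>
       base_point (l1 u) (m1 u) (T1 u) (N1 u) (\<phi>1 u) = B1" using a1 unfolding adapted_def by blast
  obtain N2 T2 l2 m2 where r2: "rot_struct W2 \<phi>2 N2 T2 l2 m2"
    "\<And>u. u \<in> W2 \<Longrightarrow> energy (l2 u) (m2 u) = c2 \<and> axis_vec (l2 u) (m2 u) (T2 u) (N2 u) = E2 \<and>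
       base_point (l2 u) (m2 u) (T2 u) (N2 u) (\<phi>2 u) = B2" using a2 unfolding adapted_def by blast
  have s1: "shape_at \<phi>1 N1 (l1 w) (T1 w) w" and s2: "shape_at \<phi>2 N2 (l2 (\<psi> w)) (T2 (\<psi> w)) (\<psi> w)" if "w \<in> V" for w
    using rot_struct_shape_at[OF r1(1)] rot_struct_shape_at[OF r2(1)] V inj that by blast+
  obtain V' s where V': "open V'" "u \<in> V'" "V' \<subseteq> V" "\<bar>s\<bar> = (1::real)"
    and N12: "\<And>w. w \<in> V' \<Longrightarrow> N1 w = s *\<^sub>R N2 (\<psi> w)"
    and rng: "\<And>w. w \<in> V' \<Longrightarrow> T2 (\<psi> w) \<in> range (FD \<phi>1 w)"
    and op: "\<And>w a. w \<in> V' \<Longrightarrow> l1 w *\<^sub>R shape_op \<phi>1 w (T1 w) a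
       = (s * l2 (\<psi> w)) *\<^sub>R shape_op \<phi>1 w (T2 (\<psi> w)) a"
    using transition_shape[OF V(1,2) eq cont s1 s2] by blast
  have det: "s = 1 \<and> l1 w = l2 (\<psi> w) \<and> (T1 w = T2 (\<psi> w) \<or> T1 w = - T2 (\<psi> w))" if w': "w \<in> V'" for w
  proof -
    have w: "w \<in> V" "w \<in> W1" "\<psi> w \<in> W2" using w' V' V by auto
    have p: "l1 w > 0" "l2 (\<psi> w) > 0" using r1(1) r2(1) w unfolding rot_struct_def by blast+
    have n: "norm (T1 w) = 1" "norm (T2 (\<psi> w)) = 1" "T1 w \<in> range (FD \<phi>1 w)"
      using s1[OF w(1)] s2[OF w(1)] unfolding shape_at_def by blast+
    show ?thesis using shape_operator_determines[OF p V'(4) n rng[OF w'] op[OF w']] by blast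
  qed
  have u: "u \<in> V" "u \<in> W1" "\<psi> u \<in> W2" using V' V by auto
  obtain k :: real where k: "k = 1 \<or> k = -1" "T1 u = k *\<^sub>R T2 (\<psi> u)" using det[OF V'(2)] by force
  have Nu: "N1 u = N2 (\<psi> u)" using N12[OF V'(2)] det[OF V'(2)] by simp
  have lu: "l1 u = l2 (\<psi> u)" using det[OF V'(2)] by blast
  have mu: "m1 u = k * m2 (\<psi> u)"
  proof -
    obtain D where D: "(\<psi> has_derivative D) (at u)" "FD \<phi>1 u = FD \<phi>2 (\<psi> u) \<circ> D"
      using transition_has_derivative[where \<psi>=\<psi> and ?\<phi>1.0=\<phi>1 and ?\<phi>2.0=\<phi>2, OF V(1) u(1) eq cont, of "FD \<phi>1 u" "FD \<phi>2 (\<psi> u)"] s1[OF u(1)] s2[OF u(1)]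
      unfolding shape_at_def by blast
    have "((\<lambda>w. l2 (\<psi> w)) has_derivative (\<lambda>a. m2 (\<psi> u) * (T2 (\<psi> u) \<bullet> FD \<phi>2 (\<psi> u) (D a)))) (at u)"
      by (rule has_derivative_compose[OF D(1)]) (use r2(1) u in \<open>auto simp: rot_struct_def\<close>)
    then have "(l1 has_derivative (\<lambda>a. m2 (\<psi> u) * (T2 (\<psi> u) \<bullet> FD \<phi>2 (\<psi> u) (D a)))) (at u)"
      by (rule has_derivative_transform_within_open[OF _ V'(1,2)]) (use det in auto)
    moreover have "(l1 has_derivative (\<lambda>a. m1 u * (T1 u \<bullet> FD \<phi>1 u a))) (at u)"
      using r1(1) u unfolding rot_struct_def by blast
    ultimately have "(\<lambda>a. m1 u * (T1 u \<bullet> FD \<phi>1 u a)) = (\<lambda>a. m2 (\<psi> u) * (T2 (\<psi> u) \<bullet> FD \<phi>2 (\<psi> u) (D a)))"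
      by (metis has_derivative_unique)
    then have e: "m1 u * (T1 u \<bullet> FD \<phi>1 u a) = m2 (\<psi> u) * (T2 (\<psi> u) \<bullet> FD \<phi>1 u a)" for a
      unfolding D(2) comp_apply by (rule fun_cong)
    obtain a where a: "FD \<phi>1 u a = T1 u" using s1[OF u(1)] unfolding shape_at_def by (metis imageE)
    have "T2 (\<psi> u) \<bullet> T2 (\<psi> u) = 1" using s2[OF u(1)] unfolding shape_at_def norm_eq_1 by blast
    then show ?thesis using e[of a] k unfolding a by auto
  qed
  have kk: "k * k = 1" using k by auto
  have en: "energy (l1 u) (m1 u) = energy (l2 (\<psi> u)) (m2 (\<psi> u))"
    using kk unfolding lu mu energy_def by (simp add: power_mult_distrib power2_eq_square)
  then have c: "c1 = c2" using r1(2)[OF u(2)] r2(2)[OF u(3)] by simp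
  have ax: "axis_vec (l1 u) (m1 u) (T1 u) (N1 u) = k *\<^sub>R axis_vec (l2 (\<psi> u)) (m2 (\<psi> u)) (T2 (\<psi> u)) (N2 (\<psi> u))"
    unfolding axis_vec_def en unfolding lu mu k(2) Nu by (simp add: scaleR_add_right mult_ac)
  then have E: "E1 = k *\<^sub>R E2" using r1(2)[OF u(2)] r2(2)[OF u(3)] by simp
  show ?thesis
  proof (cases "k = 1")
    case True
    then have "B1 = B2" using r1(2)[OF u(2)] r2(2)[OF u(3)] eq[OF u(1)] lu mu k(2) Nu by (metis mult_1 scaleR_one)
    then show ?thesis using c E True by simp
  next
    case False
    then show ?thesis using c E k by simp
  qed
qed

section \<open>Zeros of the principal curvature\<close>

text \<open>Quantifying over every structure whose \<open>l'\<close> is \<open>l\<close> up to sign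
  covers whatever \<open>shape_field_rot_struct\<close> may produce around \<open>u\<close>; the
  energy \<open>c\<close> is thereby excluded there.\<close>

definition repels :: "(real^3) set \<Rightarrow> (real^3 \<Rightarrow> real^4) \<Rightarrow> (real^3 \<Rightarrow> real) \<Rightarrow> real \<Rightarrow> real^3 \<Rightarrow> bool" where
  "repels W \<phi> l c u \<longleftrightarrow> (\<forall>r N T l' \<mu>. \<forall>s::real. r > 0 \<longrightarrow> ball u r \<subseteq> W \<longrightarrow> rot_struct (ball u r) \<phi> N T l' \<mu> \<longrightarrow>
     \<bar>s\<bar> = 1 \<longrightarrow> (\<forall>w\<in>ball u r. l' w = s * l w) \<longrightarrow> energy (l' u) (\<mu> u) \<noteq> c)"

context immersed_patch
begin

text \<open>For a unit vector \<open>v\<close> with \<open>T \<bullet> D\<phi>(v) = 0\<close> one has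
  \<open>l D\<^sup>2l(v,v) = \<mu>\<^sup>2 |D\<phi>(v)|\<^sup>2 + l \<mu> T \<bullet> D\<^sup>2\<phi>(v,v)\<close>, so that \<open>\<mu>\<^sup>2\<close> is bounded by a multiple of \<open>|l|\<close> as long as
  \<open>|\<mu>| \<le> c\<close>, contradicting \<open>c\<^sup>2 = \<mu>\<^sup>2 + l\<^sup>4\<close> for small \<open>l\<close>.\<close>

lemma shape_zero_repels:
  assumes sh: "shape_field W \<phi> N l" and WU: "W \<subseteq> U" and u0: "u0 \<in> W" and l0: "l u0 = 0" and c: "c > 0"
  obtains \<delta> where "\<delta> > 0" "ball u0 \<delta> \<subseteq> W"
    "\<forall>u\<in>ball u0 \<delta>. repels W \<phi> l c u"
proof -
  have W: "open W" and Cl: "\<And>k. Ck k W l" using sh unfolding shape_field_def by blast+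
  have C\<phi>: "Ck k W \<phi>" for k by (rule Ck_subset[OF W WU Ck_\<phi>])
  obtain d where d: "d > 0" "cball u0 d \<subseteq> W" using W u0 open_contains_cball by blast
  \<comment> \<open>The unit vectors over a closed ball form a compact set, so
    \<open>norm (FD \<phi> u v)\<close> has a positive minimum \<open>m\<close> on it, and
    \<open>G\<close>, which collects the second derivatives of \<open>l\<close> and
    \<open>\<phi>\<close>, has a maximum.\<close>
  define S where "S = cball u0 d \<times> sphere (0::real^3) 1"
  have S: "compact S" unfolding S_def by (intro compact_Times compact_cball compact_sphere)
  have Sne: "S \<noteq> {}"
  proof -
    have "(u0, axis 1 1) \<in> S" using d by (simp add: S_def)
    then show ?thesis by blast
  qed
  have fstS: "fst ` S \<subseteq> W" using d by (auto simp: S_def)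
  have cpd: "continuous_on S (\<lambda>p. pd i f (fst p))" if "\<And>k. Ck k W f" for i and f :: "real^3 \<Rightarrow> 'x::real_normed_vector"
    by (rule continuous_on_compose2[OF Ck_continuous[of 0 W "pd i f"] continuous_on_fst[OF continuous_on_id] fstS])
       (use that[of "Suc 0"] in simp)
  have cpd2: "continuous_on S (\<lambda>p. pd i (pd j f) (fst p))" if "\<And>k. Ck k W f" for i j and f :: "real^3 \<Rightarrow> 'x::real_normed_vector"
    by (rule cpd) (use that[of "Suc k" for k] in simp)
  have csnd: "continuous_on S (\<lambda>p. snd p $ i)" for i by (intro continuous_intros)
  have "continuous_on S (\<lambda>p. norm (\<Sum>i\<in>UNIV. snd p $ i *\<^sub>R pd i \<phi> (fst p)))"
    by (intro continuous_intros cpd C\<phi> csnd)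
  then obtain p0 where p0: "p0 \<in> S" "\<And>p. p \<in> S \<Longrightarrow>
     norm (\<Sum>i\<in>UNIV. snd p0 $ i *\<^sub>R pd i \<phi> (fst p0)) \<le> norm (\<Sum>i\<in>UNIV. snd p $ i *\<^sub>R pd i \<phi> (fst p))"
    using continuous_attains_inf[OF S Sne] by blast
  define m where "m = norm (FD \<phi> (fst p0) (snd p0))"
  have FDpd: "FD \<phi> u v = (\<Sum>i\<in>UNIV. v $ i *\<^sub>R pd i \<phi> u)" if "u \<in> W" for u v
    using that WU by (intro frechet_derivative_pd differentiable_\<phi>) auto
  have p0W: "fst p0 \<in> W" "snd p0 \<noteq> 0" using p0(1) fstS by (auto simp: S_def)
  have m: "m > 0" unfolding m_def using p0W WU FD_eq_0_iff by auto
  have mle: "m \<le> norm (FD \<phi> u v)" if "u \<in> cball u0 d" "norm v = 1" for u v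
    using p0(2)[of "(u, v)"] that d FDpd[OF p0W(1)] FDpd[of u] unfolding m_def S_def by auto
  define G where "G p = \<bar>\<Sum>i\<in>UNIV. \<Sum>j\<in>UNIV. (snd p $ i * snd p $ j) *\<^sub>R pd i (pd j l) (fst p)\<bar>
     + c * norm (\<Sum>i\<in>UNIV. \<Sum>j\<in>UNIV. (snd p $ i * snd p $ j) *\<^sub>R pd i (pd j \<phi>) (fst p))" for p
  have "continuous_on S G"
    unfolding G_def by (intro continuous_intros cpd2 C\<phi> Cl csnd)
  then obtain p1 where p1: "p1 \<in> S" "\<And>p. p \<in> S \<Longrightarrow> G p \<le> G p1"
    using continuous_attains_sup[OF S Sne] by blast
  have key: "\<mu>\<^sup>2 * m\<^sup>2 \<le> \<bar>l u\<bar> * G p1 \<and> \<bar>l' u\<bar> = \<bar>l u\<bar>" if u: "u \<in> cball u0 d" and r: "r > 0" "ball u r \<subseteq> W" and rs: "rot_struct (ball u r) \<phi> N' T l' \<mu>f"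
    and s: "\<bar>s\<bar> = (1::real)" "\<And>w. w \<in> ball u r \<Longrightarrow> l' w = s * l w" and en: "energy (l' u) \<mu> = c" and \<mu>: "\<mu> = \<mu>f u"
    for u r N' T l' \<mu>f s \<mu>
  proof -
    have ub: "u \<in> ball u r" and uW: "u \<in> W" using r by auto
    note R = rs[unfolded rot_struct_def, rule_format]
    have ss: "s * s = 1" using s(1) by (auto simp: abs_if split: if_splits)
    obtain v where v: "norm v = 1" "T u \<bullet> FD \<phi> u v = 0"
    proof -
      define q where "q = (\<chi> i. T u \<bullet> pd i \<phi> u)"
      obtain y where y: "y \<noteq> 0" "orthogonal q y" using orthogonal_to_vector_exists[of q] by auto
      have "T u \<bullet> FD \<phi> u y = 0"
      proof -
        have "(\<Sum>i\<in>UNIV. q $ i * y $ i) = 0" using y(2) by (simp add: orthogonal_def inner_vec_def)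
        then show ?thesis unfolding FDpd[OF uW] by (simp add: inner_sum_right q_def mult.commute)
      qed
      moreover have "FD \<phi> u (y /\<^sub>R norm y) = FD \<phi> u y /\<^sub>R norm y"
        using linear_FD[of u] uW WU by (simp add: linear_cmul subset_iff)
      ultimately show ?thesis using that[of "y /\<^sub>R norm y"] y(1) by simp
    qed
    have dl: "FD l w a = s * (\<mu>f w * (T w \<bullet> FD \<phi> w a))" if w: "w \<in> ball u r" for w a
    proof -
      have "((\<lambda>w. s * l' w) has_derivative (\<lambda>a. s * (\<mu>f w * (T w \<bullet> FD \<phi> w a)))) (at w)"
        using R[OF w] by (intro has_derivative_mult_right) blast
      then have "(l has_derivative (\<lambda>a. s * (\<mu>f w * (T w \<bullet> FD \<phi> w a)))) (at w)"
        by (rule has_derivative_transform_within_open[OF _ open_ball w]) (simp add: s(2) ss mult.assoc[symmetric])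
      from fun_cong[OF frechet_derivative_at[OF this]] show ?thesis by simp
    qed
    define P where "P = FD (\<lambda>w. FD \<phi> w v) u v"
    define D where "D a = s * (\<mu>f u * (T u \<bullet> FD (\<lambda>w. FD \<phi> w v) u a + ((\<mu>f u / l' u) *\<^sub>R (FD \<phi> u a - (T u \<bullet> FD \<phi> u a) *\<^sub>R T u)
        + (2 * l' u * (T u \<bullet> FD \<phi> u a)) *\<^sub>R N' u) \<bullet> FD \<phi> u v) + (- 2 * l' u ^ 3 * (T u \<bullet> FD \<phi> u a)) * (T u \<bullet> FD \<phi> u v))" for a
    have "((\<lambda>w. s * (\<mu>f w * (T w \<bullet> FD \<phi> w v))) has_derivative D) (at u)"
      unfolding D_def[abs_def] using R[OF ub] uW WU
      by (intro has_derivative_mult_right has_derivative_mult has_derivative_inner has_derivative_FD) blast+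
    then have "((\<lambda>w. FD l w v) has_derivative D) (at u)"
      by (rule has_derivative_transform_within_open[OF _ open_ball ub]) (simp add: dl)
    \<comment> \<open>Since \<open>T u \<bullet> FD \<phi> u v = 0\<close>, the derivative of
      \<open>\<mu>f\<close> drops out; the quotient \<open>\<mu> / l'\<close> left over is the term
      that would blow up.\<close>
    from fun_cong[OF frechet_derivative_at[OF this], of v]
    have H: "FD (\<lambda>w. FD l w v) u v = s * (\<mu> * (T u \<bullet> P + (\<mu> / l' u) * (norm (FD \<phi> u v))\<^sup>2))"
      by (simp add: D_def v P_def \<mu> power2_norm_eq_inner)
    have lp: "l' u > 0" using R[OF ub] by blast
    have lu: "\<bar>l' u\<bar> = \<bar>l u\<bar>" using s ub by (simp add: abs_mult)
    have "\<mu>\<^sup>2 * (norm (FD \<phi> u v))\<^sup>2 = l' u * (s * FD (\<lambda>w. FD l w v) u v) - l' u * (\<mu> * (T u \<bullet> P))"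
    proof -
      have "s * (s * x) = x" for x using ss by (simp add: mult.assoc[symmetric])
      then have "s * FD (\<lambda>w. FD l w v) u v = \<mu> * (T u \<bullet> P + (\<mu> / l' u) * (norm (FD \<phi> u v))\<^sup>2)"
        unfolding H .
      then show ?thesis using lp by (simp add: field_simps power2_eq_square)
    qed
    also have "\<dots> \<le> \<bar>l' u\<bar> * \<bar>FD (\<lambda>w. FD l w v) u v\<bar> + \<bar>l' u\<bar> * (c * norm P)"
    proof -
      have "s * FD (\<lambda>w. FD l w v) u v \<le> \<bar>FD (\<lambda>w. FD l w v) u v\<bar>"
        using abs_ge_self[of "s * FD (\<lambda>w. FD l w v) u v"] s(1) by (simp add: abs_mult)
      moreover have "- (\<mu> * (T u \<bullet> P)) \<le> c * norm P"
      proof -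
        have "\<mu>\<^sup>2 \<le> c\<^sup>2" using energy_sq[of "l' u" \<mu>] en by simp
        then have "\<bar>\<mu>\<bar> \<le> c" using c abs_le_square_iff[of \<mu> c] by simp
        moreover have "\<bar>T u \<bullet> P\<bar> \<le> norm P" using Cauchy_Schwarz_ineq2[of "T u" P] R[OF ub] by simp
        ultimately have "\<bar>\<mu>\<bar> * \<bar>T u \<bullet> P\<bar> \<le> c * norm P" using c by (intro mult_mono) auto
        then show ?thesis by (simp add: abs_mult[symmetric])
      qed
      ultimately have "l' u * (s * FD (\<lambda>w. FD l w v) u v + - (\<mu> * (T u \<bullet> P))) \<le> l' u * (\<bar>FD (\<lambda>w. FD l w v) u v\<bar> + c * norm P)"
        using lp by (intro mult_left_mono add_mono) auto
      then show ?thesis using lp by (simp add: algebra_simps)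
    qed
    also have "\<dots> = \<bar>l u\<bar> * G (u, v)"
      unfolding G_def P_def lu fst_conv snd_conv second_derivative_pd[OF W C\<phi> uW] second_derivative_pd[OF W Cl uW]
      by (simp add: algebra_simps)
    also have "\<dots> \<le> \<bar>l u\<bar> * G p1"
      using p1(2)[of "(u, v)"] u v by (intro mult_left_mono) (auto simp: S_def)
    finally have "\<mu>\<^sup>2 * (norm (FD \<phi> u v))\<^sup>2 \<le> \<bar>l u\<bar> * G p1" .
    moreover have "m\<^sup>2 \<le> (norm (FD \<phi> u v))\<^sup>2" using mle[OF u v(1)] m by (intro power_mono) auto
    ultimately show ?thesis using lu mult_left_mono[of "m\<^sup>2" "(norm (FD \<phi> u v))\<^sup>2" "\<mu>\<^sup>2"] by auto
  qed
  \<comment> \<open>A structure of energy \<open>c\<close> at \<open>u\<close> would give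
    \<open>c\<^sup>2 * m\<^sup>2 \<le> h u\<close>, whereas \<open>h\<close> vanishes at the zero
    \<open>u0\<close> of \<open>l\<close>.\<close>
  define h where "h u = \<bar>l u\<bar> * G p1 + \<bar>l u\<bar> ^ 4 * m\<^sup>2" for u
  have "continuous_on W h" unfolding h_def using Ck_continuous[OF Cl] by (intro continuous_intros)
  from continuous_open_preimage[OF this W, of "{..< c\<^sup>2 * m\<^sup>2}"]
  have "open (W \<inter> h -` {..< c\<^sup>2 * m\<^sup>2})" by simp
  moreover have "u0 \<in> W \<inter> h -` {..< c\<^sup>2 * m\<^sup>2}" using u0 l0 c m by (simp add: h_def)
  ultimately obtain \<delta>0 where \<delta>0: "\<delta>0 > 0" "ball u0 \<delta>0 \<subseteq> W \<inter> h -` {..< c\<^sup>2 * m\<^sup>2}" using open_contains_ball by blast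
  show ?thesis
  proof (rule that[of "min d \<delta>0"])
    show "min d \<delta>0 > 0" "ball u0 (min d \<delta>0) \<subseteq> W" using d \<delta>0 by auto
    show "\<forall>u\<in>ball u0 (min d \<delta>0). repels W \<phi> l c u"
      unfolding repels_def
    proof (intro ballI allI impI)
      fix u r N' T l' \<mu> and s :: real
      assume u: "u \<in> ball u0 (min d \<delta>0)" and a: "r > 0" "ball u r \<subseteq> W" "rot_struct (ball u r) \<phi> N' T l' \<mu>"
        "\<bar>s\<bar> = 1" "\<forall>w\<in>ball u r. l' w = s * l w"
    show "energy (l' u) (\<mu> u) \<noteq> c"
    proof
      assume en: "energy (l' u) (\<mu> u) = c"
      have ud: "u \<in> cball u0 d" and hu: "h u < c\<^sup>2 * m\<^sup>2" using u \<delta>0 by (auto simp: subset_iff)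
      have k: "(\<mu> u)\<^sup>2 * m\<^sup>2 \<le> \<bar>l u\<bar> * G p1" "\<bar>l' u\<bar> = \<bar>l u\<bar>"
        using key[OF ud a(1-4) a(5)[rule_format] en refl] by auto
      have "c\<^sup>2 = (\<mu> u)\<^sup>2 + \<bar>l' u\<bar> ^ 4" using energy_sq[of "l' u" "\<mu> u"] en by simp
      then have "c\<^sup>2 * m\<^sup>2 \<le> h u" using k unfolding h_def by (simp add: distrib_right)
      then show False using hu by simp
    qed
    qed
  qed
qed

end

section \<open>Portions of the model\<close>

definition horiz :: "real^4 \<Rightarrow> real^3" where "horiz p = (\<chi> i. if i = 1 then p $ 1 else if i = 2 then p $ 2 else p $ 3)"

lemma horiz_nth: "horiz p $ 1 = p $ 1" "horiz p $ 2 = p $ 2" "horiz p $ 3 = p $ 3"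
  by (simp_all add: horiz_def)

lemma linear_horiz: "linear horiz"
  by (rule linearI) (simp_all add: vec_eq_iff forall_3 horiz_nth)

lemma norm_horiz_sq: "(norm (horiz p))\<^sup>2 = (p $ 1)\<^sup>2 + (p $ 2)\<^sup>2 + (p $ 3)\<^sup>2"
  unfolding power2_norm_eq_inner by (simp add: inner_vec_def sum_3 horiz_nth power2_eq_square)

lemma norm_horiz: "p $ 4 = 0 \<Longrightarrow> norm (horiz p) = norm p"
proof -
  assume "p $ 4 = 0"
  then have "(norm p)\<^sup>2 = (norm (horiz p))\<^sup>2"
    unfolding norm_horiz_sq unfolding power2_norm_eq_inner by (simp add: inner_vec_def sum_4 power2_eq_square)
  then show ?thesis by simp
qed

lemma horiz_cong: "horiz p = horiz q \<Longrightarrow> p $ 4 = q $ 4 \<Longrightarrow> p = q"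
  by (metis horiz_nth vec4_eq_iff)

text \<open>One chart for the whole regular part of the model: the direction from the axis is kept
  and the height becomes the polar radius, through \<open>exp\<close> because heights may be
  negative.\<close>

definition flatten :: "real^4 \<Rightarrow> real^3" where
  "flatten p = (exp (p $ 4) / norm (horiz p)) *\<^sub>R horiz p"

lemma norm_flatten: "horiz p \<noteq> 0 \<Longrightarrow> norm (flatten p) = exp (p $ 4)"
  by (simp add: flatten_def)

text \<open>The height determines the profile parameter, so \<open>flatten\<close> is injective on the regular part of the model.\<close>

lemma flatten_inj_model:
  assumes a: "a > 0" and p: "p \<in> model_image a" "horiz p \<noteq> 0" and q: "q \<in> model_image a" "horiz q \<noteq> 0"
    and eq: "flatten p = flatten q"
  shows "p = q"
proof -
  have "exp (p $ 4) = exp (q $ 4)" using norm_flatten p(2) q(2) eq by metis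
  then have 4: "p $ 4 = q $ 4" by simp
  obtain s t where st: "(norm (horiz p))\<^sup>2 = (1/a * lem_sd (a * s))\<^sup>2" "p $ 4 = height a s"
    "(norm (horiz q))\<^sup>2 = (1/a * lem_sd (a * t))\<^sup>2" "q $ 4 = height a t"
    using p(1) q(1) unfolding model_image_iff norm_horiz_sq by blast
  then have "s = t" using 4 height_inj[OF a, of s t] by simp
  then have "norm (horiz p) = norm (horiz q)" using st by (metis norm_ge_zero power2_eq_imp_eq)
  then have "horiz p = horiz q" using eq 4 p(2) q(2) unfolding flatten_def by simp
  then show ?thesis using 4 by (rule horiz_cong)
qed

lemma continuous_flatten: "continuous_on {p. horiz p \<noteq> 0} flatten"
  unfolding flatten_def
  by (intro continuous_intros linear_continuous_on linear_horiz linear_linear[THEN iffD1]) (auto simp: linear_horiz linear_conv_bounded_linear[symmetric])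

lemma open_horiz_nonzero: "open {p. horiz p \<noteq> 0}"
proof -
  have "continuous_on UNIV horiz" by (simp add: linear_continuous_on linear_horiz linear_conv_bounded_linear[symmetric])
  then have "open (horiz -` (- {0}))" by (intro open_vimage) (auto simp: open_Compl)
  then show ?thesis by (simp add: vimage_def)
qed

lemma openin_model_image:
  assumes a: "a > 0" and X: "X \<subseteq> model_image a" "\<And>p. p \<in> X \<Longrightarrow> horiz p \<noteq> 0" and op: "open (flatten ` X)"
  shows "openin (top_of_set (model_image a)) X"
proof -
  have "open ({p. horiz p \<noteq> 0} \<inter> flatten -` (flatten ` X))"
    by (rule continuous_open_preimage[OF continuous_flatten open_horiz_nonzero op])
  moreover have "X = model_image a \<inter> ({p. horiz p \<noteq> 0} \<inter> flatten -` (flatten ` X))"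
    using X flatten_inj_model[OF a] by blast
  ultimately show ?thesis by (metis openin_open_Int)
qed

lemma radial_vec_facts:
  assumes l: "l > 0" and T: "norm T = 1" "norm N = 1" "N \<bullet> T = 0"
  shows "radial_vec l m T N \<bullet> axis_vec l m T N = 0" "norm (radial_vec l m T N) = l / energy l m"
    "radial_vec l m T N \<bullet> radial_vec l m T N = (l / energy l m)\<^sup>2"
proof -
  have c: "energy l m > 0" by (rule energy_pos[OF l])
  have d: "T \<bullet> T = 1" "N \<bullet> N = 1" "T \<bullet> N = 0" using T by (auto simp: norm_eq_1 inner_commute)
  show "radial_vec l m T N \<bullet> axis_vec l m T N = 0"
    by (simp add: radial_vec_def axis_vec_def inner_diff_left inner_add_right d T(3))
  have "(m *\<^sub>R T - l\<^sup>2 *\<^sub>R N) \<bullet> (m *\<^sub>R T - l\<^sup>2 *\<^sub>R N) = (energy l m)\<^sup>2"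
    unfolding energy_sq by (simp add: inner_diff_left inner_diff_right d T(3) power2_eq_square power4_eq_xxxx)
  then show sq: "radial_vec l m T N \<bullet> radial_vec l m T N = (l / energy l m)\<^sup>2"
    using c by (simp add: radial_vec_def power2_eq_square)
  then show "norm (radial_vec l m T N) = l / energy l m"
    using c l by (simp add: norm_eq_sqrt_inner)
qed

text \<open>Composing the moved patch with \<open>flatten\<close> gives a map between open parts of
  \<open>real^3\<close>; its derivative is injective, so an open mapping theorem gives an open
  image, and openness is carried back to the model.\<close>

lemma adapted_image_openin:
  fixes O' :: "real^4 \<Rightarrow> real^4"
  assumes W: "open W" "convex W" and ad: "adapted W \<phi> c E B" and c: "c > 0"
    and inj: "\<And>u. u \<in> W \<Longrightarrow> inj (FD \<phi> u)"
    and O': "orthogonal_transformation O'" "O' E = axis 4 1"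
  shows "openin (top_of_set (model_image (sqrt (2 * c)))) ((\<lambda>p. O' (p - B)) ` \<phi> ` W)"
proof -
  obtain N T l \<mu> where rs: "rot_struct W \<phi> N T l \<mu>"
    and const: "\<And>u. u \<in> W \<Longrightarrow> energy (l u) (\<mu> u) = c" "\<And>u. u \<in> W \<Longrightarrow> axis_vec (l u) (\<mu> u) (T u) (N u) = E"
       "\<And>u. u \<in> W \<Longrightarrow> base_point (l u) (\<mu> u) (T u) (N u) (\<phi> u) = B"
    using ad unfolding adapted_def by blast
  interpret rot_patch W \<phi> N T l \<mu> using W rs by unfold_locales
  have linO: "linear O'" and inO: "O' p \<bullet> O' q = p \<bullet> q" for p q
    using O' unfolding orthogonal_transformation_def by blast+
  define a where "a = sqrt (2 * c)"
  have a: "a > 0" using c by (simp add: a_def)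
  define X where "X u = radial_vec (l u) (\<mu> u) (T u) (N u)" for u
  define z where "z u = profile_height (l u) (\<mu> u)" for u
  define \<Phi> where "\<Phi> u = O' (\<phi> u - B)" for u
  have NT: "N u \<bullet> T u = 0" if "u \<in> W" for u using rot_struct_NT[OF rs that] .
  have XE: "X u \<bullet> E = 0" and Xn: "norm (X u) = l u / c" and XX: "X u \<bullet> X u = (l u / c)\<^sup>2" if u: "u \<in> W" for u
    using radial_vec_facts[OF rotD(1)[OF u] rotD(3)[OF u] rotD(2)[OF u] NT[OF u], of "\<mu> u"] const(1,2)[OF u]
    unfolding X_def by simp_all
  have EE: "E \<bullet> E = 1" using inO[of E E] unfolding O'(2) by (simp add: inner_axis_axis)
  have perp4: "O' v $ 4 = 0" if "v \<bullet> E = 0" for v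
    using inO[of v E] that unfolding O'(2) by (simp add: inner_axis)
  have \<Phi>: "\<Phi> u = O' (X u) + z u *\<^sub>R axis 4 1" if u: "u \<in> W" for u
  proof -
    have "\<phi> u - B = X u + z u *\<^sub>R E"
      using const(3)[OF u] const(2)[OF u] unfolding base_point_def X_def z_def by (simp add: algebra_simps)
    then show ?thesis unfolding \<Phi>_def by (simp add: linear_add[OF linO] linear_cmul[OF linO] O'(2))
  qed
  have h\<Phi>: "horiz (\<Phi> u) = horiz (O' (X u))" and \<Phi>4: "\<Phi> u $ 4 = z u" if u: "u \<in> W" for u
    using perp4[OF XE[OF u]] unfolding \<Phi>[OF u]
    by (auto simp: vec_eq_iff forall_3 horiz_nth axis_def)
  have nh: "norm (horiz (O' (X u))) = l u / c" if u: "u \<in> W" for u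
    using norm_horiz[OF perp4[OF XE[OF u]]] Xn[OF u] O'(1) by (simp add: orthogonal_transformation_norm)
  have lc: "l u / c > 0" if "u \<in> W" for u using rotD(1)[OF that] c by simp
  have h0: "horiz (\<Phi> u) \<noteq> 0" if "u \<in> W" for u using h\<Phi>[OF that] nh[OF that] lc[OF that] by auto
  have inmodel: "\<Phi> u \<in> model_image a" if u: "u \<in> W" for u
  proof -
    have "(norm (horiz (\<Phi> u)))\<^sup>2 = (1/a * lem_sd (a * profile_time (l u) (\<mu> u)))\<^sup>2"
    proof -
      have "(lem_sd (a * profile_time (l u) (\<mu> u)))\<^sup>2 = 2 * (l u)\<^sup>2 / c"
        using profile_arccos(6)[OF rotD(1)[OF u], of "\<mu> u"] a const(1)[OF u]
        unfolding profile_time_def a_def by simp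
      then have "(1/a * lem_sd (a * profile_time (l u) (\<mu> u)))\<^sup>2 = (l u / c)\<^sup>2"
      proof -
        assume sd: "(lem_sd (a * profile_time (l u) (\<mu> u)))\<^sup>2 = 2 * (l u)\<^sup>2 / c"
        have a2: "a\<^sup>2 = 2 * c" using c by (simp add: a_def)
        show ?thesis unfolding power_mult_distrib power_divide sd a2 using c by (simp add: power2_eq_square)
      qed
      then show ?thesis using h\<Phi>[OF u] nh[OF u] by simp
    qed
    moreover have "\<Phi> u $ 4 = height a (profile_time (l u) (\<mu> u))"
      using \<Phi>4[OF u] const(1)[OF u] by (simp add: z_def profile_height_def a_def)
    ultimately show ?thesis unfolding model_image_iff norm_horiz_sq by blast
  qed
  \<comment> \<open>On the moved patch the horizontal norm is \<open>l u / c\<close>, so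
    \<open>flatten\<close> takes this form, in which no norm has to be differentiated.\<close>
  define g where "g u = (exp (z u) * (c / l u)) *\<^sub>R horiz (O' (X u))" for u
  have fg: "flatten (\<Phi> u) = g u" if u: "u \<in> W" for u
    unfolding flatten_def h\<Phi>[OF u] \<Phi>4[OF u] nh[OF u] g_def by simp
  define G' where "G' u v = (exp (z u) * (c / l u)) *\<^sub>R horiz (O' (FD \<phi> u v - ((l u)\<^sup>2 / c * th u v) *\<^sub>R E))
     + (exp (z u) * (l u - c * \<mu> u / (l u)\<^sup>2) * th u v) *\<^sub>R horiz (O' (X u))" for u v
  have dg: "(g has_derivative G' u) (at u)" if u: "u \<in> W" for u
  proof -
    have l: "l u > 0" using rotD(1)[OF u] .
    have bl: "bounded_linear (\<lambda>p. horiz (O' p))"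
      using linear_compose[OF linO linear_horiz] by (simp add: comp_def linear_conv_bounded_linear)
    have dX: "((\<lambda>u. horiz (O' (X u))) has_derivative (\<lambda>v. horiz (O' (FD \<phi> u v - ((l u)\<^sup>2 / c * th u v) *\<^sub>R E)))) (at u)"
      using bounded_linear.has_derivative[OF bl radial_vec_derivative[OF u]] const(1,2)[OF u] unfolding X_def by simp
    have dz: "(z has_derivative (\<lambda>v. (l u)\<^sup>2 / c * th u v)) (at u)"
      using profile_height_derivative[OF u] const(1)[OF u] unfolding z_def[abs_def] by simp
    have "((\<lambda>u. exp (z u) * (c / l u)) has_derivative (\<lambda>v. exp (z u) * (l u - c * \<mu> u / (l u)\<^sup>2) * th u v)) (at u)"
    proof (rule has_derivative_eq_rhs)
      show "((\<lambda>u. exp (z u) * (c / l u)) has_derivative (\<lambda>v. exp (z u) * ((0 * l u - c * (\<mu> u * th u v)) / (l u * l u))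
        + ((l u)\<^sup>2 / c * th u v * exp (z u)) * (c / l u))) (at u)"
        by (rule has_derivative_mult[OF DERIV_compose_FDERIV[OF DERIV_exp dz] has_derivative_divide'[OF has_derivative_const dl[OF u]]])
           (use l in simp)
    qed (use l c in \<open>auto simp: fun_eq_iff field_simps power2_eq_square\<close>)
    from has_derivative_scaleR[OF this dX]
    show ?thesis unfolding g_def[abs_def] G'_def[abs_def] .
  qed
  have injG: "inj (G' u)" if u: "u \<in> W" for u
  proof -
    have l: "l u > 0" using rotD(1)[OF u] .
    have lin: "linear (G' u)" using dg[OF u] has_derivative_linear by blast
    have "v = 0" if v: "G' u v = 0" for v
    proof -
      define k where "k = exp (z u) * (l u - c * \<mu> u / (l u)\<^sup>2) * th u v"
      define X' where "X' = FD \<phi> u v - ((l u)\<^sup>2 / c * th u v) *\<^sub>R E"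
      define y where "y = (exp (z u) * (c / l u)) *\<^sub>R X' + k *\<^sub>R X u"
      have Ev: "E \<bullet> FD \<phi> u v = (l u)\<^sup>2 / c * th u v"
        unfolding const(2)[OF u, symmetric] axis_vec_def const(1)[OF u] by (simp add: inner_add_left rotD(5)[OF u])
      have X'E: "X' \<bullet> E = 0" using EE Ev unfolding X'_def by (subst inner_commute) (simp add: inner_diff_right)
      have yE: "y \<bullet> E = 0" using X'E XE[OF u] by (simp add: y_def inner_add_left)
      have "horiz (O' y) = 0"
        using v unfolding G'_def k_def[symmetric] X'_def[symmetric] y_def
        by (simp add: linear_add[OF linO] linear_cmul[OF linO] linear_add[OF linear_horiz] linear_cmul[OF linear_horiz])
      then have "norm (O' y) = 0" using norm_horiz[OF perp4[OF yE]] by simp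
      then have y0: "y = 0" using O'(1) by (simp add: orthogonal_transformation_norm)
      have XX': "X u \<bullet> X' = l u * \<mu> u / c\<^sup>2 * th u v"
      proof -
        have "X u \<bullet> X' = X u \<bullet> FD \<phi> u v" using XE[OF u] unfolding X'_def by (simp add: inner_diff_right)
        then show ?thesis unfolding X_def radial_vec_def const(1)[OF u] by (simp add: inner_diff_left rotD(5)[OF u])
      qed
      \<comment> \<open>In the pairing with \<open>X u\<close> the terms in \<open>\<mu>\<close>
        cancel and the nonzero factor \<open>l^3 / c^2\<close> remains. So a kernel vector has
        \<open>th u v = 0\<close>, after which \<open>y\<close> is a nonzero multiple of
        \<open>FD \<phi> u v\<close>.\<close>
      have "X u \<bullet> y = exp (z u) * th u v * ((c / l u) * (l u * \<mu> u / c\<^sup>2) + (l u - c * \<mu> u / (l u)\<^sup>2) * (l u / c)\<^sup>2)"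
        unfolding y_def k_def by (simp add: inner_add_right XX' XX[OF u] algebra_simps)
      also have "(c / l u) * (l u * \<mu> u / c\<^sup>2) + (l u - c * \<mu> u / (l u)\<^sup>2) * (l u / c)\<^sup>2 = (l u) ^ 3 / c\<^sup>2"
        using l c by (simp add: field_simps power2_eq_square power3_eq_cube)
      finally have "th u v = 0" using y0 l c by simp
      then have "X' = FD \<phi> u v" "k = 0" by (simp_all add: X'_def k_def)
      then have "FD \<phi> u v = 0" using y0 l c by (simp add: y_def)
      then show "v = 0"
        using inj[OF u] linear_injective_0[of "FD \<phi> u"] has_derivative_linear[OF d\<phi>[OF u]] by blast
    qed
    then show ?thesis using linear_injective_0[OF lin] by blast
  qed
  have "g u \<in> interior (g ` W)" if u: "u \<in> W" for u
  proof -
    have lin: "linear (G' u)" using dg[OF u] has_derivative_linear by blast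
    obtain K where K: "linear K" "\<forall>x. K (G' u x) = x" "\<forall>x. G' u (K x) = x"
      using linear_injective_isomorphism[OF lin injG[OF u]] by auto
    have cg: "continuous_on W g"
      using dg by (meson continuous_at_imp_continuous_on has_derivative_continuous)
    show ?thesis
      by (rule sussmann_open_mapping[OF W(1) cg u dg[OF u], of K])
         (use K W u in \<open>auto simp: linear_conv_bounded_linear fun_eq_iff interior_open\<close>)
  qed
  then have "g ` W \<subseteq> interior (g ` W)" by blast
  then have "open (g ` W)" by (metis interior_subset open_interior subset_antisym)
  moreover have "flatten ` \<Phi> ` W = g ` W" using fg by (auto simp: image_iff)
  ultimately have "openin (top_of_set (model_image a)) (\<Phi> ` W)"
    using inmodel h0 by (intro openin_model_image[OF a]) auto
  moreover have "\<Phi> ` W = (\<lambda>p. O' (p - B)) ` \<phi> ` W" by (auto simp: \<Phi>_def)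
  ultimately show ?thesis by (simp add: a_def)
qed

section \<open>Globalization\<close>

lemma local_paramD:
  assumes "local_param M \<iota> U x"
  shows "open U" "homeomorphic_map (top_of_set U) (subtopology M (x ` U)) x" "openin M (x ` U)"
    "smooth_on U (\<iota> \<circ> x)" "\<And>u. u \<in> U \<Longrightarrow> inj (FD (\<iota> \<circ> x) u)"
  using assms unfolding local_param_def embedding_map_def by auto

lemma local_param_immersed_patch: "local_param M \<iota> U x \<Longrightarrow> immersed_patch U (\<iota> \<circ> x)"
  by unfold_locales (auto dest: local_paramD(4,5))

lemma local_param_ideal_patch:
  assumes lp: "local_param M \<iota> U x" and "casorati_ideal M \<iota>"
  shows "ideal_patch U (\<iota> \<circ> x)"
  by (intro ideal_patch.intro local_param_immersed_patch[OF lp], unfold_locales)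
     (use assms in \<open>auto simp: casorati_ideal_def\<close>)

lemma chart_image_open:
  assumes lp: "local_param M \<iota> U x" and W: "open W" "W \<subseteq> U"
  shows "openin M (x ` W)"
proof -
  have "openin (top_of_set U) W" using W openin_open_eq local_paramD(1)[OF lp] by blast
  then have "openin (subtopology M (x ` U)) (x ` W)"
    using homeomorphic_imp_open_map[OF local_paramD(2)[OF lp]] unfolding open_map_def by blast
  then show ?thesis using openin_open_subtopology[OF local_paramD(3)[OF lp]] by blast
qed

text \<open>The topology of \<open>M\<close> supplies only a continuous transition map; its
  derivative comes from \<open>transition_has_derivative\<close>. The subsets \<open>W1\<close> and
  \<open>W2\<close> are the patches carrying the structures to be compared.\<close>

lemma chart_transition:
  assumes l1: "local_param M \<iota> U1 x1" and l2: "local_param M \<iota> U2 x2"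
    and W1: "open W1" "W1 \<subseteq> U1" "u1 \<in> W1" and W2: "open W2" "W2 \<subseteq> U2" "u2 \<in> W2" and eq: "x1 u1 = x2 u2"
  obtains V \<psi> where "open V" "u1 \<in> V" "V \<subseteq> W1" "\<psi> ` V \<subseteq> W2" "continuous_on V \<psi>"
    "\<And>w. w \<in> V \<Longrightarrow> x2 (\<psi> w) = x1 w"
proof -
  obtain g where g: "homeomorphic_maps (top_of_set U2) (subtopology M (x2 ` U2)) x2 g"
    using local_paramD(2)[OF l2] homeomorphic_map_maps by blast
  then have cg: "continuous_map (subtopology M (x2 ` U2)) (top_of_set U2) g" and gx: "\<And>u. u \<in> U2 \<Longrightarrow> g (x2 u) = u"
    unfolding homeomorphic_maps_def by auto
  have "continuous_map (top_of_set U1) (subtopology M (x1 ` U1)) x1"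
    using local_paramD(2)[OF l1] homeomorphic_imp_continuous_map by blast
  then have c1: "continuous_map (top_of_set U1) M x1" by (simp add: continuous_map_in_subtopology)
  define V where "V = {w \<in> W1. x1 w \<in> x2 ` W2}"
  have "openin (top_of_set U1) W1" using W1 openin_open_eq local_paramD(1)[OF l1] by blast
  then have "openin (top_of_set U1) V"
    unfolding V_def by (rule openin_continuous_map_preimage_gen[OF c1 _ chart_image_open[OF l2 W2(1,2)]])
  then have oV: "open V" using openin_open_eq local_paramD(1)[OF l1] by blast
  define \<psi> where "\<psi> = g \<circ> x1"
  have VU: "V \<subseteq> U1" using W1 by (auto simp: V_def)
  have "continuous_map (top_of_set V) M x1"
    using continuous_map_from_subtopology[OF c1, of V] VU by (simp add: subtopology_subtopology inf.absorb2)
  then have "continuous_map (top_of_set V) (subtopology M (x2 ` U2)) x1"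
    using W2(2) by (auto simp: continuous_map_in_subtopology V_def)
  from continuous_map_compose[OF this cg]
  have "continuous_map (top_of_set V) (top_of_set U2) \<psi>" unfolding \<psi>_def .
  then have c\<psi>: "continuous_on V \<psi>" by (simp add: continuous_map_in_subtopology)
  have \<psi>: "\<psi> w \<in> W2 \<and> x2 (\<psi> w) = x1 w" if w: "w \<in> V" for w
  proof -
    obtain y where y: "y \<in> W2" "x1 w = x2 y" using w by (auto simp: V_def)
    then have "\<psi> w = y" using gx W2(2) by (auto simp: \<psi>_def)
    then show ?thesis using y by simp
  qed
  show ?thesis
    by (rule that[OF oV _ _ _ c\<psi>]) (use \<psi> W1 W2 eq in \<open>auto simp: V_def\<close>)
qed

section \<open>The points with prescribed congruence data\<close>

text \<open>Membership asks for one chart around the point, so the sign of \<open>T\<close> may be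
  chosen chart by chart.\<close>

definition model_points :: "'a topology \<Rightarrow> ('a \<Rightarrow> real^4) \<Rightarrow> real \<Rightarrow> real^4 \<Rightarrow> real^4 \<Rightarrow> 'a set" where
  "model_points M \<iota> c E B = {p. \<exists>U x u r. local_param M \<iota> U x \<and> ball u r \<subseteq> U \<and> p \<in> x ` ball u r \<and>
     adapted (ball u r) (\<iota> \<circ> x) c E B}"

lemma model_pointsI:
  assumes "local_param M \<iota> U x" "ball u r \<subseteq> U" "adapted (ball u r) (\<iota> \<circ> x) c E B"
  shows "x ` ball u r \<subseteq> model_points M \<iota> c E B"
  unfolding model_points_def by (rule subsetI, rule CollectI, intro exI conjI) (rule assms | assumption)+

lemma openin_model_points: "openin M (model_points M \<iota> c E B)"
proof (subst openin_subopen, rule ballI)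
  fix p assume "p \<in> model_points M \<iota> c E B"
  then obtain U x u r where *: "local_param M \<iota> U x" "ball u r \<subseteq> U" "p \<in> x ` ball u r"
     "adapted (ball u r) (\<iota> \<circ> x) c E B" unfolding model_points_def by blast
  show "\<exists>T. openin M T \<and> p \<in> T \<and> T \<subseteq> model_points M \<iota> c E B"
    by (intro exI[of _ "x ` ball u r"] conjI chart_image_open[OF *(1) open_ball *(2)] *(3) model_pointsI[OF *(1,2,4)])
qed

lemma model_points_unique:
  assumes p1: "p \<in> model_points M \<iota> c1 E1 B1" and p2: "p \<in> model_points M \<iota> c2 E2 B2"
  shows "c1 = c2 \<and> (E1 = E2 \<and> B1 = B2 \<or> E1 = - E2)"
proof -
  obtain U1 x1 v1 r1 where 1: "local_param M \<iota> U1 x1" "ball v1 r1 \<subseteq> U1" "p \<in> x1 ` ball v1 r1"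
     "adapted (ball v1 r1) (\<iota> \<circ> x1) c1 E1 B1" using p1 unfolding model_points_def by blast
  obtain U2 x2 v2 r2 where 2: "local_param M \<iota> U2 x2" "ball v2 r2 \<subseteq> U2" "p \<in> x2 ` ball v2 r2"
     "adapted (ball v2 r2) (\<iota> \<circ> x2) c2 E2 B2" using p2 unfolding model_points_def by blast
  obtain u1 u2 where u: "u1 \<in> ball v1 r1" "u2 \<in> ball v2 r2" "x1 u1 = x2 u2" using 1(3) 2(3) by blast
  obtain V \<psi> where V: "open V" "u1 \<in> V" "V \<subseteq> ball v1 r1" "\<psi> ` V \<subseteq> ball v2 r2" "continuous_on V \<psi>"
    "\<And>w. w \<in> V \<Longrightarrow> x2 (\<psi> w) = x1 w"
    using chart_transition[OF 1(1) 2(1) open_ball 1(2) u(1) open_ball 2(2) u(2,3)] by blast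
  show ?thesis
  proof (rule adapted_unique[OF 1(4) 2(4) V(1-4)])
    show "(\<iota> \<circ> x2) (\<psi> w) = (\<iota> \<circ> x1) w" if "w \<in> V" for w using V(6)[OF that] by simp
    show "continuous_on V \<psi>" by (rule V(5))
    show "inj (FD (\<iota> \<circ> x1) w)" if "w \<in> V" for w using local_paramD(5)[OF 1(1)] that V 1(2) by blast
    show "inj (FD (\<iota> \<circ> x2) (\<psi> w))" if "w \<in> V" for w using local_paramD(5)[OF 2(1)] that V 2(2) by blast
  qed
qed

text \<open>The axis direction is only determined up to sign, since \<open>T\<close> is; both signs occur at every point,
  with unrelated base points.\<close>

lemma rot_struct_model_points:
  assumes lp: "local_param M \<iota> U x" and r: "r > 0" "ball u r \<subseteq> U" and rs: "rot_struct (ball u r) (\<iota> \<circ> x) N T l \<mu>"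
  obtains E B B' where "x u \<in> model_points M \<iota> (energy (l u) (\<mu> u)) E B" "x u \<in> model_points M \<iota> (energy (l u) (\<mu> u)) (- E) B'"
proof -
  have ub: "u \<in> ball u r" using r by simp
  have adI: "\<exists>B. adapted (ball u r) (\<iota> \<circ> x) (energy (l u) (\<mu> u)) (axis_vec (l u) (\<mu> u) (T u) (N u)) B"
    if "rot_struct (ball u r) (\<iota> \<circ> x) N T l \<mu>" for N T l \<mu>
  proof -
    interpret rot_patch "ball u r" "\<iota> \<circ> x" N T l \<mu> using that by unfold_locales auto
    show ?thesis unfolding adapted_def
      using that energy_constant[OF _ ub] axis_vec_constant[OF _ ub] base_point_constant[OF _ ub] by blast
  qed
  have mp: "x u \<in> model_points M \<iota> c E B" if "adapted (ball u r) (\<iota> \<circ> x) c E B" for c E B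
    unfolding model_points_def using that lp r ub by blast
  have ax: "axis_vec (l u) (- \<mu> u) (- T u) (N u) = - axis_vec (l u) (\<mu> u) (T u) (N u)"
    and en: "energy (l u) (- \<mu> u) = energy (l u) (\<mu> u)"
    by (simp_all add: axis_vec_def energy_def scaleR_diff_right scaleR_add_right)
  obtain B where B: "adapted (ball u r) (\<iota> \<circ> x) (energy (l u) (\<mu> u)) (axis_vec (l u) (\<mu> u) (T u) (N u)) B"
    using adI[OF rs] by blast
  obtain B' where "adapted (ball u r) (\<iota> \<circ> x) (energy (l u) (\<mu> u)) (- axis_vec (l u) (\<mu> u) (T u) (N u)) B'"
    using adI[OF rot_struct_flip[OF rs]] unfolding ax en by blast
  then show ?thesis using that mp B by blast
qed

lemma norm_axis_model_points:
  assumes "p \<in> model_points M \<iota> c E B" shows "norm E = 1" "c > 0"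
proof -
  obtain U x u r where *: "local_param M \<iota> U x" "ball u r \<subseteq> U" "p \<in> x ` ball u r"
     "adapted (ball u r) (\<iota> \<circ> x) c E B" using assms unfolding model_points_def by blast
  then obtain N T l \<mu> where rs: "rot_struct (ball u r) (\<iota> \<circ> x) N T l \<mu>"
    and const: "\<And>u'. u' \<in> ball u r \<Longrightarrow> energy (l u') (\<mu> u') = c \<and> axis_vec (l u') (\<mu> u') (T u') (N u') = E"
    unfolding adapted_def by blast
  obtain w where w: "w \<in> ball u r" using *(3) by blast
  note R = rs[unfolded rot_struct_def, rule_format, OF w]
  show "norm E = 1" "c > 0"
    using norm_axis_vec[of "l w" "T w" "N w" "\<mu> w"] energy_pos[of "l w" "\<mu> w"] R const[OF w] rot_struct_NT[OF rs w] by auto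
qed

text \<open>Where \<open>l\<close> is nonzero, a limit point has constants of its own on an open
  set, and a nearby point of the given set identifies the two. Where \<open>l\<close> vanishes,
  \<open>shape_zero_repels\<close> keeps all points of energy \<open>c\<close> away.\<close>

lemma closedin_model_points:
  assumes hyp: "hypersurface M \<iota>" and ideal: "casorati_ideal M \<iota>" and c: "c > 0"
  shows "closedin M (model_points M \<iota> c E B)"
proof -
  have "M closure_of (model_points M \<iota> c E B) \<subseteq> model_points M \<iota> c E B"
  proof
    fix p assume "p \<in> M closure_of (model_points M \<iota> c E B)"
    then have pM: "p \<in> topspace M" and near: "\<And>T. p \<in> T \<Longrightarrow> openin M T \<Longrightarrow> \<exists>q. q \<in> model_points M \<iota> c E B \<and> q \<in> T"
      unfolding in_closure_of by blast+
    obtain U x u0 where lp: "local_param M \<iota> U x" and u0: "u0 \<in> U" "p = x u0"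
      using hyp pM unfolding hypersurface_def by blast
    interpret ideal_patch U "\<iota> \<circ> x" by (rule local_param_ideal_patch[OF lp ideal])
    obtain W N l where W: "u0 \<in> W" "W \<subseteq> U" "shape_field W (\<iota> \<circ> x) N l"
      and "\<forall>u\<in>W. l u = 0 \<longrightarrow> (\<forall>a b. second_fundamental_form (\<iota> \<circ> x) u a b = 0)"
      by (rule shape_field_exists[OF u0(1)])
    have oW: "open W" using W(3) unfolding shape_field_def by blast
    show "p \<in> model_points M \<iota> c E B"
    proof (cases "l u0 = 0")
      case False
      obtain r s N' T l' \<mu> where rs: "r > 0" "ball u0 r \<subseteq> W" "rot_struct (ball u0 r) (\<iota> \<circ> x) N' T l' \<mu>" "\<bar>s\<bar> = (1::real)" "\<forall>u\<in>ball u0 r. l' u = s * l u"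
        by (rule shape_field_rot_struct[OF W(3,2,1) False])
      obtain E' B1 B2 where mp0: "x u0 \<in> model_points M \<iota> (energy (l' u0) (\<mu> u0)) E' B1"
        "x u0 \<in> model_points M \<iota> (energy (l' u0) (\<mu> u0)) (- E') B2"
        by (rule rot_struct_model_points[OF lp rs(1) subset_trans[OF rs(2) W(2)] rs(3)])
      define c' where "c' = energy (l' u0) (\<mu> u0)"
      note mp = mp0[folded u0(2) c'_def]
      \<comment> \<open>The point \<open>q\<close> is taken in the sets of both axis signs:
        agreement up to sign alone would match \<open>E\<close> without determining the base
        point.\<close>
      obtain q where q: "q \<in> model_points M \<iota> c E B" "q \<in> model_points M \<iota> c' E' B1" "q \<in> model_points M \<iota> c' (- E') B2"
        using near[of "model_points M \<iota> c' E' B1 \<inter> model_points M \<iota> c' (- E') B2", OF IntI[OF mp] openin_Int[OF openin_model_points openin_model_points]] by auto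
      from model_points_unique[OF q(1,2)] model_points_unique[OF q(1,3)] norm_axis_model_points[OF q(1)]
      have "c = c'" "E = E' \<and> B = B1 \<or> E = - E' \<and> (B = B2 \<or> E = E')" by auto
      moreover have "E \<noteq> - E"
      proof
        assume "E = - E"
        then have "2 *\<^sub>R E = 0" by (simp add: scaleR_2 eq_neg_iff_add_eq_0)
        then show False using norm_axis_model_points(1)[OF q(1)] by simp
      qed
      ultimately show ?thesis using mp by auto
    next
      case True
      obtain \<delta> where \<delta>: "\<delta> > 0" "ball u0 \<delta> \<subseteq> W"
        and rep: "\<forall>u\<in>ball u0 \<delta>. repels W (\<iota> \<circ> x) l c u"
        by (rule shape_zero_repels[OF W(3,2,1) True c])
      have "openin M (x ` ball u0 \<delta>)" using chart_image_open[OF lp open_ball] \<delta>(2) W(2) by blast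
      then obtain q u where q: "q \<in> model_points M \<iota> c E B" "u \<in> ball u0 \<delta>" "q = x u"
        using near[of "x ` ball u0 \<delta>"] \<delta>(1) u0(2) by auto
      have uW: "u \<in> W" using q(2) \<delta>(2) by blast
      \<comment> \<open>Membership of \<open>q\<close> is witnessed in another chart. Comparing
        shape operators carries the nonvanishing over to \<open>l\<close> in the present chart,
        where a structure around \<open>u\<close> can then be built.\<close>
      have "l u \<noteq> 0"
      proof
        assume l0: "l u = 0"
        obtain U2 x2 v2 r2 where 2: "local_param M \<iota> U2 x2" "ball v2 r2 \<subseteq> U2" "q \<in> x2 ` ball v2 r2"
           "adapted (ball v2 r2) (\<iota> \<circ> x2) c E B" using q(1) unfolding model_points_def by blast
        then obtain N2 T2 l2 m2 where r2: "rot_struct (ball v2 r2) (\<iota> \<circ> x2) N2 T2 l2 m2" unfolding adapted_def by blast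
        obtain u2 where u2: "u2 \<in> ball v2 r2" "x u = x2 u2" using 2(3) unfolding q(3) by (rule imageE)
        obtain V \<psi> where V: "open V" "u \<in> V" "V \<subseteq> W" "\<psi> ` V \<subseteq> ball v2 r2" "continuous_on V \<psi>"
          "\<And>w. w \<in> V \<Longrightarrow> x2 (\<psi> w) = x w"
          using chart_transition[OF lp 2(1) oW W(2) uW open_ball 2(2) u2] by blast
        have "\<forall>w\<in>W. \<exists>T. shape_at (\<iota> \<circ> x) N (l w) T w"
        proof
          fix w assume w: "w \<in> W"
          have wU: "w \<in> U" using w W(2) by blast
          obtain T where T: "norm (N w) = 1" "\<And>a. N w \<bullet> FD (\<iota> \<circ> x) w a = 0" "norm T = 1" "T \<in> range (FD (\<iota> \<circ> x) w)"
            "\<And>a. FD N w a = - l w *\<^sub>R shape_op (\<iota> \<circ> x) w T a"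
            using W(3) w unfolding shape_field_def by blast
          have "Ck (Suc 0) W N" using W(3) unfolding shape_field_def by blast
          then have "(N has_derivative FD N w) (at w)" by (intro diff_on_open_has_derivative[OF oW _ w]) simp
          then have "(N has_derivative (\<lambda>a. - l w *\<^sub>R shape_op (\<iota> \<circ> x) w T a)) (at w)"
            unfolding T(5)[abs_def] .
          then show "\<exists>T. shape_at (\<iota> \<circ> x) N (l w) T w"
            unfolding shape_at_def using T has_derivative_\<phi>[OF wU] immersion[OF wU] by blast
        qed
        then obtain T where T: "\<And>w. w \<in> W \<Longrightarrow> shape_at (\<iota> \<circ> x) N (l w) (T w) w" by metis
        have tr: "(\<iota> \<circ> x2) (\<psi> w) = (\<iota> \<circ> x) w" if "w \<in> V" for w using V(6)[OF that] by simp
        have s1: "shape_at (\<iota> \<circ> x) N (l w) (T w) w" if "w \<in> V" for w using T V(3) that by blast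
        have s2: "shape_at (\<iota> \<circ> x2) N2 (l2 (\<psi> w)) (T2 (\<psi> w)) (\<psi> w)" if "w \<in> V" for w
          using rot_struct_shape_at[OF r2] V(4) local_paramD(5)[OF 2(1)] 2(2) that by blast
        obtain V' s where V': "open V'" "u \<in> V'" "V' \<subseteq> V" "\<bar>s\<bar> = (1::real)"
          and "\<And>w. w \<in> V' \<Longrightarrow> N w = s *\<^sub>R N2 (\<psi> w)"
          and rng: "\<And>w. w \<in> V' \<Longrightarrow> T2 (\<psi> w) \<in> range (FD (\<iota> \<circ> x) w)"
          and op: "\<And>w a. w \<in> V' \<Longrightarrow> l w *\<^sub>R (shape_op (\<iota> \<circ> x) w (T w) a)
            = (s * l2 (\<psi> w)) *\<^sub>R (shape_op (\<iota> \<circ> x) w (T2 (\<psi> w)) a)"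
          using transition_shape[OF V(1,2) tr V(5) s1 s2] by blast
        obtain a where a: "FD (\<iota> \<circ> x) u a = T2 (\<psi> u)" using rng[OF V'(2)] by (metis imageE)
        have uV: "u \<in> V" "\<psi> u \<in> ball v2 r2" using V' V by auto
        have t: "T2 (\<psi> u) \<bullet> T2 (\<psi> u) = 1" "l2 (\<psi> u) > 0"
          using r2 uV(2) unfolding rot_struct_def norm_eq_1 by blast+
        have "(s * l2 (\<psi> u)) *\<^sub>R (T2 (\<psi> u) + T2 (\<psi> u)) = 0" using op[OF V'(2), of a] l0 unfolding a t(1) by simp
        moreover have "T2 (\<psi> u) + T2 (\<psi> u) \<noteq> 0"
        proof
          assume "T2 (\<psi> u) + T2 (\<psi> u) = 0"
          then have "(T2 (\<psi> u) + T2 (\<psi> u)) \<bullet> T2 (\<psi> u) = 0" by simp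
          then show False unfolding inner_add_left t(1) by simp
        qed
        ultimately show False using V'(4) t(2) by auto
      qed
      then obtain r s N' T l' \<mu> where rs: "r > 0" "ball u r \<subseteq> W" "rot_struct (ball u r) (\<iota> \<circ> x) N' T l' \<mu>"
        "\<bar>s\<bar> = (1::real)" "\<forall>w\<in>ball u r. l' w = s * l w"
        by (rule shape_field_rot_struct[OF W(3,2) uW])
      obtain E' B1 where "q \<in> model_points M \<iota> (energy (l' u) (\<mu> u)) E' B1"
        unfolding q(3) by (rule rot_struct_model_points[OF lp rs(1) subset_trans[OF rs(2) W(2)] rs(3)])
      then have "energy (l' u) (\<mu> u) = c" using model_points_unique[OF q(1)] by metis
      then show ?thesis using bspec[OF rep q(2)] rs unfolding repels_def by blast
    qed
  qed
  moreover have "model_points M \<iota> c E B \<subseteq> topspace M" using openin_model_points by (rule openin_subset)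
  ultimately show ?thesis using closure_of_subset_eq by metis
qed

lemma model_points_nonempty:
  assumes ideal: "casorati_ideal M \<iota>" and ntg: "\<not> totally_geodesic M \<iota>"
  obtains p c E B where "p \<in> model_points M \<iota> c E B"
proof -
  obtain U x u0 a b where lp: "local_param M \<iota> U x" and u0: "u0 \<in> U" and nz: "second_fundamental_form (\<iota> \<circ> x) u0 a b \<noteq> 0"
    using ntg unfolding totally_geodesic_def by blast
  interpret ideal_patch U "\<iota> \<circ> x" by (rule local_param_ideal_patch[OF lp ideal])
  obtain W N l where W: "u0 \<in> W" "W \<subseteq> U" "shape_field W (\<iota> \<circ> x) N l"
    and z: "\<forall>u\<in>W. l u = 0 \<longrightarrow> (\<forall>a b. second_fundamental_form (\<iota> \<circ> x) u a b = 0)"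
    by (rule shape_field_exists[OF u0])
  have "l u0 \<noteq> 0" using z W(1) nz by blast
  then obtain r s N' T l' \<mu> where rs: "r > 0" "ball u0 r \<subseteq> W" "rot_struct (ball u0 r) (\<iota> \<circ> x) N' T l' \<mu>" "\<bar>s\<bar> = (1::real)" "\<forall>u\<in>ball u0 r. l' u = s * l u"
    by (rule shape_field_rot_struct[OF W(3,2,1)])
  show ?thesis by (rule rot_struct_model_points[OF lp rs(1) subset_trans[OF rs(2) W(2)] rs(3)]) (rule that)
qed

theorem theorem5p4:
  fixes M :: "'a topology" and \<iota> :: "'a \<Rightarrow> real^4"
  assumes "hypersurface M \<iota>"
    and "connected_space M"
    and "\<not> totally_geodesic M \<iota>"
    and "casorati_ideal M \<iota>"
  shows "\<exists>a>0. \<exists>F :: real^4 \<Rightarrow> real^4.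
           (\<forall>p q. dist (F p) (F q) = dist p q) \<and>
           openin (top_of_set (model_image a)) (F ` \<iota> ` topspace M)"
proof -
  obtain p0 c E B where p0: "p0 \<in> model_points M \<iota> c E B"
    using model_points_nonempty[OF assms(4,3)] by blast
  have c: "c > 0" and E: "norm E = 1" using norm_axis_model_points[OF p0] by auto
  have all: "model_points M \<iota> c E B = topspace M"
  proof -
    have "model_points M \<iota> c E B = {} \<or> model_points M \<iota> c E B = topspace M"
      using assms(2) unfolding connected_space_clopen_in
      using openin_model_points[of M \<iota> c E B] closedin_model_points[OF assms(1,4) c, of E B] by blast
    then show ?thesis using p0 by auto
  qed
  \<comment> \<open>The axis direction becomes the fourth coordinate direction and \<open>B\<close>
    the origin. As \<open>E\<close> and \<open>B\<close> are now the same for all of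
    \<open>M\<close>, one isometry serves every chart.\<close>
  obtain O' :: "real^4 \<Rightarrow> real^4" where O': "orthogonal_transformation O'" "O' E = axis 4 1"
    by (rule orthogonal_transformation_exists_1[OF E norm_axis_1])
  define F where "F p = O' (p - B)" for p
  have "dist (F p) (F q) = dist p q" for p q
  proof -
    have "dist (F p) (F q) = dist (p - B) (q - B)"
      using O'(1) unfolding orthogonal_transformation_isometry F_def by blast
    then show ?thesis by (simp add: dist_norm)
  qed
  moreover have "openin (top_of_set (model_image (sqrt (2 * c)))) (F ` \<iota> ` topspace M)"
  \<comment> \<open>Relative openness is local, so it suffices that every chart ball has open image;
    since the immersion may self-intersect, the pieces may overlap.\<close>
  proof (subst openin_subopen, rule ballI)
    fix y assume "y \<in> F ` \<iota> ` topspace M"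
    then obtain p where p: "p \<in> model_points M \<iota> c E B" "y = F (\<iota> p)" using all by blast
    then obtain U x u r where *: "local_param M \<iota> U x" "ball u r \<subseteq> U" "p \<in> x ` ball u r"
     "adapted (ball u r) (\<iota> \<circ> x) c E B" unfolding model_points_def by blast
    have "openin (top_of_set (model_image (sqrt (2 * c)))) (F ` (\<iota> \<circ> x) ` ball u r)"
      unfolding F_def[abs_def]
      by (rule adapted_image_openin[OF open_ball convex_ball *(4) c _ O']) (use local_paramD(5)[OF *(1)] *(2) in blast)
    moreover have "y \<in> F ` (\<iota> \<circ> x) ` ball u r" using p(2) *(3) by auto
    moreover have "F ` (\<iota> \<circ> x) ` ball u r \<subseteq> F ` \<iota> ` topspace M"
    proof -
      have "x ` ball u r \<subseteq> topspace M" using chart_image_open[OF *(1) open_ball *(2)] by (rule openin_subset)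
      then show ?thesis by auto
    qed
    ultimately show "\<exists>T. openin (top_of_set (model_image (sqrt (2 * c)))) T \<and> y \<in> T \<and> T \<subseteq> F ` \<iota> ` topspace M" by blast
  qed
  ultimately show ?thesis using c by (intro exI[of _ "sqrt (2 * c)"]) auto
qed

end
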